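(* Let $(\nu,\nu')$ be a regular couple of characters of $(\mathcal O_r^E)^\times$ and let $\mathcal C_{\nu,\nu'}$ be the associated cuspidal representation of $GL(2,\mathcal O_r)$. For every $0\le i\le r-1$ and $\alpha,\delta\in\mathcal O_r^\times$ with $\alpha-\delta\in\varpi^i\mathcal O_r^\times$, the character of $\mathcal C_{\nu,\nu'}$ at $D_{i,\alpha,\delta}=\begin{pmatrix}\alpha&0\\0&\delta\end{pmatrix}$ is $$\mathrm{tr}(D_{i,\alpha,\delta}|_{\mathcal C_{\nu,\nu'}})=0.$$
   Context: $F$ is a non-archimedean local field with ring of integers $\mathcal O$, uniformizer $\varpi$, residue field of cardinality $q$ and characteristic $p\neq2$. $r\ge2$ is an even integer, $l=r/2$, $\mathcal O_r=\mathcal O/\varpi^r\mathcal O$, $G^{(r)}=GL(2,\mathcal O_r)$, $K_l=\{g\in G^{(r)}: g\equiv I \bmod \varpi^l\}$. $\psi:(\mathcal O,+)\to\mathbb C^\times$ is a fixed smooth additive character of level $r$ (trivial on $\varpi^r\mathcal O$ but not on $\varpi^{r-1}\mathcal O$), viewed as a character of $\mathcal O_r$. $E$ is the unramified quadratic extension of $F$, $\sigma$ the nontrivial element of $\mathrm{Gal}(E/F)$, $\mathcal O^E$ the ring of integers of $E$, $\mathcal O^E_k=\mathcal O^E/\varpi^k\mathcal O^E$; $Tr(x)=x+\sigma(x)$, $N(x)=x\sigma(x)$. Put $\mathcal O_r^{E(-)}=\{z\in\mathcal O_r^E:\sigma(z)=-z\}$. A couple $(\nu,\nu')$ of characters $(\mathcal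 O_r^E)^\times\to\mathbb C^\times$ is regular if the restriction of $\nu\nu'^{-1}$ to the group $1+\varpi^l\mathcal O_r^{E(-)}$ is of level $l$, i.e. nontrivial on $1+\varpi^{r-1}\mathcal O_r^{E(-)}$. To a regular couple is associated the unique $\tau\in\mathcal O_l^E$ such that $\nu(1+\varpi^lz)\,\nu'(1+\varpi^l\sigma(z))=\psi\big(\varpi^l(\tau z+\sigma(\tau)\sigma(z))\big)$ for all $z\in\mathcal O_r^E$; one has $\tau-\sigma(\tau)\not\equiv0$ mod $\varpi$. Let $\hat\tau\in\mathcal O_r^E$ be any lift of $\tau$, $\hat\beta=\begin{pmatrix}0&1\\-N(\hat\tau)&Tr(\hat\tau)\end{pmatrix}$, $S=\mathcal O_r[\hat\beta]^\times=\{aI+b\hat\beta: a,b\in\mathcal O_r\}\cap G^{(r)}$, $T=SK_l$. Then $\nu\boxtimes\nu'$ is the one-dimensional representation of $T$ defined by $(\nu\boxtimes\nu')(sk)=\nu(a+b\hat\tau)\,\nu'(a+b\sigma(\hat\tau))\,\psi(\mathrm{Tr}(\hat\beta(k-I)))$ for $s=aI+b\hat\beta\in S$, $k\in K_l$ (Tr being here the matrix trace), and $\mathcal C_{\nu,\nu'}=\mathrm{Ind}_T^{G^{(r)}}(\nu\boxtimes\nu')$. *)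

theory Defs
  imports Complex_Main "HOL-Algebra.Embedded_Algebras" "HOL-Algebra.Multiplicative_Group" "HOL-Library.Function_Algebras"
begin

section \<open>Local fields and unramified quadratic extensions\<close>

text \<open>The valuation is normalized and written additively; its value at zero is irrelevant.\<close>

definition val_ge :: "('a, 'b) ring_scheme \<Rightarrow> ('a \<Rightarrow> int) \<Rightarrow> int \<Rightarrow> 'a \<Rightarrow> bool" where
  "val_ge F v n x \<longleftrightarrow> x = \<zero>\<^bsub>F\<^esub> \<or> n \<le> v x"

definition valuation_ring :: "'a ring \<Rightarrow> ('a \<Rightarrow> int) \<Rightarrow> 'a ring" where
  "valuation_ring F v = F\<lparr>carrier := {x \<in> carrier F. val_ge F v 0 x}\<rparr>"

locale discrete_valuation_field = field F
  for F :: "'a ring" (structure) +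
  fixes v :: "'a \<Rightarrow> int" and \<pi> :: 'a
  assumes val_mult: "\<lbrakk>x \<in> carrier F - {\<zero>}; y \<in> carrier F - {\<zero>}\<rbrakk> \<Longrightarrow> v (x \<otimes> y) = v x + v y"
    and val_add: "\<lbrakk>x \<in> carrier F - {\<zero>}; y \<in> carrier F - {\<zero>}; x \<oplus> y \<noteq> \<zero>\<rbrakk>
      \<Longrightarrow> min (v x) (v y) \<le> v (x \<oplus> y)"
    and uniformizer_carrier: "\<pi> \<in> carrier F - {\<zero>}"
    and uniformizer_val: "v \<pi> = 1"

locale nonarch_local_field = discrete_valuation_field +
  assumes complete: "\<lbrakk>range s \<subseteq> carrier F;
        \<forall>N. \<exists>M::nat. \<forall>m\<ge>M. \<forall>n\<ge>M. val_ge F v N (s m \<ominus> s n)\<rbrakk>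
      \<Longrightarrow> \<exists>x\<in>carrier F. \<forall>N. \<exists>M. \<forall>n\<ge>M. val_ge F v N (s n \<ominus> x)"
    and finite_residue_field:
      "finite (carrier (valuation_ring F v Quot PIdl\<^bsub>valuation_ring F v\<^esub> \<pi>))"

definition residue_characteristic :: "'a ring \<Rightarrow> ('a \<Rightarrow> int) \<Rightarrow> 'a \<Rightarrow> nat" where
  "residue_characteristic F v \<pi> =
    (let k = valuation_ring F v Quot PIdl\<^bsub>valuation_ring F v\<^esub> \<pi>
     in group.ord (add_monoid k) \<one>\<^bsub>k\<^esub>)"

text \<open>
  \<open>F\<close> is a subfield of \<open>E\<close>, so the two share their operations.  That the extension is
  unramified is the assumption that the normalized valuation \<open>w\<close> of \<open>E\<close> extends the
  normalized valuation \<open>v\<close> of \<open>F\<close>, with \<open>\<pi>\<close> as a common uniformizer (the residue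
  extension is separable, since the residue field of \<open>F\<close> is finite).
\<close>

locale unramified_quadratic_extension =
  base: nonarch_local_field F v \<pi> + ext: discrete_valuation_field E w \<pi>
  for F :: "'a ring" and v :: "'a \<Rightarrow> int" and \<pi> :: 'a and E :: "'a ring" and w :: "'a \<Rightarrow> int" +
  fixes \<sigma> :: "'a \<Rightarrow> 'a"
  assumes subfield: "subfield (carrier F) E"
    and restrict: "F = E\<lparr>carrier := carrier F\<rparr>"
    and degree_two: "ext.dimension 2 (carrier F) (carrier E)"
    and val_extends: "x \<in> carrier F - {\<zero>\<^bsub>F\<^esub>} \<Longrightarrow> w x = v x"
    and galois_iso: "\<sigma> \<in> ring_iso E E"
    and galois_fixes: "x \<in> carrier F \<Longrightarrow> \<sigma> x = x"
    and galois_nontrivial: "\<exists>x\<in>carrier E. \<sigma> x \<noteq> x"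


section \<open>Truncated rings\<close>

text \<open>
  \<open>trunc R p k\<close> is \<open>R / p\<^sup>k R\<close>.  \<open>trunc_map S p k h\<close> is the map into \<open>S / p\<^sup>k S\<close> that a map
  \<open>h\<close> into \<open>S\<close> induces on cosets; it is only used where the induced map is well defined.
\<close>

definition trunc :: "'a ring \<Rightarrow> 'a \<Rightarrow> nat \<Rightarrow> 'a set ring" where
  "trunc R p k = R Quot PIdl\<^bsub>R\<^esub> (p [^]\<^bsub>R\<^esub> k)"

definition trunc_class :: "'a ring \<Rightarrow> 'a \<Rightarrow> nat \<Rightarrow> 'a \<Rightarrow> 'a set" where
  "trunc_class R p k x = PIdl\<^bsub>R\<^esub> (p [^]\<^bsub>R\<^esub> k) +>\<^bsub>R\<^esub> x"

definition trunc_map :: "'a ring \<Rightarrow> 'a \<Rightarrow> nat \<Rightarrow> ('a \<Rightarrow> 'a) \<Rightarrow> 'a set \<Rightarrow> 'a set" where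
  "trunc_map S p k h X = the_elem ((\<lambda>x. trunc_class S p k (h x)) ` X)"

text \<open>
  Below, \<open>A\<close> and \<open>B\<close> are the rings of integers of \<open>F\<close> and \<open>E\<close>.  \<open>trunc_embed\<close> is the
  injection of \<open>A / p\<^sup>k A\<close> into \<open>B / p\<^sup>k B\<close>, and \<open>trunc_descend\<close> is its inverse on its image,
  needed because trace and norm are to take values in \<open>A / p\<^sup>k A\<close>.
\<close>

definition trunc_embed :: "'a ring \<Rightarrow> 'a \<Rightarrow> nat \<Rightarrow> 'a set \<Rightarrow> 'a set" where
  "trunc_embed B p k = trunc_map B p k (\<lambda>x. x)"

definition trunc_descend :: "'a ring \<Rightarrow> 'a ring \<Rightarrow> 'a \<Rightarrow> nat \<Rightarrow> 'a set \<Rightarrow> 'a set" where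
  "trunc_descend A B p k = inv_into (carrier (trunc A p k)) (trunc_embed B p k)"

definition trunc_trace :: "'a ring \<Rightarrow> 'a ring \<Rightarrow> 'a \<Rightarrow> ('a \<Rightarrow> 'a) \<Rightarrow> nat \<Rightarrow> 'a set \<Rightarrow> 'a set" where
  "trunc_trace A B p \<sigma> k x =
    trunc_descend A B p k (x \<oplus>\<^bsub>trunc B p k\<^esub> trunc_map B p k \<sigma> x)"

definition trunc_norm :: "'a ring \<Rightarrow> 'a ring \<Rightarrow> 'a \<Rightarrow> ('a \<Rightarrow> 'a) \<Rightarrow> nat \<Rightarrow> 'a set \<Rightarrow> 'a set" where
  "trunc_norm A B p \<sigma> k x =
    trunc_descend A B p k (x \<otimes>\<^bsub>trunc B p k\<^esub> trunc_map B p k \<sigma> x)"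

definition trunc_minus_part :: "'a ring \<Rightarrow> 'a \<Rightarrow> ('a \<Rightarrow> 'a) \<Rightarrow> nat \<Rightarrow> 'a set set" where
  "trunc_minus_part B p \<sigma> k =
    {z \<in> carrier (trunc B p k). trunc_map B p k \<sigma> z = \<ominus>\<^bsub>trunc B p k\<^esub> z}"


section \<open>Characters\<close>

definition complex_units :: "complex monoid" where
  "complex_units = \<lparr>carrier = - {0}, mult = (*), one = 1\<rparr>"

text \<open>Such a character is automatically smooth, being trivial on \<open>p\<^sup>r A\<close>.\<close>

definition additive_character_of_level :: "'a ring \<Rightarrow> 'a \<Rightarrow> nat \<Rightarrow> ('a \<Rightarrow> complex) \<Rightarrow> bool" where
  "additive_character_of_level A p r \<psi> \<longleftrightarrow>
    \<psi> \<in> hom (add_monoid A) complex_units \<and>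
    (\<forall>x\<in>PIdl\<^bsub>A\<^esub> (p [^]\<^bsub>A\<^esub> r). \<psi> x = 1) \<and>
    (\<exists>x\<in>PIdl\<^bsub>A\<^esub> (p [^]\<^bsub>A\<^esub> (r - 1)). \<psi> x \<noteq> 1)"

definition trunc_char :: "('a \<Rightarrow> complex) \<Rightarrow> 'a set \<Rightarrow> complex" where
  "trunc_char \<psi> X = the_elem (\<psi> ` X)"

definition regular_couple ::
    "'a ring \<Rightarrow> 'a \<Rightarrow> ('a \<Rightarrow> 'a) \<Rightarrow> nat \<Rightarrow> ('a set \<Rightarrow> complex) \<Rightarrow> ('a set \<Rightarrow> complex) \<Rightarrow> bool" where
  "regular_couple B p \<sigma> r \<nu> \<nu>' \<longleftrightarrow>
    (let R = trunc B p r in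
      \<nu> \<in> hom (units_of R) complex_units \<and> \<nu>' \<in> hom (units_of R) complex_units \<and>
      (\<exists>z\<in>trunc_minus_part B p \<sigma> r.
        let u = \<one>\<^bsub>R\<^esub> \<oplus>\<^bsub>R\<^esub> trunc_class B p r (p [^]\<^bsub>B\<^esub> (r - 1)) \<otimes>\<^bsub>R\<^esub> z
        in \<nu> u * inverse (\<nu>' u) \<noteq> 1))"

text \<open>
  With \<open>l = r / 2\<close>, the sum \<open>\<tau> z + \<sigma>(\<tau>) \<sigma>(z)\<close> lives in \<open>A / p\<^sup>l A\<close> (with \<open>z\<close> reduced modulo
  \<open>p\<^sup>l\<close>), and multiplication by \<open>p\<^sup>l\<close> is a map from \<open>A / p\<^sup>l A\<close> to \<open>A / p\<^sup>r A\<close>.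
\<close>

definition associated_element ::
    "'a ring \<Rightarrow> 'a ring \<Rightarrow> 'a \<Rightarrow> ('a \<Rightarrow> 'a) \<Rightarrow> nat \<Rightarrow> ('a \<Rightarrow> complex)
      \<Rightarrow> ('a set \<Rightarrow> complex) \<Rightarrow> ('a set \<Rightarrow> complex) \<Rightarrow> 'a set \<Rightarrow> bool" where
  "associated_element A B p \<sigma> r \<psi> \<nu> \<nu>' \<tau> \<longleftrightarrow>
    (let l = r div 2; R = trunc B p r; Q = trunc B p l;
         pl = trunc_class B p r (p [^]\<^bsub>B\<^esub> l);
         red = trunc_map B p l (\<lambda>x. x);
         shift = trunc_map A p r (\<lambda>x. p [^]\<^bsub>A\<^esub> l \<otimes>\<^bsub>A\<^esub> x)
     in \<tau> \<in> carrier Q \<and>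
       (\<forall>z\<in>carrier R.
          \<nu> (\<one>\<^bsub>R\<^esub> \<oplus>\<^bsub>R\<^esub> pl \<otimes>\<^bsub>R\<^esub> z) * \<nu>' (\<one>\<^bsub>R\<^esub> \<oplus>\<^bsub>R\<^esub> pl \<otimes>\<^bsub>R\<^esub> trunc_map B p r \<sigma> z) =
          trunc_char \<psi> (shift (trunc_descend A B p l
            (\<tau> \<otimes>\<^bsub>Q\<^esub> red z \<oplus>\<^bsub>Q\<^esub> trunc_map B p l \<sigma> \<tau> \<otimes>\<^bsub>Q\<^esub> trunc_map B p l \<sigma> (red z))))))"


section \<open>Two by two matrices\<close>

text \<open>\<open>Mat2 a b c d\<close> has rows \<open>(a, b)\<close> and \<open>(c, d)\<close>.\<close>

datatype 'a mat2 = Mat2 (m11: 'a) (m12: 'a) (m21: 'a) (m22: 'a)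

definition mat2_ring :: "('a, 'b) ring_scheme \<Rightarrow> 'a mat2 ring" where
  "mat2_ring R =
    \<lparr>carrier = {X. set_mat2 X \<subseteq> carrier R},
     mult = (\<lambda>X Y. Mat2
       (m11 X \<otimes>\<^bsub>R\<^esub> m11 Y \<oplus>\<^bsub>R\<^esub> m12 X \<otimes>\<^bsub>R\<^esub> m21 Y) (m11 X \<otimes>\<^bsub>R\<^esub> m12 Y \<oplus>\<^bsub>R\<^esub> m12 X \<otimes>\<^bsub>R\<^esub> m22 Y)
       (m21 X \<otimes>\<^bsub>R\<^esub> m11 Y \<oplus>\<^bsub>R\<^esub> m22 X \<otimes>\<^bsub>R\<^esub> m21 Y) (m21 X \<otimes>\<^bsub>R\<^esub> m12 Y \<oplus>\<^bsub>R\<^esub> m22 X \<otimes>\<^bsub>R\<^esub> m22 Y)),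
     one = Mat2 \<one>\<^bsub>R\<^esub> \<zero>\<^bsub>R\<^esub> \<zero>\<^bsub>R\<^esub> \<one>\<^bsub>R\<^esub>,
     zero = Mat2 \<zero>\<^bsub>R\<^esub> \<zero>\<^bsub>R\<^esub> \<zero>\<^bsub>R\<^esub> \<zero>\<^bsub>R\<^esub>,
     add = (\<lambda>X Y. Mat2 (m11 X \<oplus>\<^bsub>R\<^esub> m11 Y) (m12 X \<oplus>\<^bsub>R\<^esub> m12 Y)
                       (m21 X \<oplus>\<^bsub>R\<^esub> m21 Y) (m22 X \<oplus>\<^bsub>R\<^esub> m22 Y))\<rparr>"

definition mat2_scale :: "('a, 'b) ring_scheme \<Rightarrow> 'a \<Rightarrow> 'a mat2 \<Rightarrow> 'a mat2" where
  "mat2_scale R a X = map_mat2 (\<lambda>x. a \<otimes>\<^bsub>R\<^esub> x) X"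

definition mat2_trace :: "('a, 'b) ring_scheme \<Rightarrow> 'a mat2 \<Rightarrow> 'a" where
  "mat2_trace R X = m11 X \<oplus>\<^bsub>R\<^esub> m22 X"

definition GL2 :: "('a, 'b) ring_scheme \<Rightarrow> 'a mat2 monoid" where
  "GL2 R = units_of (mat2_ring R)"

definition congruence_subgroup :: "('a, 'b) ring_scheme \<Rightarrow> 'a \<Rightarrow> 'a mat2 set" where
  "congruence_subgroup R c =
    {g \<in> carrier (GL2 R). set_mat2 (g \<ominus>\<^bsub>mat2_ring R\<^esub> \<one>\<^bsub>mat2_ring R\<^esub>) \<subseteq> PIdl\<^bsub>R\<^esub> c}"

definition lin_comb :: "('a, 'b) ring_scheme \<Rightarrow> 'a mat2 \<Rightarrow> 'a \<Rightarrow> 'a \<Rightarrow> 'a mat2" where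
  "lin_comb R \<beta> a b =
    mat2_scale R a \<one>\<^bsub>mat2_ring R\<^esub> \<oplus>\<^bsub>mat2_ring R\<^esub> mat2_scale R b \<beta>"

definition matrix_torus :: "('a, 'b) ring_scheme \<Rightarrow> 'a mat2 \<Rightarrow> 'a mat2 set" where
  "matrix_torus R \<beta> = {lin_comb R \<beta> a b | a b. a \<in> carrier R \<and> b \<in> carrier R} \<inter> carrier (GL2 R)"


section \<open>Induced representations of finite groups\<close>

definition fun_scale :: "complex \<Rightarrow> ('g \<Rightarrow> complex) \<Rightarrow> 'g \<Rightarrow> complex" where
  "fun_scale c f = (\<lambda>x. c * f x)"

interpretation fun_space: vector_space "fun_scale :: complex \<Rightarrow> ('g \<Rightarrow> complex) \<Rightarrow> 'g \<Rightarrow> complex"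
  by unfold_locales (auto simp: fun_scale_def fun_eq_iff algebra_simps)

text \<open>The trace of a linear operator \<open>L\<close> on a finite-dimensional space \<open>V\<close> of functions.\<close>

definition trace_on :: "('g \<Rightarrow> complex) set \<Rightarrow> (('g \<Rightarrow> complex) \<Rightarrow> 'g \<Rightarrow> complex) \<Rightarrow> complex" where
  "trace_on V L =
    (let B = (SOME B. fun_space.independent B \<and> fun_space.span B = V)
     in \<Sum>b\<in>B. fun_space.representation B (L b) b)"

text \<open>Functions on the group are extended by zero outside its carrier.\<close>

definition induced_space ::
    "('g, 'm) monoid_scheme \<Rightarrow> 'g set \<Rightarrow> ('g \<Rightarrow> complex) \<Rightarrow> ('g \<Rightarrow> complex) set" where
  "induced_space G T \<chi> =
    {f. (\<forall>x. x \<notin> carrier G \<longrightarrow> f x = 0) \<and>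
        (\<forall>t\<in>T. \<forall>x\<in>carrier G. f (t \<otimes>\<^bsub>G\<^esub> x) = \<chi> t * f x)}"

definition right_translation ::
    "('g, 'm) monoid_scheme \<Rightarrow> 'g \<Rightarrow> ('g \<Rightarrow> complex) \<Rightarrow> 'g \<Rightarrow> complex" where
  "right_translation G g f = (\<lambda>x. if x \<in> carrier G then f (x \<otimes>\<^bsub>G\<^esub> g) else 0)"

definition induced_character ::
    "('g, 'm) monoid_scheme \<Rightarrow> 'g set \<Rightarrow> ('g \<Rightarrow> complex) \<Rightarrow> 'g \<Rightarrow> complex" where
  "induced_character G T \<chi> g = trace_on (induced_space G T \<chi>) (right_translation G g)"


section \<open>The cuspidal representation attached to a regular couple\<close>

text \<open>In this section \<open>t\<close> is a lift to \<open>B / p\<^sup>r B\<close> of the element associated to the couple.\<close>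

definition beta_hat :: "'a ring \<Rightarrow> 'a ring \<Rightarrow> 'a \<Rightarrow> ('a \<Rightarrow> 'a) \<Rightarrow> nat \<Rightarrow> 'a set \<Rightarrow> 'a set mat2" where
  "beta_hat A B p \<sigma> r t =
    (let R = trunc A p r
     in Mat2 \<zero>\<^bsub>R\<^esub> \<one>\<^bsub>R\<^esub> (\<ominus>\<^bsub>R\<^esub> trunc_norm A B p \<sigma> r t) (trunc_trace A B p \<sigma> r t))"

definition level_subgroup :: "'a ring \<Rightarrow> 'a \<Rightarrow> nat \<Rightarrow> 'a set mat2 set" where
  "level_subgroup A p r =
    congruence_subgroup (trunc A p r) (trunc_class A p r (p [^]\<^bsub>A\<^esub> (r div 2)))"

definition inducing_subgroup ::
    "'a ring \<Rightarrow> 'a ring \<Rightarrow> 'a \<Rightarrow> ('a \<Rightarrow> 'a) \<Rightarrow> nat \<Rightarrow> 'a set \<Rightarrow> 'a set mat2 set" where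
  "inducing_subgroup A B p \<sigma> r t =
    matrix_torus (trunc A p r) (beta_hat A B p \<sigma> r t)
      <#>\<^bsub>GL2 (trunc A p r)\<^esub> level_subgroup A p r"

text \<open>The value does not depend on how the argument is written as a product \<open>s k\<close>.\<close>

definition inducing_character ::
    "'a ring \<Rightarrow> 'a ring \<Rightarrow> 'a \<Rightarrow> ('a \<Rightarrow> 'a) \<Rightarrow> nat \<Rightarrow> ('a \<Rightarrow> complex)
      \<Rightarrow> ('a set \<Rightarrow> complex) \<Rightarrow> ('a set \<Rightarrow> complex) \<Rightarrow> 'a set \<Rightarrow> 'a set mat2 \<Rightarrow> complex" where
  "inducing_character A B p \<sigma> r \<psi> \<nu> \<nu>' t x =
    (let R = trunc A p r; R' = trunc B p r; M = mat2_ring R;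
         \<beta> = beta_hat A B p \<sigma> r t; emb = trunc_embed B p r
     in THE c. \<exists>a\<in>carrier R. \<exists>b\<in>carrier R. \<exists>k\<in>level_subgroup A p r.
          lin_comb R \<beta> a b \<in> carrier (GL2 R) \<and>
          x = lin_comb R \<beta> a b \<otimes>\<^bsub>GL2 R\<^esub> k \<and>
          c = \<nu> (emb a \<oplus>\<^bsub>R'\<^esub> emb b \<otimes>\<^bsub>R'\<^esub> t) *
              \<nu>' (emb a \<oplus>\<^bsub>R'\<^esub> emb b \<otimes>\<^bsub>R'\<^esub> trunc_map B p r \<sigma> t) *
              trunc_char \<psi> (mat2_trace R (\<beta> \<otimes>\<^bsub>M\<^esub> (k \<ominus>\<^bsub>M\<^esub> \<one>\<^bsub>M\<^esub>))))"

definition cuspidal_character ::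
    "'a ring \<Rightarrow> 'a ring \<Rightarrow> 'a \<Rightarrow> ('a \<Rightarrow> 'a) \<Rightarrow> nat \<Rightarrow> ('a \<Rightarrow> complex)
      \<Rightarrow> ('a set \<Rightarrow> complex) \<Rightarrow> ('a set \<Rightarrow> complex) \<Rightarrow> 'a set \<Rightarrow> 'a set mat2 \<Rightarrow> complex" where
  "cuspidal_character A B p \<sigma> r \<psi> \<nu> \<nu>' t =
    induced_character (GL2 (trunc A p r)) (inducing_subgroup A B p \<sigma> r t)
      (inducing_character A B p \<sigma> r \<psi> \<nu> \<nu>' t)"

end

theory Submission
  imports Defs
begin

text \<open>
  Let \<open>\<rho>\<close> be the induced representation, \<open>D\<close> the diagonal matrix with entries \<open>\<alpha>, \<delta>\<close>, and for \<open>z\<close> in the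
  ideal \<open>I = \<pi>\<^sup>r\<^sup>-\<^sup>1 \<O>\<^sub>r\<close> let \<open>u\<^sub>z\<close> be the upper triangular unipotent matrix with corner \<open>z\<close>.  One
  argument covers every \<open>i\<close>, whether or not \<open>D\<close> is conjugate into the inducing subgroup: the sum of
  \<open>tr \<rho>(D u\<^sub>z)\<close> over \<open>z\<close> in \<open>I\<close> is computed in two ways (\<open>induced_character_eq_0\<close>).

  On the one hand, conjugating \<open>D\<close> by the unipotent matrix with corner \<open>m\<close> gives \<open>D u\<^sub>z\<close> with
  \<open>z = \<alpha>\<^sup>-\<^sup>1 (\<delta> - \<alpha>) m\<close>.  As \<open>\<alpha> - \<delta>\<close> is a unit times \<open>\<pi>\<^sup>i\<close> with \<open>i \<le> r - 1\<close>, every \<open>z\<close> in \<open>I\<close>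
  arises.  So all \<open>D u\<^sub>z\<close> are conjugate to \<open>D\<close> and the sum is \<open>card I \<cdot> tr \<rho>(D)\<close>.

  On the other hand the sum of the operators \<open>\<rho>(u\<^sub>z)\<close> is zero, which is the strong form of
  cuspidality.  All conjugates \<open>x u\<^sub>z x\<^sup>-\<^sup>1\<close> lie in \<open>K\<^sub>l\<close>, and the inducing character takes the
  value \<open>\<psi> (Tr (\<beta> (x u\<^sub>z x\<^sup>-\<^sup>1 - 1))) = \<psi> (z C)\<close> there, where \<open>C\<close> is the lower left entry of
  \<open>x\<^sup>-\<^sup>1 \<beta> x\<close> (\<open>inducing_character_on_level_subgroup\<close>).  By regularity the eigenvalues of \<open>\<beta>\<close> are
  distinct modulo \<open>\<pi>\<close> (\<open>t_regular\<close>); being exchanged by \<open>\<sigma>\<close>, they do not lie in the residue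
  field of \<open>F\<close>, so \<open>\<beta>\<close> has no eigenvector modulo \<open>\<pi>\<close> and \<open>C\<close> is a unit
  (\<open>conjugate_corner_not_in_PIdl\<close>).  Hence \<open>z \<mapsto> \<psi> (z C)\<close> is a nontrivial character of \<open>I\<close>, and its
  sum vanishes (\<open>character_sum_socle\<close>).

  All of this takes place over two rings \<open>A \<subseteq> B\<close> with an involution \<open>\<sigma>\<close> of \<open>B\<close>, as collected in
  \<open>quadratic_integers\<close>.  That the rings of integers of an unramified quadratic extension are an
  instance rests on the fact that \<open>\<sigma>\<close> preserves integrality (\<open>galois_integral\<close>), for which the
  completeness of \<open>F\<close> is essential: over a field that is not complete the ideal \<open>\<pi>\<close> could split in \<open>E\<close>.
\<close>

section \<open>Vanishing of induced characters\<close>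

text \<open>
  The trace of an induced representation is a sum over one chosen basis.  This is
  \<open>tr (X Y) = tr (Y X)\<close> for that fixed basis, so that conjugation invariance of the trace
  needs no comparison of bases.
\<close>

lemma fun_space_trace_commute:
  fixes X Y :: "('g \<Rightarrow> complex) \<Rightarrow> 'g \<Rightarrow> complex"
  assumes ind: "fun_space.independent B" and fin: "finite B"
    and linX: "Vector_Spaces.linear fun_scale fun_scale X"
    and linY: "Vector_Spaces.linear fun_scale fun_scale Y"
    and X: "\<And>b. b \<in> B \<Longrightarrow> X b \<in> fun_space.span B"
    and Y: "\<And>b. b \<in> B \<Longrightarrow> Y b \<in> fun_space.span B"
  shows "(\<Sum>b\<in>B. fun_space.representation B (X (Y b)) b) =
         (\<Sum>b\<in>B. fun_space.representation B (Y (X b)) b)"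
proof -
  have expand: "fun_space.representation B (P (Q b)) b =
      (\<Sum>c\<in>B. fun_space.representation B (Q b) c * fun_space.representation B (P c) b)"
    if linP: "Vector_Spaces.linear fun_scale fun_scale P"
      and P: "\<And>b. b \<in> B \<Longrightarrow> P b \<in> fun_space.span B"
      and Q: "\<And>b. b \<in> B \<Longrightarrow> Q b \<in> fun_space.span B"
      and b: "b \<in> B" for P Q b
  proof -
    interpret P: module_hom fun_scale fun_scale P
      using linP by (simp add: linear_iff_module_hom)
    let ?r = "\<lambda>c. fun_space.representation B (Q b) c"
    have "Q b = (\<Sum>c\<in>B. fun_scale (?r c) c)"
      using fun_space.sum_representation_eq[OF ind Q[OF b] fin] by simp
    then have "P (Q b) = P (\<Sum>c\<in>B. fun_scale (?r c) c)" by simp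
    also have "\<dots> = (\<Sum>c\<in>B. fun_scale (?r c) (P c))"
      by (simp add: P.sum P.scale)
    finally have "fun_space.representation B (P (Q b)) =
        (\<lambda>d. \<Sum>c\<in>B. fun_space.representation B (fun_scale (?r c) (P c)) d)"
      using fun_space.representation_sum[OF ind, of B "\<lambda>c. fun_scale (?r c) (P c)"]
      by (simp add: P fun_space.span_scale)
    then show ?thesis
      by (simp add: fun_space.representation_scale[OF ind] P)
  qed
  have "(\<Sum>b\<in>B. fun_space.representation B (X (Y b)) b) =
      (\<Sum>b\<in>B. \<Sum>c\<in>B. fun_space.representation B (Y b) c * fun_space.representation B (X c) b)"
    by (intro sum.cong refl expand linX X Y)
  also have "\<dots> = (\<Sum>c\<in>B. \<Sum>b\<in>B. fun_space.representation B (X c) b * fun_space.representation B (Y b) c)"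
    by (subst sum.swap) (simp add: mult.commute)
  also have "\<dots> = (\<Sum>c\<in>B. fun_space.representation B (Y (X c)) c)"
    by (intro sum.cong refl expand[symmetric] linY X Y)
  finally show ?thesis .
qed

lemma right_translation_linear:
  "Vector_Spaces.linear fun_scale fun_scale (right_translation G g)"
  by unfold_locales (auto simp: right_translation_def fun_scale_def fun_eq_iff algebra_simps)

lemma (in group) right_translation_mult:
  assumes "g \<in> carrier G" "h \<in> carrier G"
  shows "right_translation G (g \<otimes> h) f = right_translation G g (right_translation G h f)"
  using assms by (auto simp: right_translation_def fun_eq_iff m_assoc)

lemma (in group) right_translation_induced_space:
  assumes "f \<in> induced_space G T \<chi>" "T \<subseteq> carrier G" "g \<in> carrier G"
  shows "right_translation G g f \<in> induced_space G T \<chi>"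
  using assms unfolding induced_space_def right_translation_def
  by (auto simp: m_assoc subset_iff)

lemma induced_space_subspace: "fun_space.subspace (induced_space G T \<chi>)"
  unfolding fun_space.subspace_def induced_space_def
  by (auto simp: fun_scale_def algebra_simps)

text \<open>
  The vanishing mechanism.  Summing the trace of \<open>g u\<^sub>z\<close> over \<open>z\<close> in two ways gives
  \<open>card Z \<cdot> tr g\<close>, since every \<open>g u\<^sub>z\<close> is conjugate to \<open>g\<close>, and the trace of \<open>g\<close> composed with
  the sum of the \<open>u\<^sub>z\<close>.  That sum acts on a function \<open>f\<close> of the induced space at the point \<open>x\<close> by
  the scalar of the last hypothesis, because \<open>f (x u\<^sub>z) = \<chi> (x u\<^sub>z x\<^sup>-\<^sup>1) f x\<close>.
\<close>

lemma (in group) induced_character_eq_0: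
  assumes T: "T \<subseteq> carrier G" and g: "g \<in> carrier G"
    and fin: "finite Z" and ne: "Z \<noteq> {}"
    and u: "\<And>z. z \<in> Z \<Longrightarrow> u z \<in> carrier G"
    and conj: "\<And>z. z \<in> Z \<Longrightarrow> \<exists>h\<in>carrier G. h \<otimes> g = (g \<otimes> u z) \<otimes> h"
    and mem: "\<And>x z. x \<in> carrier G \<Longrightarrow> z \<in> Z \<Longrightarrow> x \<otimes> u z \<otimes> inv x \<in> T"
    and sum0: "\<And>x. x \<in> carrier G \<Longrightarrow> (\<Sum>z\<in>Z. \<chi> (x \<otimes> u z \<otimes> inv x)) = 0"
  shows "induced_character G T \<chi> g = 0"
proof -
  let ?V = "induced_space G T \<chi>" and ?\<rho> = "right_translation G"
  define B where "B = (SOME B. fun_space.independent B \<and> fun_space.span B = ?V)"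
  have "\<exists>B. fun_space.independent B \<and> fun_space.span B = ?V"
    using fun_space.basis_exists[of ?V] induced_space_subspace[of G T \<chi>]
    by (metis fun_space.span_eq_iff fun_space.span_mono subset_antisym)
  then have "fun_space.independent B \<and> fun_space.span B = ?V"
    unfolding B_def by (rule someI_ex)
  then have ind: "fun_space.independent B" and span: "fun_space.span B = ?V" by auto
  define tr where "tr L = (\<Sum>b\<in>B. fun_space.representation B (L b) b)" for L
  have char_eq: "induced_character G T \<chi> h = tr (?\<rho> h)" for h
    unfolding induced_character_def trace_on_def tr_def B_def Let_def ..
  show ?thesis
  proof (cases "finite B")
    \<comment> \<open>a sum over an infinite basis is zero by convention\<close>
    case False
    then show ?thesis by (simp add: char_eq tr_def)
  next
    case finB: True
    have BV: "b \<in> ?V" if "b \<in> B" for b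
      using that span fun_space.span_base by blast
    have \<rho>V: "?\<rho> h b \<in> ?V" if "b \<in> B" "h \<in> carrier G" for b h
      using right_translation_induced_space[OF BV[OF that(1)] T that(2)] .
    have conj_inv: "tr (?\<rho> (g \<otimes> u z)) = tr (?\<rho> g)" if z: "z \<in> Z" for z
    proof -
      obtain h where h: "h \<in> carrier G" and hg: "h \<otimes> g = (g \<otimes> u z) \<otimes> h"
        using conj[OF z] by blast
      note cl = g h u[OF z]
      have "g \<otimes> u z = h \<otimes> (g \<otimes> inv h)"
        using cl hg by (metis m_assoc m_closed inv_closed r_inv r_one)
      moreover have "?\<rho> (h \<otimes> (g \<otimes> inv h)) = (\<lambda>b. ?\<rho> h (?\<rho> (g \<otimes> inv h) b))"
        by (rule ext, rule right_translation_mult) (use cl in auto)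
      ultimately have "tr (?\<rho> (g \<otimes> u z)) = tr (\<lambda>b. ?\<rho> h (?\<rho> (g \<otimes> inv h) b))"
        by simp
      also have "\<dots> = tr (\<lambda>b. ?\<rho> (g \<otimes> inv h) (?\<rho> h b))"
        unfolding tr_def
        using cl \<rho>V span
        by (intro fun_space_trace_commute[OF ind finB] right_translation_linear) auto
      also have "\<dots> = tr (?\<rho> g)"
        unfolding tr_def
      proof (intro sum.cong refl)
        fix b assume b: "b \<in> B"
        have "?\<rho> (g \<otimes> inv h) (?\<rho> h b) = ?\<rho> g b"
          using cl by (simp flip: right_translation_mult add: m_assoc)
        then show "fun_space.representation B (?\<rho> (g \<otimes> inv h) (?\<rho> h b)) b =
          fun_space.representation B (?\<rho> g b) b" by simp
      qed
      finally show ?thesis .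
    qed
    have avg: "(\<Sum>z\<in>Z. ?\<rho> (g \<otimes> u z) b) = 0" if b: "b \<in> B" for b
    proof
      fix x
      have *: "b (y \<otimes> u z) = \<chi> (y \<otimes> u z \<otimes> inv y) * b y" if y: "y \<in> carrier G" and z: "z \<in> Z" for y z
      proof -
        have "b (y \<otimes> u z) = b ((y \<otimes> u z \<otimes> inv y) \<otimes> y)"
          using y u[OF z] by (simp add: m_assoc)
        also have "\<dots> = \<chi> (y \<otimes> u z \<otimes> inv y) * b y"
          using BV[OF b] mem[OF y z] y unfolding induced_space_def by blast
        finally show ?thesis .
      qed
      have "(\<Sum>z\<in>Z. ?\<rho> (g \<otimes> u z) b) x = (\<Sum>z\<in>Z. ?\<rho> (g \<otimes> u z) b x)"
        using fin by (induction Z rule: finite_induct) auto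
      also have "\<dots> = 0"
      proof (cases "x \<in> carrier G")
        case True
        then have "(\<Sum>z\<in>Z. ?\<rho> (g \<otimes> u z) b x) =
            (\<Sum>z\<in>Z. \<chi> ((x \<otimes> g) \<otimes> u z \<otimes> inv (x \<otimes> g)) * b (x \<otimes> g))"
          using g u by (intro sum.cong refl) (simp add: right_translation_def * flip: m_assoc)
        also have "\<dots> = 0"
          using True g sum0 by (simp flip: sum_distrib_right)
        finally show ?thesis .
      qed (simp add: right_translation_def)
      finally show "(\<Sum>z\<in>Z. ?\<rho> (g \<otimes> u z) b) x = 0 x" by simp
    qed
    have "of_nat (card Z) * tr (?\<rho> g) = (\<Sum>z\<in>Z. tr (?\<rho> (g \<otimes> u z)))"
      by (simp add: conj_inv)
    also have "\<dots> = (\<Sum>b\<in>B. \<Sum>z\<in>Z. fun_space.representation B (?\<rho> (g \<otimes> u z) b) b)"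
      unfolding tr_def by (rule sum.swap)
    also have "\<dots> = (\<Sum>b\<in>B. fun_space.representation B (\<Sum>z\<in>Z. ?\<rho> (g \<otimes> u z) b) b)"
      using g u by (intro sum.cong refl)
        (subst fun_space.representation_sum[OF ind], auto simp: span \<rho>V)
    also have "\<dots> = 0"
      by (simp add: avg fun_space.representation_zero)
    finally show ?thesis
      using fin ne by (simp add: char_eq)
  qed
qed

section \<open>Two by two matrices over a commutative ring\<close>

context cring begin

lemma mat2_simps:
  "Mat2 a b c d \<in> carrier (mat2_ring R) \<longleftrightarrow>
     a \<in> carrier R \<and> b \<in> carrier R \<and> c \<in> carrier R \<and> d \<in> carrier R"
  "Mat2 a b c d \<otimes>\<^bsub>mat2_ring R\<^esub> Mat2 a' b' c' d' =
     Mat2 (a \<otimes> a' \<oplus> b \<otimes> c') (a \<otimes> b' \<oplus> b \<otimes> d') (c \<otimes> a' \<oplus> d \<otimes> c') (c \<otimes> b' \<oplus> d \<otimes> d')"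
  "Mat2 a b c d \<oplus>\<^bsub>mat2_ring R\<^esub> Mat2 a' b' c' d' = Mat2 (a \<oplus> a') (b \<oplus> b') (c \<oplus> c') (d \<oplus> d')"
  "\<one>\<^bsub>mat2_ring R\<^esub> = Mat2 \<one> \<zero> \<zero> \<one>"
  "\<zero>\<^bsub>mat2_ring R\<^esub> = Mat2 \<zero> \<zero> \<zero> \<zero>"
  by (auto simp: mat2_ring_def)

lemma ring_mat2_ring: "ring (mat2_ring R)"
proof (rule ringI)
  show "abelian_group (mat2_ring R)"
  proof (rule abelian_groupI)
    fix X assume "X \<in> carrier (mat2_ring R)"
    then show "\<exists>Y\<in>carrier (mat2_ring R). Y \<oplus>\<^bsub>mat2_ring R\<^esub> X = \<zero>\<^bsub>mat2_ring R\<^esub>"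
      by (cases X, intro bexI[of _ "Mat2 (\<ominus> m11 X) (\<ominus> m12 X) (\<ominus> m21 X) (\<ominus> m22 X)"])
        (auto simp: mat2_simps l_neg)
  next
    fix X Y Z assume "X \<in> carrier (mat2_ring R)" "Y \<in> carrier (mat2_ring R)" "Z \<in> carrier (mat2_ring R)"
    then show "X \<oplus>\<^bsub>mat2_ring R\<^esub> Y \<oplus>\<^bsub>mat2_ring R\<^esub> Z = X \<oplus>\<^bsub>mat2_ring R\<^esub> (Y \<oplus>\<^bsub>mat2_ring R\<^esub> Z)"
      by (cases X, cases Y, cases Z) (auto simp: mat2_simps a_assoc)
  next
    fix X Y assume "X \<in> carrier (mat2_ring R)" "Y \<in> carrier (mat2_ring R)"
    then show "X \<oplus>\<^bsub>mat2_ring R\<^esub> Y \<in> carrier (mat2_ring R)" "X \<oplus>\<^bsub>mat2_ring R\<^esub> Y = Y \<oplus>\<^bsub>mat2_ring R\<^esub> X"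
      by (cases X, cases Y, auto simp: mat2_simps a_comm)+
  next
    fix X assume "X \<in> carrier (mat2_ring R)"
    then show "\<zero>\<^bsub>mat2_ring R\<^esub> \<oplus>\<^bsub>mat2_ring R\<^esub> X = X"
      by (cases X) (auto simp: mat2_simps)
  qed (auto simp: mat2_simps)
  show "Group.monoid (mat2_ring R)"
  proof (rule monoidI)
    fix X Y Z assume "X \<in> carrier (mat2_ring R)" "Y \<in> carrier (mat2_ring R)" "Z \<in> carrier (mat2_ring R)"
    then show "X \<otimes>\<^bsub>mat2_ring R\<^esub> Y \<otimes>\<^bsub>mat2_ring R\<^esub> Z = X \<otimes>\<^bsub>mat2_ring R\<^esub> (Y \<otimes>\<^bsub>mat2_ring R\<^esub> Z)"
      by (cases X, cases Y, cases Z) (simp add: mat2_simps, algebra)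
  next
    fix X Y assume "X \<in> carrier (mat2_ring R)" "Y \<in> carrier (mat2_ring R)"
    then show "X \<otimes>\<^bsub>mat2_ring R\<^esub> Y \<in> carrier (mat2_ring R)"
      by (cases X, cases Y, auto simp: mat2_simps)+
  next
    fix X assume "X \<in> carrier (mat2_ring R)"
    then show "\<one>\<^bsub>mat2_ring R\<^esub> \<otimes>\<^bsub>mat2_ring R\<^esub> X = X" "X \<otimes>\<^bsub>mat2_ring R\<^esub> \<one>\<^bsub>mat2_ring R\<^esub> = X"
      by (cases X, auto simp: mat2_simps)+
  qed (auto simp: mat2_simps)
next
  fix X Y Z assume "X \<in> carrier (mat2_ring R)" "Y \<in> carrier (mat2_ring R)" "Z \<in> carrier (mat2_ring R)"
  then show "(X \<oplus>\<^bsub>mat2_ring R\<^esub> Y) \<otimes>\<^bsub>mat2_ring R\<^esub> Z = X \<otimes>\<^bsub>mat2_ring R\<^esub> Z \<oplus>\<^bsub>mat2_ring R\<^esub> Y \<otimes>\<^bsub>mat2_ring R\<^esub> Z"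
    "Z \<otimes>\<^bsub>mat2_ring R\<^esub> (X \<oplus>\<^bsub>mat2_ring R\<^esub> Y) = Z \<otimes>\<^bsub>mat2_ring R\<^esub> X \<oplus>\<^bsub>mat2_ring R\<^esub> Z \<otimes>\<^bsub>mat2_ring R\<^esub> Y"
    by (cases X, cases Y, cases Z, simp add: mat2_simps, algebra)+
qed

lemma mat2_a_inv:
  assumes "a \<in> carrier R" "b \<in> carrier R" "c \<in> carrier R" "d \<in> carrier R"
  shows "\<ominus>\<^bsub>mat2_ring R\<^esub> Mat2 a b c d = Mat2 (\<ominus> a) (\<ominus> b) (\<ominus> c) (\<ominus> d)"
proof -
  interpret M: ring "mat2_ring R" by (rule ring_mat2_ring)
  show ?thesis
    by (rule M.minus_equality) (use assms in \<open>auto simp: mat2_simps l_neg\<close>)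
qed

lemma mat2_minus:
  assumes "a' \<in> carrier R" "b' \<in> carrier R" "c' \<in> carrier R" "d' \<in> carrier R"
  shows "Mat2 a b c d \<ominus>\<^bsub>mat2_ring R\<^esub> Mat2 a' b' c' d' = Mat2 (a \<ominus> a') (b \<ominus> b') (c \<ominus> c') (d \<ominus> d')"
  using assms by (simp add: a_minus_def mat2_a_inv mat2_simps)

lemma lin_comb_Mat2:
  assumes "a \<in> carrier R" "b \<in> carrier R" "n \<in> carrier R" "t \<in> carrier R"
  shows "lin_comb R (Mat2 \<zero> \<one> n t) a b = Mat2 a b (b \<otimes> n) (a \<oplus> b \<otimes> t)"
  using assms by (simp add: lin_comb_def mat2_scale_def mat2_simps)

lemma group_GL2: "group (GL2 R)"
proof -
  interpret M: ring "mat2_ring R" by (rule ring_mat2_ring)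
  show ?thesis unfolding GL2_def by (rule M.units_group)
qed

lemma GL2_carrier_iff:
  "X \<in> carrier (GL2 R) \<longleftrightarrow> X \<in> carrier (mat2_ring R) \<and>
    (\<exists>Y\<in>carrier (mat2_ring R). Y \<otimes>\<^bsub>mat2_ring R\<^esub> X = \<one>\<^bsub>mat2_ring R\<^esub> \<and> X \<otimes>\<^bsub>mat2_ring R\<^esub> Y = \<one>\<^bsub>mat2_ring R\<^esub>)"
  by (auto simp: GL2_def units_of_def Units_def)

lemma GL2_mult: "X \<otimes>\<^bsub>GL2 R\<^esub> Y = X \<otimes>\<^bsub>mat2_ring R\<^esub> Y"
  by (simp add: GL2_def units_of_def)

lemma GL2_one: "\<one>\<^bsub>GL2 R\<^esub> = Mat2 \<one> \<zero> \<zero> \<one>"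
  by (simp add: GL2_def units_of_def mat2_simps)

lemma Mat2_upper_unipotent: 
  assumes "z \<in> carrier R"
  shows "Mat2 \<one> z \<zero> \<one> \<in> carrier (GL2 R)"
  unfolding GL2_carrier_iff using assms
  by (auto simp: mat2_simps l_neg r_neg intro!: bexI[of _ "Mat2 \<one> (\<ominus> z) \<zero> \<one>"])

lemma Mat2_diag:
  assumes "a \<in> Units R" "d \<in> Units R"
  shows "Mat2 a \<zero> \<zero> d \<in> carrier (GL2 R)"
  unfolding GL2_carrier_iff using assms Units_closed[OF assms(1)] Units_closed[OF assms(2)]
  by (auto simp: mat2_simps intro!: bexI[of _ "Mat2 (inv a) \<zero> \<zero> (inv d)"])

lemma set_mat2_minus_one:
  assumes "Mat2 a b c d \<in> carrier (mat2_ring R)"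
  shows "Mat2 a b c d \<ominus>\<^bsub>mat2_ring R\<^esub> \<one>\<^bsub>mat2_ring R\<^esub> = Mat2 (a \<ominus> \<one>) b c (d \<ominus> \<one>)"
  using assms by (simp add: mat2_simps mat2_minus) (simp add: a_minus_def)

lemma congruence_subgroup_iff:
  "Mat2 a b c d \<in> congruence_subgroup R e \<longleftrightarrow> Mat2 a b c d \<in> carrier (GL2 R) \<and>
     {a \<ominus> \<one>, b, c, d \<ominus> \<one>} \<subseteq> PIdl e"
proof -
  have "Mat2 a b c d \<in> carrier (GL2 R) \<Longrightarrow> Mat2 a b c d \<in> carrier (mat2_ring R)"
    by (simp add: GL2_carrier_iff)
  then show ?thesis
    unfolding congruence_subgroup_def using set_mat2_minus_one by auto
qed

text \<open>
  Conjugating a diagonal matrix by a unipotent one multiplies it by a unipotent one; the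
  hypothesis says \<open>z = a\<^sup>-\<^sup>1 (d - a) m\<close> without dividing.
\<close>

lemma diag_unipotent_conj:
  assumes "a \<in> carrier R" "d \<in> carrier R" "z \<in> carrier R" "m \<in> carrier R"
    and "m \<otimes> d = a \<otimes> z \<oplus> a \<otimes> m"
  shows "Mat2 \<one> m \<zero> \<one> \<otimes>\<^bsub>GL2 R\<^esub> Mat2 a \<zero> \<zero> d =
    (Mat2 a \<zero> \<zero> d \<otimes>\<^bsub>GL2 R\<^esub> Mat2 \<one> z \<zero> \<one>) \<otimes>\<^bsub>GL2 R\<^esub> Mat2 \<one> m \<zero> \<one>"
  using assms by (simp add: GL2_mult mat2_simps, algebra)

lemma unipotent_conj:
  assumes x: "Mat2 x11 x12 x21 x22 \<in> carrier (mat2_ring R)"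
    and y: "Mat2 y11 y12 y21 y22 \<in> carrier (mat2_ring R)"
    and xy: "Mat2 x11 x12 x21 x22 \<otimes>\<^bsub>mat2_ring R\<^esub> Mat2 y11 y12 y21 y22 = \<one>\<^bsub>mat2_ring R\<^esub>"
    and z: "z \<in> carrier R"
  shows "Mat2 x11 x12 x21 x22 \<otimes>\<^bsub>mat2_ring R\<^esub> Mat2 \<one> z \<zero> \<one> \<otimes>\<^bsub>mat2_ring R\<^esub> Mat2 y11 y12 y21 y22 =
    Mat2 (\<one> \<oplus> z \<otimes> (x11 \<otimes> y21)) (z \<otimes> (x11 \<otimes> y22)) (z \<otimes> (x21 \<otimes> y21)) (\<one> \<oplus> z \<otimes> (x21 \<otimes> y22))"
proof -
  have e: "x11 \<otimes> y11 \<oplus> x12 \<otimes> y21 = \<one>" "x11 \<otimes> y12 \<oplus> x12 \<otimes> y22 = \<zero>"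
    "x21 \<otimes> y11 \<oplus> x22 \<otimes> y21 = \<zero>" "x21 \<otimes> y12 \<oplus> x22 \<otimes> y22 = \<one>"
    using xy by (simp_all add: mat2_simps)
  have "(p \<otimes> \<one> \<oplus> q \<otimes> \<zero>) \<otimes> u \<oplus> (p \<otimes> z \<oplus> q \<otimes> \<one>) \<otimes> w = (p \<otimes> u \<oplus> q \<otimes> w) \<oplus> z \<otimes> (p \<otimes> w)"
    if "p \<in> carrier R" "q \<in> carrier R" "u \<in> carrier R" "w \<in> carrier R" for p q u w
    using that z by algebra
  then show ?thesis
    using x y z by (simp add: mat2_simps e)
qed


lemma minus_eq_iff_add:
  assumes "x \<in> carrier R" "y \<in> carrier R" "z \<in> carrier R"
  shows "x \<ominus> y = z \<longleftrightarrow> x = y \<oplus> z"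
proof
  assume "x \<ominus> y = z"
  moreover have "y \<oplus> (x \<ominus> y) = x" using assms by algebra
  ultimately show "x = y \<oplus> z" by simp
next
  assume "x = y \<oplus> z"
  moreover have "y \<oplus> z \<ominus> y = z" using assms by algebra
  ultimately show "x \<ominus> y = z" by simp
qed

text \<open>
  The entries of \<open>s k = g\<close> with \<open>s = a + b \<beta>\<close> in the torus of \<open>\<beta> = ((0, 1), (n, t))\<close> and
  \<open>k = 1 + c k'\<close>, \<open>g = 1 + c g'\<close>.  Then \<open>s\<close> is itself \<open>1 + c (a' + b' \<beta>)\<close>, and as \<open>c\<^sup>2 = 0\<close> the
  perturbations add up: \<open>Tr (\<beta> (g - 1)) = Tr (\<beta> (s - 1)) + Tr (\<beta> (k - 1))\<close>.  The last equation is
  this one, \<open>t\<^sup>2 + 2 n\<close> being the trace of \<open>\<beta>\<^sup>2\<close>.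
\<close>

lemma torus_times_nilpotent:
  assumes cl: "a \<in> carrier R" "b \<in> carrier R" "n \<in> carrier R" "t \<in> carrier R" "c \<in> carrier R"
    "k11 \<in> carrier R" "k12 \<in> carrier R" "k21 \<in> carrier R" "k22 \<in> carrier R"
    "g11 \<in> carrier R" "g12 \<in> carrier R" "g21 \<in> carrier R" "g22 \<in> carrier R"
    and cc: "c \<otimes> c = \<zero>"
    and e11: "a \<otimes> (\<one> \<oplus> c \<otimes> k11) \<oplus> b \<otimes> (c \<otimes> k21) = \<one> \<oplus> c \<otimes> g11"
    and e12: "a \<otimes> (c \<otimes> k12) \<oplus> b \<otimes> (\<one> \<oplus> c \<otimes> k22) = c \<otimes> g12"
    and e21: "b \<otimes> n \<otimes> (\<one> \<oplus> c \<otimes> k11) \<oplus> (a \<oplus> b \<otimes> t) \<otimes> (c \<otimes> k21) = c \<otimes> g21"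
    and e22: "b \<otimes> n \<otimes> (c \<otimes> k12) \<oplus> (a \<oplus> b \<otimes> t) \<otimes> (\<one> \<oplus> c \<otimes> k22) = \<one> \<oplus> c \<otimes> g22"
  obtains a' b' where "a' \<in> carrier R" "b' \<in> carrier R" "a = \<one> \<oplus> c \<otimes> a'" "b = c \<otimes> b'"
    "c \<otimes> g21 \<oplus> (n \<otimes> (c \<otimes> g12) \<oplus> t \<otimes> (c \<otimes> g22)) =
      c \<otimes> (a' \<otimes> t \<oplus> b' \<otimes> (t \<otimes> t \<oplus> (n \<oplus> n))) \<oplus>
      (c \<otimes> k21 \<oplus> (n \<otimes> (c \<otimes> k12) \<oplus> t \<otimes> (c \<otimes> k22)))"
proof -
  define a' where "a' = g11 \<ominus> a \<otimes> k11 \<ominus> b \<otimes> k21"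
  define b' where "b' = g12 \<ominus> a \<otimes> k12 \<ominus> b \<otimes> k22"
  have cl': "a' \<in> carrier R" "b' \<in> carrier R" unfolding a'_def b'_def using cl by auto
  have "a = (a \<otimes> (\<one> \<oplus> c \<otimes> k11) \<oplus> b \<otimes> (c \<otimes> k21)) \<ominus> c \<otimes> (a \<otimes> k11 \<oplus> b \<otimes> k21)"
    using cl by algebra
  also have "\<dots> = \<one> \<oplus> c \<otimes> a'"
    unfolding e11 a'_def using cl by algebra
  finally have a: "a = \<one> \<oplus> c \<otimes> a'" .
  have "b = (a \<otimes> (c \<otimes> k12) \<oplus> b \<otimes> (\<one> \<oplus> c \<otimes> k22)) \<ominus> c \<otimes> (a \<otimes> k12 \<oplus> b \<otimes> k22)"
    using cl by algebra
  also have "\<dots> = c \<otimes> b'"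
    unfolding e12 b'_def using cl by algebra
  finally have b: "b = c \<otimes> b'" .
  have absorb_a: "a \<otimes> (c \<otimes> k) = c \<otimes> k" if "k \<in> carrier R" for k
  proof -
    have "a \<otimes> (c \<otimes> k) = c \<otimes> k \<oplus> (c \<otimes> c) \<otimes> (a' \<otimes> k)"
      unfolding a using cl cl' that by algebra
    then show ?thesis using cl cl' that by (simp add: cc)
  qed
  have absorb_b: "b \<otimes> (c \<otimes> k) = \<zero>" if "k \<in> carrier R" for k
  proof -
    have "b \<otimes> (c \<otimes> k) = (c \<otimes> c) \<otimes> (b' \<otimes> k)"
      unfolding b using cl cl' that by algebra
    then show ?thesis using cl cl' that by (simp add: cc)
  qed
  have g12: "c \<otimes> g12 = c \<otimes> k12 \<oplus> c \<otimes> b'"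
    using cl cl' unfolding e12[symmetric] by (simp add: r_distr absorb_a absorb_b flip: b)
  have "c \<otimes> g21 = b \<otimes> n \<oplus> n \<otimes> (b \<otimes> (c \<otimes> k11)) \<oplus> (a \<otimes> (c \<otimes> k21) \<oplus> t \<otimes> (b \<otimes> (c \<otimes> k21)))"
    using cl unfolding e21[symmetric] by algebra
  then have g21: "c \<otimes> g21 = c \<otimes> b' \<otimes> n \<oplus> c \<otimes> k21"
    using cl cl' by (simp add: absorb_a absorb_b) (simp add: b)
  have "\<one> \<oplus> c \<otimes> g22 = n \<otimes> (b \<otimes> (c \<otimes> k12)) \<oplus> a \<oplus> b \<otimes> t \<oplus> (a \<otimes> (c \<otimes> k22) \<oplus> t \<otimes> (b \<otimes> (c \<otimes> k22)))"
    using cl unfolding e22[symmetric] by algebra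
  also have "\<dots> = a \<oplus> b \<otimes> t \<oplus> c \<otimes> k22"
    using cl cl' by (simp add: absorb_a absorb_b)
  also have "\<dots> = \<one> \<oplus> (c \<otimes> a' \<oplus> c \<otimes> b' \<otimes> t \<oplus> c \<otimes> k22)"
    unfolding a b using cl cl' by algebra
  finally have g22: "c \<otimes> g22 = c \<otimes> a' \<oplus> c \<otimes> b' \<otimes> t \<oplus> c \<otimes> k22"
    using cl cl' by (simp del: b)
  show thesis
    by (rule that[OF cl' a b]) (unfold g12 g21 g22, use cl cl' in algebra)
qed

text \<open>
  Let \<open>\<beta> = ((0, 1), (n, t))\<close>.  For \<open>x\<close> invertible with inverse \<open>y\<close>, the second factor on the
  right is the lower left entry of \<open>x\<^sup>-\<^sup>1 \<beta> x\<close>, which measures how far the first basis vector is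
  from being an eigenvector of the conjugate.  Multiplied by \<open>- det x\<close> it is the characteristic
  polynomial of \<open>\<beta>\<close>, made homogeneous, at \<open>(x\<^sub>2\<^sub>1, x\<^sub>1\<^sub>1)\<close>.
\<close>

lemma norm_form_eq:
  assumes cl: "x11 \<in> carrier R" "x12 \<in> carrier R" "x21 \<in> carrier R" "x22 \<in> carrier R"
    "y21 \<in> carrier R" "y22 \<in> carrier R" "n \<in> carrier R" "t \<in> carrier R"
    and e1: "y21 \<otimes> x11 \<oplus> y22 \<otimes> x21 = \<zero>"
    and e2: "y21 \<otimes> x12 \<oplus> y22 \<otimes> x22 = \<one>"
  shows "x21 \<otimes> x21 \<ominus> t \<otimes> (x11 \<otimes> x21) \<ominus> n \<otimes> (x11 \<otimes> x11) =
    (x12 \<otimes> x21 \<ominus> x11 \<otimes> x22) \<otimes> (x21 \<otimes> y21 \<oplus> (n \<otimes> (x11 \<otimes> y22) \<oplus> t \<otimes> (x21 \<otimes> y22)))"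
proof -
  let ?d = "x12 \<otimes> x21 \<ominus> x11 \<otimes> x22"
  have "?d \<otimes> y22 = x12 \<otimes> (y21 \<otimes> x11 \<oplus> y22 \<otimes> x21) \<ominus> x11 \<otimes> (y21 \<otimes> x12 \<oplus> y22 \<otimes> x22)"
    using cl by algebra
  then have d22: "?d \<otimes> y22 = \<ominus> x11"
    unfolding e1 e2 using cl by algebra
  have "?d \<otimes> y21 = x21 \<otimes> (y21 \<otimes> x12 \<oplus> y22 \<otimes> x22) \<ominus> x22 \<otimes> (y21 \<otimes> x11 \<oplus> y22 \<otimes> x21)"
    using cl by algebra
  then have d21: "?d \<otimes> y21 = x21"
    unfolding e1 e2 using cl by algebra
  have "?d \<otimes> (x21 \<otimes> y21 \<oplus> (n \<otimes> (x11 \<otimes> y22) \<oplus> t \<otimes> (x21 \<otimes> y22))) =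
    x21 \<otimes> (?d \<otimes> y21) \<oplus> (n \<otimes> (x11 \<otimes> (?d \<otimes> y22)) \<oplus> t \<otimes> (x21 \<otimes> (?d \<otimes> y22)))"
    using cl by algebra
  also have "\<dots> = x21 \<otimes> x21 \<ominus> t \<otimes> (x11 \<otimes> x21) \<ominus> n \<otimes> (x11 \<otimes> x11)"
    unfolding d22 d21 using cl by algebra
  finally show ?thesis ..
qed

end

section \<open>Quotients by powers of an element\<close>

locale truncation = cring R for R :: "'a ring" (structure) + fixes p :: 'a
  assumes p_closed [simp, intro]: "p \<in> carrier R"
begin

lemma p_pow_closed [simp, intro]: "p [^] (k::nat) \<in> carrier R" by simp

lemma ideal_pow: "ideal (PIdl (p [^] (k::nat))) R"
  by (simp add: cgenideal_ideal)

lemma PIdl_iff: "y \<in> PIdl x \<longleftrightarrow> (\<exists>c\<in>carrier R. y = x \<otimes> c)" if "x \<in> carrier R"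
  using m_comm[OF that] by (force simp: cgenideal_def)

lemma cring_trunc: "cring (trunc R p k)"
  unfolding trunc_def by (rule ideal.quotient_is_cring[OF ideal_pow is_cring])

lemma trunc_class_hom: "trunc_class R p k \<in> ring_hom R (trunc R p k)"
  using ideal.rcos_ring_hom[OF ideal_pow] unfolding trunc_class_def trunc_def .

sublocale trunc_hom: ring_hom_cring R "trunc R p k" "trunc_class R p k" for k
  by (intro ring_hom_cring.intro is_cring cring_trunc ring_hom_cring_axioms.intro trunc_class_hom)

lemma carrier_trunc: "carrier (trunc R p k) = trunc_class R p k ` carrier R"
  unfolding trunc_def trunc_class_def by (auto simp: FactRing_def A_RCOSETS_def')

lemma trunc_class_eq_iff_minus:
  assumes "x \<in> carrier R" "y \<in> carrier R"
  shows "trunc_class R p k x = trunc_class R p k y \<longleftrightarrow> x \<ominus> y \<in> PIdl (p [^] k)"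
  unfolding trunc_class_def using quotient_eq_iff_same_a_r_cos[OF ideal_pow assms] by simp

lemma trunc_class_eq_iff:
  assumes "x \<in> carrier R" "y \<in> carrier R"
  shows "trunc_class R p k x = trunc_class R p k y \<longleftrightarrow> (\<exists>c\<in>carrier R. x = y \<oplus> p [^] k \<otimes> c)"
  using assms by (auto simp: trunc_class_eq_iff_minus PIdl_iff minus_eq_iff_add)

lemma trunc_class_eq_zero_iff:
  assumes "x \<in> carrier R"
  shows "trunc_class R p k x = \<zero>\<^bsub>trunc R p k\<^esub> \<longleftrightarrow> (\<exists>c\<in>carrier R. x = p [^] k \<otimes> c)"
  using trunc_class_eq_iff[OF assms zero_closed, of k] by simp

lemma mem_trunc_class_iff:
  assumes "x \<in> carrier R"
  shows "y \<in> trunc_class R p k x \<longleftrightarrow> y \<in> carrier R \<and> trunc_class R p k y = trunc_class R p k x"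
proof -
  interpret I: ideal "PIdl (p [^] k)" R by (rule ideal_pow)
  show ?thesis
    unfolding trunc_class_def
    using assms I.a_rcos_self I.a_repr_independence' I.a_elemrcos_carrier by blast
qed

lemma trunc_class_pow_shift:
  assumes "x \<in> carrier R" "y \<in> carrier R" "trunc_class R p m x = trunc_class R p m y"
  shows "trunc_class R p (l + m) (p [^] l \<otimes> x) = trunc_class R p (l + m) (p [^] l \<otimes> y)"
proof -
  obtain c where "c \<in> carrier R" "x = y \<oplus> p [^] m \<otimes> c"
    using assms trunc_class_eq_iff by blast
  then have "p [^] l \<otimes> x = p [^] l \<otimes> y \<oplus> p [^] (l + m) \<otimes> c"
    using assms by (simp add: r_distr nat_pow_mult flip: m_assoc)
  moreover have "p [^] l \<otimes> x \<in> carrier R" "p [^] l \<otimes> y \<in> carrier R"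
    using assms by auto
  ultimately show ?thesis
    using \<open>c \<in> carrier R\<close> by (intro trunc_class_eq_iff[THEN iffD2] bexI)
qed

lemma trunc_class_coarsen:
  assumes "x \<in> carrier R" "y \<in> carrier R" "trunc_class R p k x = trunc_class R p k y" "m \<le> k"
  shows "trunc_class R p m x = trunc_class R p m y"
proof -
  obtain c where "c \<in> carrier R" "x = y \<oplus> p [^] k \<otimes> c"
    using assms trunc_class_eq_iff by blast
  moreover have "p [^] k = p [^] m \<otimes> p [^] (k - m)"
    using \<open>m \<le> k\<close> by (simp add: nat_pow_mult)
  ultimately have "x = y \<oplus> p [^] m \<otimes> (p [^] (k - m) \<otimes> c)"
    by (simp add: m_assoc)
  moreover have "p [^] (k - m) \<otimes> c \<in> carrier R"
    using \<open>c \<in> carrier R\<close> by auto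
  ultimately show ?thesis
    by (intro trunc_class_eq_iff[THEN iffD2] assms(1,2) bexI)
qed

text \<open>
  \<open>trunc_map\<close> takes the only element of an image; this is its value whenever the induced map is
  well defined at the coset in question.
\<close>

lemma trunc_map_class:
  assumes "x \<in> carrier R"
    and "\<And>y. y \<in> carrier R \<Longrightarrow> trunc_class R p k y = trunc_class R p k x \<Longrightarrow>
      trunc_class S p m (h y) = trunc_class S p m (h x)"
  shows "trunc_map S p m h (trunc_class R p k x) = trunc_class S p m (h x)"
proof -
  have "x \<in> trunc_class R p k x"
    using assms(1) by (simp add: mem_trunc_class_iff)
  moreover have "trunc_class S p m (h y) = trunc_class S p m (h x)" if "y \<in> trunc_class R p k x" for y
    using that assms(2)[of y] unfolding mem_trunc_class_iff[OF assms(1)] by blast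
  ultimately have "(\<lambda>x. trunc_class S p m (h x)) ` trunc_class R p k x = {trunc_class S p m (h x)}"
    by blast
  then show ?thesis unfolding trunc_map_def by simp
qed

lemma trunc_char_class:
  assumes \<psi>: "\<psi> \<in> hom (add_monoid R) complex_units"
    and triv: "\<forall>x\<in>PIdl (p [^] k). \<psi> x = 1" and x: "x \<in> carrier R"
  shows "trunc_char \<psi> (trunc_class R p k x) = \<psi> x"
proof -
  have "\<psi> y = \<psi> x" if yx: "y \<in> carrier R \<and> trunc_class R p k y = trunc_class R p k x" for y
  proof -
    have "\<exists>c\<in>carrier R. y = x \<oplus> p [^] k \<otimes> c"
      using trunc_class_eq_iff[of y x k] yx x by (simp only: simp_thms)
    then obtain c where c: "c \<in> carrier R" and y: "y = x \<oplus> p [^] k \<otimes> c"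
      by blast
    have pc: "p [^] k \<otimes> c \<in> carrier R" using c by simp
    have "\<psi> y = \<psi> x * \<psi> (p [^] k \<otimes> c)"
      unfolding y using hom_mult[OF \<psi>, of x "p [^] k \<otimes> c"] x pc by (simp add: complex_units_def del: r_distr)
    moreover have "p [^] k \<otimes> c \<in> PIdl (p [^] k)"
      using c unfolding PIdl_iff[OF p_pow_closed] by blast
    ultimately show ?thesis using triv by simp
  qed
  moreover have "x \<in> trunc_class R p k x"
    using x by (simp add: mem_trunc_class_iff)
  moreover have "y \<in> carrier R \<and> trunc_class R p k y = trunc_class R p k x"
    if "y \<in> trunc_class R p k x" for y
    using that mem_trunc_class_iff[OF x] by simp
  ultimately have "\<psi> ` trunc_class R p k x = {\<psi> x}"
    by blast
  then show ?thesis unfolding trunc_char_def by simp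
qed

lemma trunc_char_add:
  assumes \<psi>: "\<psi> \<in> hom (add_monoid R) complex_units"
    and triv: "\<forall>x\<in>PIdl (p [^] k). \<psi> x = 1"
    and "X \<in> carrier (trunc R p k)" "Y \<in> carrier (trunc R p k)"
  shows "trunc_char \<psi> (X \<oplus>\<^bsub>trunc R p k\<^esub> Y) = trunc_char \<psi> X * trunc_char \<psi> Y"
proof -
  obtain x y where xy: "x \<in> carrier R" "y \<in> carrier R"
    and XY: "X = trunc_class R p k x" "Y = trunc_class R p k y"
    using assms(3,4) carrier_trunc by auto
  have "\<psi> (x \<oplus> y) = \<psi> x * \<psi> y"
    using hom_mult[OF \<psi>] xy by (simp add: complex_units_def)
  moreover have "X \<oplus>\<^bsub>trunc R p k\<^esub> Y = trunc_class R p k (x \<oplus> y)"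
    using xy XY by simp
  ultimately show ?thesis
    using xy XY by (simp only: trunc_char_class[OF \<psi> triv] a_closed)
qed

end


section \<open>Truncations of a quadratic extension of rings\<close>

text \<open>
  The properties that matter of the rings of integers \<open>A\<close> and \<open>B\<close> of an unramified quadratic extension.
  That \<open>B / A\<close> is without \<open>p\<close>-torsion makes \<open>A / p\<^sup>k A\<close> a subring of \<open>B / p\<^sup>k B\<close>; that \<open>p\<close> stays prime
  in \<open>B\<close> is inertness.
\<close>

locale quadratic_integers = B: domain B
  for A B :: "'a ring" and p :: 'a and \<sigma> :: "'a \<Rightarrow> 'a" +
  assumes subring_A: "subring (carrier A) B"
    and A_eq: "A = B\<lparr>carrier := carrier A\<rparr>"
    and p_A: "p \<in> carrier A"
    and \<sigma>_hom: "\<sigma> \<in> ring_hom B B"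
    and \<sigma>_invol: "x \<in> carrier B \<Longrightarrow> \<sigma> (\<sigma> x) = x"
    and \<sigma>_fixes: "x \<in> carrier A \<Longrightarrow> \<sigma> x = x"
    and trace_A: "x \<in> carrier B \<Longrightarrow> x \<oplus>\<^bsub>B\<^esub> \<sigma> x \<in> carrier A"
    and norm_A: "x \<in> carrier B \<Longrightarrow> x \<otimes>\<^bsub>B\<^esub> \<sigma> x \<in> carrier A"
    and saturated: "x \<in> carrier B \<Longrightarrow> p \<otimes>\<^bsub>B\<^esub> x \<in> carrier A \<Longrightarrow> x \<in> carrier A"
    and p_prime: "x \<in> carrier B \<Longrightarrow> y \<in> carrier B \<Longrightarrow> x \<otimes>\<^bsub>B\<^esub> y \<in> PIdl\<^bsub>B\<^esub> p \<Longrightarrow>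
      x \<in> PIdl\<^bsub>B\<^esub> p \<or> y \<in> PIdl\<^bsub>B\<^esub> p"
    and unit_A: "x \<in> carrier A \<Longrightarrow> x \<notin> PIdl\<^bsub>A\<^esub> p \<Longrightarrow> x \<in> Units A"
    and finite_residue: "finite (carrier (A Quot PIdl\<^bsub>A\<^esub> p))"
begin

lemma A_in_B [simp]: "x \<in> carrier A \<Longrightarrow> x \<in> carrier B"
  using subringE(1)[OF subring_A] by auto

lemma domain_A: "domain A"
  using B.subring_is_domain[OF subring_A] A_eq by simp

sublocale A: domain A by (rule domain_A)

sublocale At: truncation A p
  by unfold_locales (rule p_A)

sublocale Bt: truncation B p
  by unfold_locales (simp add: p_A)

sublocale \<sigma>: ring_hom_cring B B \<sigma>
  by unfold_locales (rule \<sigma>_hom)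

lemma A_ops: "mult A = mult B" "add A = add B" "one A = one B" "zero A = zero B"
  using arg_cong[OF A_eq, of mult] arg_cong[OF A_eq, of add] arg_cong[OF A_eq, of one]
    arg_cong[OF A_eq, of zero] by simp_all

lemma A_pow: "x [^]\<^bsub>A\<^esub> (k::nat) = x [^]\<^bsub>B\<^esub> k"
  using B.nat_pow_consistent[of x k "carrier A"] by (simp only: A_eq[symmetric])

lemma A_inv: "x \<in> carrier A \<Longrightarrow> \<ominus>\<^bsub>A\<^esub> x = \<ominus>\<^bsub>B\<^esub> x"
  using A.l_neg[of x] by (intro B.minus_equality[symmetric]) (auto simp: A_ops)

lemma A_minus: "y \<in> carrier A \<Longrightarrow> x \<ominus>\<^bsub>A\<^esub> y = x \<ominus>\<^bsub>B\<^esub> y"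
  by (simp add: a_minus_def A_ops A_inv)

lemma p_pow_A: "p [^]\<^bsub>B\<^esub> (k::nat) \<in> carrier A"
  using At.p_pow_closed[of k] by (simp add: A_pow)

lemma \<sigma>_p [simp]: "\<sigma> p = p"
  by (rule \<sigma>_fixes[OF p_A])

lemma saturated_pow:
  "x \<in> carrier B \<Longrightarrow> p [^]\<^bsub>B\<^esub> (k::nat) \<otimes>\<^bsub>B\<^esub> x \<in> carrier A \<Longrightarrow> x \<in> carrier A"
proof (induction k arbitrary: x)
  case (Suc k)
  have "p [^]\<^bsub>B\<^esub> k \<otimes>\<^bsub>B\<^esub> (p \<otimes>\<^bsub>B\<^esub> x) \<in> carrier A"
    using Suc.prems by (simp add: B.m_assoc p_A)
  then have "p \<otimes>\<^bsub>B\<^esub> x \<in> carrier A" by (rule Suc.IH[rotated]) (simp add: Suc.prems(1) p_A)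
  then show ?case by (rule saturated[OF Suc.prems(1)])
qed simp

text \<open>
  The restriction of the ideal \<open>p\<^sup>k B\<close> to \<open>A\<close> is \<open>p\<^sup>k A\<close>, because \<open>A\<close> is saturated in \<open>B\<close>.  Hence
  \<open>trunc_embed\<close> is injective and \<open>trunc_descend\<close> really inverts it.
\<close>

lemma trunc_class_A_iff_B:
  assumes "x \<in> carrier A" "y \<in> carrier A"
  shows "trunc_class A p k x = trunc_class A p k y \<longleftrightarrow> trunc_class B p k x = trunc_class B p k y"
proof -
  have "c \<in> carrier A" if "c \<in> carrier B" "x = y \<oplus>\<^bsub>B\<^esub> p [^]\<^bsub>B\<^esub> k \<otimes>\<^bsub>B\<^esub> c" for c
  proof -
    have "p [^]\<^bsub>B\<^esub> k \<otimes>\<^bsub>B\<^esub> c = x \<ominus>\<^bsub>B\<^esub> y"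
      using that assms by (intro B.minus_eq_iff_add[THEN iffD2, symmetric]) auto
    also have "\<dots> \<in> carrier A"
      using assms A.minus_closed[of x y] by (simp add: A_minus)
    finally show ?thesis using that saturated_pow by blast
  qed
  then show ?thesis
    using assms by (auto simp: At.trunc_class_eq_iff Bt.trunc_class_eq_iff A_ops A_pow)
qed

lemma trunc_embed_class:
  "a \<in> carrier A \<Longrightarrow> trunc_embed B p k (trunc_class A p k a) = trunc_class B p k a"
  unfolding trunc_embed_def using trunc_class_A_iff_B
  by (subst At.trunc_map_class) auto

lemma trunc_descend_class:
  assumes "a \<in> carrier A"
  shows "trunc_descend A B p k (trunc_class B p k a) = trunc_class A p k a"
proof -
  have "inj_on (trunc_embed B p k) (carrier (trunc A p k))"
    by (auto simp: At.carrier_trunc inj_on_def trunc_embed_class trunc_class_A_iff_B)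
  moreover have "trunc_class A p k a \<in> carrier (trunc A p k)"
    using assms by simp
  ultimately show ?thesis
    unfolding trunc_descend_def
    using inv_into_f_f[of "trunc_embed B p k" _ "trunc_class A p k a"] assms
    by (simp add: trunc_embed_class)
qed

lemma trunc_map_\<sigma>_class:
  assumes "x \<in> carrier B"
  shows "trunc_map B p k \<sigma> (trunc_class B p k x) = trunc_class B p k (\<sigma> x)"
proof (rule Bt.trunc_map_class[OF assms])
  fix y assume "y \<in> carrier B" "trunc_class B p k y = trunc_class B p k x"
  then obtain c where c: "c \<in> carrier B" "y = x \<oplus>\<^bsub>B\<^esub> p [^]\<^bsub>B\<^esub> k \<otimes>\<^bsub>B\<^esub> c"
    using assms Bt.trunc_class_eq_iff by blast
  then have "\<sigma> y = \<sigma> x \<oplus>\<^bsub>B\<^esub> p [^]\<^bsub>B\<^esub> k \<otimes>\<^bsub>B\<^esub> \<sigma> c"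
    using assms by simp
  then show "trunc_class B p k (\<sigma> y) = trunc_class B p k (\<sigma> x)"
    using c(1) assms \<open>y \<in> carrier B\<close>
    by (intro Bt.trunc_class_eq_iff[THEN iffD2] bexI[of _ "\<sigma> c"] \<sigma>.hom_closed)
qed

lemma trunc_map_reduce_class:
  "x \<in> carrier B \<Longrightarrow> m \<le> k \<Longrightarrow>
    trunc_map B p m (\<lambda>x. x) (trunc_class B p k x) = trunc_class B p m x"
  by (rule Bt.trunc_map_class, assumption, rule Bt.trunc_class_coarsen)

lemma trunc_map_shift_class:
  "x \<in> carrier A \<Longrightarrow>
    trunc_map A p (l + m) (\<lambda>x. p [^]\<^bsub>A\<^esub> l \<otimes>\<^bsub>A\<^esub> x) (trunc_class A p m x) =
    trunc_class A p (l + m) (p [^]\<^bsub>A\<^esub> l \<otimes>\<^bsub>A\<^esub> x)"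
  by (rule At.trunc_map_class, assumption, rule At.trunc_class_pow_shift)

lemma trunc_trace_class:
  "x \<in> carrier B \<Longrightarrow> trunc_trace A B p \<sigma> k (trunc_class B p k x) = trunc_class A p k (x \<oplus>\<^bsub>B\<^esub> \<sigma> x)"
  using trunc_descend_class[OF trace_A, of x k] Bt.trunc_hom.hom_add[of x "\<sigma> x" k]
  by (simp only: trunc_trace_def trunc_map_\<sigma>_class \<sigma>.hom_closed)

lemma trunc_norm_class:
  "x \<in> carrier B \<Longrightarrow> trunc_norm A B p \<sigma> k (trunc_class B p k x) = trunc_class A p k (x \<otimes>\<^bsub>B\<^esub> \<sigma> x)"
  using trunc_descend_class[OF norm_A, of x k] Bt.trunc_hom.hom_mult[of x "\<sigma> x" k]
  by (simp only: trunc_norm_def trunc_map_\<sigma>_class \<sigma>.hom_closed)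

lemma minus_in_PIdl_of_trunc_class_eq:
  assumes x: "x \<in> carrier A" and y: "y \<in> carrier A" and k: "0 < k"
    and eq: "trunc_class A p k x = trunc_class A p k y"
  shows "x \<ominus>\<^bsub>B\<^esub> y \<in> PIdl\<^bsub>B\<^esub> p"
proof -
  have "trunc_class B p k x = trunc_class B p k y"
    using eq trunc_class_A_iff_B[OF x y] by simp
  then have "trunc_class B p 1 x = trunc_class B p 1 y"
    by (rule Bt.trunc_class_coarsen[OF A_in_B[OF x] A_in_B[OF y]]) (use k in simp)
  then show ?thesis
    unfolding Bt.trunc_class_eq_iff_minus[OF A_in_B[OF x] A_in_B[OF y]] by simp
qed

end

section \<open>The inducing character on the congruence subgroup\<close>

text \<open>
  Here \<open>t\<close> is an element of \<open>B\<close> itself; its class modulo \<open>p\<^sup>r\<close> is the chosen lift and its class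
  modulo \<open>p\<^sup>l\<close> is the element associated to the couple.
\<close>

locale cuspidal_datum = quadratic_integers A B p \<sigma>
  for A B :: "'a ring" and p :: 'a and \<sigma> :: "'a \<Rightarrow> 'a" +
  fixes r l :: nat and \<psi> :: "'a \<Rightarrow> complex" and \<nu> \<nu>' :: "'a set \<Rightarrow> complex" and t :: 'a
  assumes r_eq: "r = l + l" and l_pos: "0 < l"
    and \<psi>_level: "additive_character_of_level A p r \<psi>"
    and regular: "regular_couple B p \<sigma> r \<nu> \<nu>'"
    and assoc: "associated_element A B p \<sigma> r \<psi> \<nu> \<nu>' (trunc_class B p l t)"
    and t_B [simp]: "t \<in> carrier B"
begin

lemma half: "r div 2 = l" by (simp add: r_eq)

lemma \<psi>_hom: "\<psi> \<in> hom (add_monoid A) complex_units"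
  and \<psi>_trivial: "\<forall>x\<in>PIdl\<^bsub>A\<^esub> (p [^]\<^bsub>A\<^esub> r). \<psi> x = 1"
  and \<psi>_nontrivial: "\<exists>x\<in>PIdl\<^bsub>A\<^esub> (p [^]\<^bsub>A\<^esub> (r - 1)). \<psi> x \<noteq> 1"
  using \<psi>_level unfolding additive_character_of_level_def by auto

lemma \<nu>'_hom: "\<nu>' \<in> hom (units_of (trunc B p r)) complex_units"
  using regular unfolding regular_couple_def by (auto simp: Let_def)

lemmas \<psi>_class = At.trunc_char_class[OF \<psi>_hom \<psi>_trivial]
lemmas \<psi>_add = At.trunc_char_add[OF \<psi>_hom \<psi>_trivial]

lemma \<psi>_eq_1:
  assumes "x \<in> carrier A" "c \<in> carrier B" "x = p [^]\<^bsub>B\<^esub> r \<otimes>\<^bsub>B\<^esub> c"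
  shows "\<psi> x = 1"
proof -
  have "c \<in> carrier A" using assms saturated_pow by blast
  then have "x \<in> PIdl\<^bsub>A\<^esub> (p [^]\<^bsub>A\<^esub> r)"
    unfolding At.PIdl_iff[OF At.p_pow_closed] using assms(3) by (auto simp: A_ops A_pow)
  then show ?thesis using \<psi>_trivial by blast
qed

text \<open>
  The condition that defines the associated element, read on representatives in \<open>B\<close>.
\<close>

lemma associated_formula:
  assumes z: "z \<in> carrier B"
  shows "\<nu> (trunc_class B p r (\<one>\<^bsub>B\<^esub> \<oplus>\<^bsub>B\<^esub> p [^]\<^bsub>B\<^esub> l \<otimes>\<^bsub>B\<^esub> z)) *
    \<nu>' (trunc_class B p r (\<one>\<^bsub>B\<^esub> \<oplus>\<^bsub>B\<^esub> p [^]\<^bsub>B\<^esub> l \<otimes>\<^bsub>B\<^esub> \<sigma> z)) =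
    \<psi> (p [^]\<^bsub>B\<^esub> l \<otimes>\<^bsub>B\<^esub> (t \<otimes>\<^bsub>B\<^esub> z \<oplus>\<^bsub>B\<^esub> \<sigma> (t \<otimes>\<^bsub>B\<^esub> z)))"
proof -
  have mem: "trunc_class B p r z \<in> carrier (trunc B p r)" using z by simp
  have trA: "t \<otimes>\<^bsub>B\<^esub> z \<oplus>\<^bsub>B\<^esub> \<sigma> (t \<otimes>\<^bsub>B\<^esub> z) \<in> carrier A"
    using z by (intro trace_A) simp
  note E = bspec[OF conjunct2[OF assoc[unfolded associated_element_def Let_def half]] mem]
  have red: "trunc_map B p l (\<lambda>x. x) (trunc_class B p r z) = trunc_class B p l z"
    using z by (intro trunc_map_reduce_class) (auto simp: r_eq)
  have Q: "trunc_class B p l t \<otimes>\<^bsub>trunc B p l\<^esub> trunc_class B p l z \<oplus>\<^bsub>trunc B p l\<^esub>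
      trunc_map B p l \<sigma> (trunc_class B p l t) \<otimes>\<^bsub>trunc B p l\<^esub> trunc_map B p l \<sigma> (trunc_class B p l z)
     = trunc_class B p l (t \<otimes>\<^bsub>B\<^esub> z \<oplus>\<^bsub>B\<^esub> \<sigma> (t \<otimes>\<^bsub>B\<^esub> z))"
    using z by (simp add: trunc_map_\<sigma>_class)
  have shift: "trunc_map A p r (\<lambda>x. p [^]\<^bsub>A\<^esub> l \<otimes>\<^bsub>A\<^esub> x) (trunc_class A p l y) =
      trunc_class A p r (p [^]\<^bsub>B\<^esub> l \<otimes>\<^bsub>B\<^esub> y)" if "y \<in> carrier A" for y
    using trunc_map_shift_class[OF that, of l l] by (simp add: r_eq A_ops A_pow)
  have pA: "p [^]\<^bsub>B\<^esub> l \<otimes>\<^bsub>B\<^esub> (t \<otimes>\<^bsub>B\<^esub> z \<oplus>\<^bsub>B\<^esub> \<sigma> (t \<otimes>\<^bsub>B\<^esub> z)) \<in> carrier A"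
    using A.m_closed[OF p_pow_A trA] by (simp add: A_ops)
  have L: "\<one>\<^bsub>trunc B p r\<^esub> \<oplus>\<^bsub>trunc B p r\<^esub> trunc_class B p r (p [^]\<^bsub>B\<^esub> l) \<otimes>\<^bsub>trunc B p r\<^esub> trunc_class B p r y
     = trunc_class B p r (\<one>\<^bsub>B\<^esub> \<oplus>\<^bsub>B\<^esub> p [^]\<^bsub>B\<^esub> l \<otimes>\<^bsub>B\<^esub> y)" if "y \<in> carrier B" for y
    using that by simp
  show ?thesis
    using E unfolding red Q trunc_map_\<sigma>_class[OF z, of r] L[OF z] L[OF \<sigma>.hom_closed[OF z]]
      trunc_descend_class[OF trA] shift[OF trA] \<psi>_class[OF pA] .
qed

text \<open>
  Regularity says that the two eigenvalues \<open>t\<close> and \<open>\<sigma> t\<close> of \<open>\<beta>\<close> differ modulo \<open>p\<close>.  Since \<open>1 - p\<^sup>r\<^sup>-\<^sup>1 z\<close> is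
  both the inverse and the conjugate of \<open>1 + p\<^sup>r\<^sup>-\<^sup>1 z\<close> when \<open>\<sigma> z = - z\<close>, the value of \<open>\<nu> / \<nu>'\<close> there
  is \<open>\<psi> (p\<^sup>r\<^sup>-\<^sup>1 (t - \<sigma> t) z)\<close>, which would be \<open>1\<close> if \<open>p\<close> divided \<open>t - \<sigma> t\<close>.
\<close>

lemma t_regular: "t \<ominus>\<^bsub>B\<^esub> \<sigma> t \<notin> PIdl\<^bsub>B\<^esub> p"
proof
  assume "t \<ominus>\<^bsub>B\<^esub> \<sigma> t \<in> PIdl\<^bsub>B\<^esub> p"
  then obtain y where y: "y \<in> carrier B" "t \<ominus>\<^bsub>B\<^esub> \<sigma> t = p \<otimes>\<^bsub>B\<^esub> y"
    using Bt.PIdl_iff[OF Bt.p_closed] by blast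
  let ?R = "trunc B p r" and ?c = "trunc_class B p r" and ?q = "p [^]\<^bsub>B\<^esub> (r - 1)"
  obtain Z where Z: "Z \<in> trunc_minus_part B p \<sigma> r"
    and ne: "\<nu> (\<one>\<^bsub>?R\<^esub> \<oplus>\<^bsub>?R\<^esub> ?c ?q \<otimes>\<^bsub>?R\<^esub> Z) * inverse (\<nu>' (\<one>\<^bsub>?R\<^esub> \<oplus>\<^bsub>?R\<^esub> ?c ?q \<otimes>\<^bsub>?R\<^esub> Z)) \<noteq> 1"
    using regular unfolding regular_couple_def Let_def by blast
  obtain z where z: "z \<in> carrier B" and Zz: "Z = ?c z"
    using Z Bt.carrier_trunc unfolding trunc_minus_part_def by auto
  have "trunc_map B p r \<sigma> Z = \<ominus>\<^bsub>?R\<^esub> Z"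
    using Z unfolding trunc_minus_part_def by blast
  then have \<sigma>z: "?c (\<sigma> z) = ?c (\<ominus>\<^bsub>B\<^esub> z)"
    using z by (simp add: Zz trunc_map_\<sigma>_class)
  then obtain d where d: "d \<in> carrier B" "\<sigma> z = \<ominus>\<^bsub>B\<^esub> z \<oplus>\<^bsub>B\<^esub> p [^]\<^bsub>B\<^esub> r \<otimes>\<^bsub>B\<^esub> d"
    using Bt.trunc_class_eq_iff[of "\<sigma> z" "\<ominus>\<^bsub>B\<^esub> z" r] z by auto
  define u where "u = \<one>\<^bsub>B\<^esub> \<oplus>\<^bsub>B\<^esub> ?q \<otimes>\<^bsub>B\<^esub> z"
  define u' where "u' = \<one>\<^bsub>B\<^esub> \<ominus>\<^bsub>B\<^esub> ?q \<otimes>\<^bsub>B\<^esub> z"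
  have cl: "u \<in> carrier B" "u' \<in> carrier B" unfolding u_def u'_def using z by auto
  have qq: "?q \<otimes>\<^bsub>B\<^esub> ?q = p [^]\<^bsub>B\<^esub> r \<otimes>\<^bsub>B\<^esub> p [^]\<^bsub>B\<^esub> (r - 2)"
    using l_pos by (simp add: B.nat_pow_mult r_eq numeral_2_eq_2)
  have "u \<otimes>\<^bsub>B\<^esub> u' = \<one>\<^bsub>B\<^esub> \<oplus>\<^bsub>B\<^esub> (?q \<otimes>\<^bsub>B\<^esub> ?q) \<otimes>\<^bsub>B\<^esub> (\<ominus>\<^bsub>B\<^esub> (z \<otimes>\<^bsub>B\<^esub> z))"
    unfolding u_def u'_def using z Bt.p_pow_closed[of "r - 1"] by algebra
  also have "\<dots> = \<one>\<^bsub>B\<^esub> \<oplus>\<^bsub>B\<^esub> p [^]\<^bsub>B\<^esub> r \<otimes>\<^bsub>B\<^esub> (p [^]\<^bsub>B\<^esub> (r - 2) \<otimes>\<^bsub>B\<^esub> (\<ominus>\<^bsub>B\<^esub> (z \<otimes>\<^bsub>B\<^esub> z)))"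
    unfolding qq using z by (simp add: B.m_assoc)
  finally have "?c (u \<otimes>\<^bsub>B\<^esub> u') = ?c \<one>\<^bsub>B\<^esub>"
    using cl z by (intro Bt.trunc_class_eq_iff[THEN iffD2]
        bexI[of _ "p [^]\<^bsub>B\<^esub> (r - 2) \<otimes>\<^bsub>B\<^esub> (\<ominus>\<^bsub>B\<^esub> (z \<otimes>\<^bsub>B\<^esub> z))"]) auto
  then have uu': "?c u \<otimes>\<^bsub>?R\<^esub> ?c u' = \<one>\<^bsub>?R\<^esub>" using cl by simp
  have units: "?c u \<in> Units ?R" "?c u' \<in> Units ?R"
    using uu' cl Bt.trunc_hom.S.m_comm[where x = "?c u" and y = "?c u'"]
    unfolding Units_def by (auto intro: bexI[of _ "?c u"] bexI[of _ "?c u'"])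
  have \<nu>'1: "\<nu>' \<one>\<^bsub>?R\<^esub> * \<nu>' \<one>\<^bsub>?R\<^esub> = \<nu>' \<one>\<^bsub>?R\<^esub>"
    using hom_mult[OF \<nu>'_hom, of "\<one>\<^bsub>?R\<^esub>" "\<one>\<^bsub>?R\<^esub>"] by (simp add: units_of_def complex_units_def)
  have "\<nu>' \<one>\<^bsub>?R\<^esub> \<noteq> 0"
    using hom_in_carrier[OF \<nu>'_hom, of "\<one>\<^bsub>?R\<^esub>"] by (simp add: units_of_def complex_units_def)
  with \<nu>'1 have \<nu>'1: "\<nu>' \<one>\<^bsub>?R\<^esub> = 1" by simp
  have "\<nu>' (?c u) * \<nu>' (?c u') = 1"
    using hom_mult[OF \<nu>'_hom, of "?c u" "?c u'"] units
    by (simp add: units_of_def complex_units_def uu' \<nu>'1)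
  then have inv: "inverse (\<nu>' (?c u)) = \<nu>' (?c u')"
    by (simp add: inverse_unique)
  \<comment> \<open>the associated formula is about 1 + p^l w, so p^(r - 1) z is written as p^l w\<close>
  define w where "w = p [^]\<^bsub>B\<^esub> (l - 1) \<otimes>\<^bsub>B\<^esub> z"
  have w: "w \<in> carrier B" unfolding w_def using z by simp
  have pw: "p [^]\<^bsub>B\<^esub> l \<otimes>\<^bsub>B\<^esub> (p [^]\<^bsub>B\<^esub> (l - 1) \<otimes>\<^bsub>B\<^esub> x) = ?q \<otimes>\<^bsub>B\<^esub> x" if "x \<in> carrier B" for x
    using that l_pos by (simp add: B.nat_pow_mult r_eq flip: B.m_assoc)
  have \<sigma>w: "\<sigma> w = p [^]\<^bsub>B\<^esub> (l - 1) \<otimes>\<^bsub>B\<^esub> \<sigma> z"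
    unfolding w_def using z by simp
  have "\<one>\<^bsub>B\<^esub> \<oplus>\<^bsub>B\<^esub> p [^]\<^bsub>B\<^esub> l \<otimes>\<^bsub>B\<^esub> w = u"
    unfolding w_def u_def using pw z by simp
  moreover have "?c (\<one>\<^bsub>B\<^esub> \<oplus>\<^bsub>B\<^esub> p [^]\<^bsub>B\<^esub> l \<otimes>\<^bsub>B\<^esub> \<sigma> w) = ?c u'"
    unfolding \<sigma>w u'_def using pw z \<sigma>z by (simp add: a_minus_def B.r_minus Bt.trunc_hom.S.r_minus)
  ultimately have "\<nu> (?c u) * \<nu>' (?c u') = \<psi> (p [^]\<^bsub>B\<^esub> l \<otimes>\<^bsub>B\<^esub> (t \<otimes>\<^bsub>B\<^esub> w \<oplus>\<^bsub>B\<^esub> \<sigma> (t \<otimes>\<^bsub>B\<^esub> w)))"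
    using associated_formula[OF w] by simp
  also have "\<dots> = 1"
  proof (rule \<psi>_eq_1)
    have "t \<otimes>\<^bsub>B\<^esub> w \<oplus>\<^bsub>B\<^esub> \<sigma> (t \<otimes>\<^bsub>B\<^esub> w) \<in> carrier A"
      using w by (intro trace_A) simp
    from A.m_closed[OF p_pow_A this]
    show "p [^]\<^bsub>B\<^esub> l \<otimes>\<^bsub>B\<^esub> (t \<otimes>\<^bsub>B\<^esub> w \<oplus>\<^bsub>B\<^esub> \<sigma> (t \<otimes>\<^bsub>B\<^esub> w)) \<in> carrier A" by (simp add: A_ops)
    show "y \<otimes>\<^bsub>B\<^esub> z \<oplus>\<^bsub>B\<^esub> ?q \<otimes>\<^bsub>B\<^esub> (\<sigma> t \<otimes>\<^bsub>B\<^esub> d) \<in> carrier B" using y z d by simp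
    have qp: "?q \<otimes>\<^bsub>B\<^esub> p = p [^]\<^bsub>B\<^esub> r"
      using l_pos by (simp add: r_eq flip: B.nat_pow_Suc)
    have "p [^]\<^bsub>B\<^esub> l \<otimes>\<^bsub>B\<^esub> (t \<otimes>\<^bsub>B\<^esub> w \<oplus>\<^bsub>B\<^esub> \<sigma> (t \<otimes>\<^bsub>B\<^esub> w)) =
        p [^]\<^bsub>B\<^esub> l \<otimes>\<^bsub>B\<^esub> (p [^]\<^bsub>B\<^esub> (l - 1) \<otimes>\<^bsub>B\<^esub> (t \<otimes>\<^bsub>B\<^esub> z \<oplus>\<^bsub>B\<^esub> \<sigma> t \<otimes>\<^bsub>B\<^esub> \<sigma> z))"
      using \<sigma>w w z by (simp add: w_def B.r_distr B.m_lcomm)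
    also have "\<dots> = ?q \<otimes>\<^bsub>B\<^esub> (t \<otimes>\<^bsub>B\<^esub> z \<oplus>\<^bsub>B\<^esub> \<sigma> t \<otimes>\<^bsub>B\<^esub> \<sigma> z)"
      using z by (intro pw) simp
    also have "\<dots> = ?q \<otimes>\<^bsub>B\<^esub> ((t \<ominus>\<^bsub>B\<^esub> \<sigma> t) \<otimes>\<^bsub>B\<^esub> z \<oplus>\<^bsub>B\<^esub> p [^]\<^bsub>B\<^esub> r \<otimes>\<^bsub>B\<^esub> (\<sigma> t \<otimes>\<^bsub>B\<^esub> d))"
      unfolding d(2) using z d(1) t_B \<sigma>.hom_closed[OF t_B] Bt.p_pow_closed[of r] Bt.p_pow_closed[of "r - 1"] by algebra
    also have "\<dots> = (?q \<otimes>\<^bsub>B\<^esub> p) \<otimes>\<^bsub>B\<^esub> (y \<otimes>\<^bsub>B\<^esub> z) \<oplus>\<^bsub>B\<^esub> p [^]\<^bsub>B\<^esub> r \<otimes>\<^bsub>B\<^esub> (?q \<otimes>\<^bsub>B\<^esub> (\<sigma> t \<otimes>\<^bsub>B\<^esub> d))"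
      unfolding y(2) using z y(1) d(1) \<sigma>.hom_closed[OF t_B] Bt.p_closed Bt.p_pow_closed[of r] Bt.p_pow_closed[of "r - 1"] by algebra
    also have "\<dots> = p [^]\<^bsub>B\<^esub> r \<otimes>\<^bsub>B\<^esub> (y \<otimes>\<^bsub>B\<^esub> z \<oplus>\<^bsub>B\<^esub> ?q \<otimes>\<^bsub>B\<^esub> (\<sigma> t \<otimes>\<^bsub>B\<^esub> d))"
      unfolding qp using z y(1) d(1) by (simp add: B.r_distr)
    finally show "p [^]\<^bsub>B\<^esub> l \<otimes>\<^bsub>B\<^esub> (t \<otimes>\<^bsub>B\<^esub> w \<oplus>\<^bsub>B\<^esub> \<sigma> (t \<otimes>\<^bsub>B\<^esub> w)) =
        p [^]\<^bsub>B\<^esub> r \<otimes>\<^bsub>B\<^esub> (y \<otimes>\<^bsub>B\<^esub> z \<oplus>\<^bsub>B\<^esub> ?q \<otimes>\<^bsub>B\<^esub> (\<sigma> t \<otimes>\<^bsub>B\<^esub> d))" .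
  qed
  finally have "\<nu> (?c u) * inverse (\<nu>' (?c u)) = 1" by (simp add: inv)
  moreover have "\<one>\<^bsub>?R\<^esub> \<oplus>\<^bsub>?R\<^esub> ?c ?q \<otimes>\<^bsub>?R\<^esub> Z = ?c u"
    unfolding u_def Zz using z by simp
  ultimately show False using ne by simp
qed

abbreviation "RA \<equiv> trunc A p r"
abbreviation "cA \<equiv> trunc_class A p r"
abbreviation "cB \<equiv> trunc_class B p r"
abbreviation "\<beta> \<equiv> beta_hat A B p \<sigma> r (cB t)"

definition "\<beta>\<^sub>2\<^sub>1 = cA (\<ominus>\<^bsub>A\<^esub> (t \<otimes>\<^bsub>B\<^esub> \<sigma> t))"
definition "\<beta>\<^sub>2\<^sub>2 = cA (t \<oplus>\<^bsub>B\<^esub> \<sigma> t)"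
definition "\<epsilon> = cA (p [^]\<^bsub>A\<^esub> l)"

lemma closed_RA [simp]: "\<beta>\<^sub>2\<^sub>1 \<in> carrier RA" "\<beta>\<^sub>2\<^sub>2 \<in> carrier RA" "\<epsilon> \<in> carrier RA"
  unfolding \<beta>\<^sub>2\<^sub>1_def \<beta>\<^sub>2\<^sub>2_def \<epsilon>_def using norm_A[OF t_B] trace_A[OF t_B] by auto

lemma beta_hat_eq: "\<beta> = Mat2 \<zero>\<^bsub>RA\<^esub> \<one>\<^bsub>RA\<^esub> \<beta>\<^sub>2\<^sub>1 \<beta>\<^sub>2\<^sub>2"
  unfolding beta_hat_def Let_def \<beta>\<^sub>2\<^sub>1_def \<beta>\<^sub>2\<^sub>2_def trunc_norm_class[OF t_B] trunc_trace_class[OF t_B]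
  using norm_A[OF t_B] by simp

lemma \<epsilon>_square: "\<epsilon> \<otimes>\<^bsub>RA\<^esub> \<epsilon> = \<zero>\<^bsub>RA\<^esub>"
proof -
  have "\<epsilon> \<otimes>\<^bsub>RA\<^esub> \<epsilon> = cA (p [^]\<^bsub>A\<^esub> l \<otimes>\<^bsub>A\<^esub> p [^]\<^bsub>A\<^esub> l)"
    unfolding \<epsilon>_def by (rule At.trunc_hom.hom_mult[symmetric]) simp_all
  also have "\<dots> = \<zero>\<^bsub>RA\<^esub>"
  proof -
    have "p [^]\<^bsub>A\<^esub> l \<otimes>\<^bsub>A\<^esub> p [^]\<^bsub>A\<^esub> l = p [^]\<^bsub>A\<^esub> r \<otimes>\<^bsub>A\<^esub> \<one>\<^bsub>A\<^esub>"
      using At.p_closed by (simp add: A.nat_pow_mult r_eq)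
    then show ?thesis
      by (intro At.trunc_class_eq_zero_iff[THEN iffD2] bexI[of _ "\<one>\<^bsub>A\<^esub>"]) simp_all
  qed
  finally show ?thesis .
qed

lemma level_subgroup_iff:
  "Mat2 a b c d \<in> level_subgroup A p r \<longleftrightarrow> Mat2 a b c d \<in> carrier (GL2 RA) \<and>
     {a \<ominus>\<^bsub>RA\<^esub> \<one>\<^bsub>RA\<^esub>, b, c, d \<ominus>\<^bsub>RA\<^esub> \<one>\<^bsub>RA\<^esub>} \<subseteq> PIdl\<^bsub>RA\<^esub> \<epsilon>"
  unfolding level_subgroup_def half A_pow[symmetric] \<epsilon>_def[symmetric]
  by (rule cring.congruence_subgroup_iff[OF At.cring_trunc])

lemma level_subgroupI:
  assumes "Mat2 (\<one>\<^bsub>RA\<^esub> \<oplus>\<^bsub>RA\<^esub> \<epsilon> \<otimes>\<^bsub>RA\<^esub> g11) (\<epsilon> \<otimes>\<^bsub>RA\<^esub> g12) (\<epsilon> \<otimes>\<^bsub>RA\<^esub> g21) (\<one>\<^bsub>RA\<^esub> \<oplus>\<^bsub>RA\<^esub> \<epsilon> \<otimes>\<^bsub>RA\<^esub> g22)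
      \<in> carrier (GL2 RA)"
    and cl: "g11 \<in> carrier RA" "g12 \<in> carrier RA" "g21 \<in> carrier RA" "g22 \<in> carrier RA"
  shows "Mat2 (\<one>\<^bsub>RA\<^esub> \<oplus>\<^bsub>RA\<^esub> \<epsilon> \<otimes>\<^bsub>RA\<^esub> g11) (\<epsilon> \<otimes>\<^bsub>RA\<^esub> g12) (\<epsilon> \<otimes>\<^bsub>RA\<^esub> g21) (\<one>\<^bsub>RA\<^esub> \<oplus>\<^bsub>RA\<^esub> \<epsilon> \<otimes>\<^bsub>RA\<^esub> g22)
      \<in> level_subgroup A p r"
proof -
  have "(\<one>\<^bsub>RA\<^esub> \<oplus>\<^bsub>RA\<^esub> x) \<ominus>\<^bsub>RA\<^esub> \<one>\<^bsub>RA\<^esub> = x" if "x \<in> carrier RA" for x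
    using that At.trunc_hom.S.one_closed by algebra
  moreover have "\<epsilon> \<otimes>\<^bsub>RA\<^esub> x \<in> PIdl\<^bsub>RA\<^esub> \<epsilon>" if "x \<in> carrier RA" for x
    using that At.trunc_hom.S.m_comm[where x = \<epsilon> and y = x] unfolding cgenideal_def by auto
  ultimately show ?thesis
    unfolding level_subgroup_iff using assms by simp
qed

lemma level_subgroupE:
  assumes "g \<in> level_subgroup A p r"
  obtains g11 g12 g21 g22 where "g11 \<in> carrier RA" "g12 \<in> carrier RA" "g21 \<in> carrier RA" "g22 \<in> carrier RA"
    "g = Mat2 (\<one>\<^bsub>RA\<^esub> \<oplus>\<^bsub>RA\<^esub> \<epsilon> \<otimes>\<^bsub>RA\<^esub> g11) (\<epsilon> \<otimes>\<^bsub>RA\<^esub> g12) (\<epsilon> \<otimes>\<^bsub>RA\<^esub> g21) (\<one>\<^bsub>RA\<^esub> \<oplus>\<^bsub>RA\<^esub> \<epsilon> \<otimes>\<^bsub>RA\<^esub> g22)"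
proof -
  obtain a b c d where g: "g = Mat2 a b c d" by (cases g)
  have mem: "a \<ominus>\<^bsub>RA\<^esub> \<one>\<^bsub>RA\<^esub> \<in> PIdl\<^bsub>RA\<^esub> \<epsilon>" "b \<in> PIdl\<^bsub>RA\<^esub> \<epsilon>" "c \<in> PIdl\<^bsub>RA\<^esub> \<epsilon>"
    "d \<ominus>\<^bsub>RA\<^esub> \<one>\<^bsub>RA\<^esub> \<in> PIdl\<^bsub>RA\<^esub> \<epsilon>"
    and G: "Mat2 a b c d \<in> carrier (GL2 RA)"
    using assms unfolding g level_subgroup_iff by auto
  have cl: "a \<in> carrier RA" "d \<in> carrier RA"
    using G unfolding At.trunc_hom.S.GL2_carrier_iff At.trunc_hom.S.mat2_simps by auto
  have ex: "\<exists>y\<in>carrier RA. x = \<epsilon> \<otimes>\<^bsub>RA\<^esub> y" if "x \<in> PIdl\<^bsub>RA\<^esub> \<epsilon>" for x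
    using that At.trunc_hom.S.m_comm[where x = \<epsilon>] unfolding cgenideal_def by auto
  have diag: "x = \<one>\<^bsub>RA\<^esub> \<oplus>\<^bsub>RA\<^esub> (x \<ominus>\<^bsub>RA\<^esub> \<one>\<^bsub>RA\<^esub>)" if "x \<in> carrier RA" for x
    using that At.trunc_hom.S.one_closed by algebra
  from ex[OF mem(1)] obtain g11 where "g11 \<in> carrier RA" "a \<ominus>\<^bsub>RA\<^esub> \<one>\<^bsub>RA\<^esub> = \<epsilon> \<otimes>\<^bsub>RA\<^esub> g11" by blast
  moreover from ex[OF mem(2)] obtain g12 where "g12 \<in> carrier RA" "b = \<epsilon> \<otimes>\<^bsub>RA\<^esub> g12" by blast
  moreover from ex[OF mem(3)] obtain g21 where "g21 \<in> carrier RA" "c = \<epsilon> \<otimes>\<^bsub>RA\<^esub> g21" by blast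
  moreover from ex[OF mem(4)] obtain g22 where "g22 \<in> carrier RA" "d \<ominus>\<^bsub>RA\<^esub> \<one>\<^bsub>RA\<^esub> = \<epsilon> \<otimes>\<^bsub>RA\<^esub> g22" by blast
  ultimately show thesis
    using that[of g11 g12 g21 g22] diag[OF cl(1)] diag[OF cl(2)] g by simp
qed

lemma trace_beta_minus_one:
  assumes "g11 \<in> carrier RA" "g12 \<in> carrier RA" "g21 \<in> carrier RA" "g22 \<in> carrier RA"
  shows "mat2_trace RA (\<beta> \<otimes>\<^bsub>mat2_ring RA\<^esub>
      (Mat2 (\<one>\<^bsub>RA\<^esub> \<oplus>\<^bsub>RA\<^esub> g11) g12 g21 (\<one>\<^bsub>RA\<^esub> \<oplus>\<^bsub>RA\<^esub> g22) \<ominus>\<^bsub>mat2_ring RA\<^esub> \<one>\<^bsub>mat2_ring RA\<^esub>)) =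
    g21 \<oplus>\<^bsub>RA\<^esub> (\<beta>\<^sub>2\<^sub>1 \<otimes>\<^bsub>RA\<^esub> g12 \<oplus>\<^bsub>RA\<^esub> \<beta>\<^sub>2\<^sub>2 \<otimes>\<^bsub>RA\<^esub> g22)"
proof -
  have m: "Mat2 (\<one>\<^bsub>RA\<^esub> \<oplus>\<^bsub>RA\<^esub> g11) g12 g21 (\<one>\<^bsub>RA\<^esub> \<oplus>\<^bsub>RA\<^esub> g22) \<in> carrier (mat2_ring RA)"
    using assms by (simp add: At.trunc_hom.S.mat2_simps)
  have d: "(\<one>\<^bsub>RA\<^esub> \<oplus>\<^bsub>RA\<^esub> x) \<ominus>\<^bsub>RA\<^esub> \<one>\<^bsub>RA\<^esub> = x" if "x \<in> carrier RA" for x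
    using that At.trunc_hom.S.one_closed by algebra
  show ?thesis
    unfolding At.trunc_hom.S.set_mat2_minus_one[OF m] d[OF assms(1)] d[OF assms(4)] beta_hat_eq mat2_trace_def
    using assms by (simp add: At.trunc_hom.S.mat2_simps)
qed

text \<open>
  The value attached to a decomposition \<open>g = s k\<close> of an element of the congruence subgroup does not
  depend on it.  The factor \<open>s\<close> is then congruent to \<open>1\<close>, so \<open>\<nu>\<close> and \<open>\<nu>'\<close> are evaluated where the
  associated element determines them, and they contribute \<open>\<psi> (Tr (\<beta> (s - 1)))\<close>: the trace of
  \<open>\<beta> (a' + b' \<beta>)\<close> is the trace over \<open>A\<close> of \<open>t (a' + b' t)\<close>, as \<open>t\<close> is an eigenvalue of \<open>\<beta>\<close>.
\<close>

lemma inducing_value: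
  assumes ab: "a \<in> carrier RA" "b \<in> carrier RA"
    and k: "k \<in> level_subgroup A p r" and g: "g \<in> level_subgroup A p r"
    and eq: "g = lin_comb RA \<beta> a b \<otimes>\<^bsub>GL2 RA\<^esub> k"
  shows "\<nu> (trunc_embed B p r a \<oplus>\<^bsub>trunc B p r\<^esub> trunc_embed B p r b \<otimes>\<^bsub>trunc B p r\<^esub> cB t) *
     \<nu>' (trunc_embed B p r a \<oplus>\<^bsub>trunc B p r\<^esub> trunc_embed B p r b \<otimes>\<^bsub>trunc B p r\<^esub> trunc_map B p r \<sigma> (cB t)) *
     trunc_char \<psi> (mat2_trace RA (\<beta> \<otimes>\<^bsub>mat2_ring RA\<^esub> (k \<ominus>\<^bsub>mat2_ring RA\<^esub> \<one>\<^bsub>mat2_ring RA\<^esub>))) =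
     trunc_char \<psi> (mat2_trace RA (\<beta> \<otimes>\<^bsub>mat2_ring RA\<^esub> (g \<ominus>\<^bsub>mat2_ring RA\<^esub> \<one>\<^bsub>mat2_ring RA\<^esub>)))"
proof -
  obtain k11 k12 k21 k22 where kc: "k11 \<in> carrier RA" "k12 \<in> carrier RA" "k21 \<in> carrier RA" "k22 \<in> carrier RA"
    and k_eq: "k = Mat2 (\<one>\<^bsub>RA\<^esub> \<oplus>\<^bsub>RA\<^esub> \<epsilon> \<otimes>\<^bsub>RA\<^esub> k11) (\<epsilon> \<otimes>\<^bsub>RA\<^esub> k12) (\<epsilon> \<otimes>\<^bsub>RA\<^esub> k21) (\<one>\<^bsub>RA\<^esub> \<oplus>\<^bsub>RA\<^esub> \<epsilon> \<otimes>\<^bsub>RA\<^esub> k22)"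
    by (rule level_subgroupE[OF k])
  obtain g11 g12 g21 g22 where gc: "g11 \<in> carrier RA" "g12 \<in> carrier RA" "g21 \<in> carrier RA" "g22 \<in> carrier RA"
    and g_eq: "g = Mat2 (\<one>\<^bsub>RA\<^esub> \<oplus>\<^bsub>RA\<^esub> \<epsilon> \<otimes>\<^bsub>RA\<^esub> g11) (\<epsilon> \<otimes>\<^bsub>RA\<^esub> g12) (\<epsilon> \<otimes>\<^bsub>RA\<^esub> g21) (\<one>\<^bsub>RA\<^esub> \<oplus>\<^bsub>RA\<^esub> \<epsilon> \<otimes>\<^bsub>RA\<^esub> g22)"
    by (rule level_subgroupE[OF g])
  have eqs:
    "a \<otimes>\<^bsub>RA\<^esub> (\<one>\<^bsub>RA\<^esub> \<oplus>\<^bsub>RA\<^esub> \<epsilon> \<otimes>\<^bsub>RA\<^esub> k11) \<oplus>\<^bsub>RA\<^esub> b \<otimes>\<^bsub>RA\<^esub> (\<epsilon> \<otimes>\<^bsub>RA\<^esub> k21) = \<one>\<^bsub>RA\<^esub> \<oplus>\<^bsub>RA\<^esub> \<epsilon> \<otimes>\<^bsub>RA\<^esub> g11"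
    "a \<otimes>\<^bsub>RA\<^esub> (\<epsilon> \<otimes>\<^bsub>RA\<^esub> k12) \<oplus>\<^bsub>RA\<^esub> b \<otimes>\<^bsub>RA\<^esub> (\<one>\<^bsub>RA\<^esub> \<oplus>\<^bsub>RA\<^esub> \<epsilon> \<otimes>\<^bsub>RA\<^esub> k22) = \<epsilon> \<otimes>\<^bsub>RA\<^esub> g12"
    "b \<otimes>\<^bsub>RA\<^esub> \<beta>\<^sub>2\<^sub>1 \<otimes>\<^bsub>RA\<^esub> (\<one>\<^bsub>RA\<^esub> \<oplus>\<^bsub>RA\<^esub> \<epsilon> \<otimes>\<^bsub>RA\<^esub> k11) \<oplus>\<^bsub>RA\<^esub> (a \<oplus>\<^bsub>RA\<^esub> b \<otimes>\<^bsub>RA\<^esub> \<beta>\<^sub>2\<^sub>2) \<otimes>\<^bsub>RA\<^esub> (\<epsilon> \<otimes>\<^bsub>RA\<^esub> k21) = \<epsilon> \<otimes>\<^bsub>RA\<^esub> g21"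
    "b \<otimes>\<^bsub>RA\<^esub> \<beta>\<^sub>2\<^sub>1 \<otimes>\<^bsub>RA\<^esub> (\<epsilon> \<otimes>\<^bsub>RA\<^esub> k12) \<oplus>\<^bsub>RA\<^esub> (a \<oplus>\<^bsub>RA\<^esub> b \<otimes>\<^bsub>RA\<^esub> \<beta>\<^sub>2\<^sub>2) \<otimes>\<^bsub>RA\<^esub> (\<one>\<^bsub>RA\<^esub> \<oplus>\<^bsub>RA\<^esub> \<epsilon> \<otimes>\<^bsub>RA\<^esub> k22) = \<one>\<^bsub>RA\<^esub> \<oplus>\<^bsub>RA\<^esub> \<epsilon> \<otimes>\<^bsub>RA\<^esub> g22"
    using eq unfolding k_eq g_eq beta_hat_eq At.trunc_hom.S.GL2_mult At.trunc_hom.S.mat2_simps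
      At.trunc_hom.S.lin_comb_Mat2[OF ab closed_RA(1,2)] by simp_all
  obtain a' b' where ab': "a' \<in> carrier RA" "b' \<in> carrier RA"
    and a_eq: "a = \<one>\<^bsub>RA\<^esub> \<oplus>\<^bsub>RA\<^esub> \<epsilon> \<otimes>\<^bsub>RA\<^esub> a'" and b_eq: "b = \<epsilon> \<otimes>\<^bsub>RA\<^esub> b'"
    and tr: "\<epsilon> \<otimes>\<^bsub>RA\<^esub> g21 \<oplus>\<^bsub>RA\<^esub> (\<beta>\<^sub>2\<^sub>1 \<otimes>\<^bsub>RA\<^esub> (\<epsilon> \<otimes>\<^bsub>RA\<^esub> g12) \<oplus>\<^bsub>RA\<^esub> \<beta>\<^sub>2\<^sub>2 \<otimes>\<^bsub>RA\<^esub> (\<epsilon> \<otimes>\<^bsub>RA\<^esub> g22)) =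
      \<epsilon> \<otimes>\<^bsub>RA\<^esub> (a' \<otimes>\<^bsub>RA\<^esub> \<beta>\<^sub>2\<^sub>2 \<oplus>\<^bsub>RA\<^esub> b' \<otimes>\<^bsub>RA\<^esub> (\<beta>\<^sub>2\<^sub>2 \<otimes>\<^bsub>RA\<^esub> \<beta>\<^sub>2\<^sub>2 \<oplus>\<^bsub>RA\<^esub> (\<beta>\<^sub>2\<^sub>1 \<oplus>\<^bsub>RA\<^esub> \<beta>\<^sub>2\<^sub>1))) \<oplus>\<^bsub>RA\<^esub>
      (\<epsilon> \<otimes>\<^bsub>RA\<^esub> k21 \<oplus>\<^bsub>RA\<^esub> (\<beta>\<^sub>2\<^sub>1 \<otimes>\<^bsub>RA\<^esub> (\<epsilon> \<otimes>\<^bsub>RA\<^esub> k12) \<oplus>\<^bsub>RA\<^esub> \<beta>\<^sub>2\<^sub>2 \<otimes>\<^bsub>RA\<^esub> (\<epsilon> \<otimes>\<^bsub>RA\<^esub> k22)))"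
    by (rule At.trunc_hom.S.torus_times_nilpotent[OF ab closed_RA kc gc \<epsilon>_square eqs])
  obtain x y where xy: "x \<in> carrier A" "y \<in> carrier A" and a': "a' = cA x" and b': "b' = cA y"
    using ab' At.carrier_trunc by auto
  have xyB [simp]: "x \<in> carrier B" "y \<in> carrier B" using xy by auto
  define z where "z = x \<oplus>\<^bsub>B\<^esub> y \<otimes>\<^bsub>B\<^esub> t"
  have zB: "z \<in> carrier B" unfolding z_def by simp
  have aA: "a = cA (\<one>\<^bsub>A\<^esub> \<oplus>\<^bsub>A\<^esub> p [^]\<^bsub>A\<^esub> l \<otimes>\<^bsub>A\<^esub> x)" and bA: "b = cA (p [^]\<^bsub>A\<^esub> l \<otimes>\<^bsub>A\<^esub> y)"
    unfolding a_eq b_eq a' b' \<epsilon>_def using xy by simp_all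
  have emb_a: "trunc_embed B p r a = cB (\<one>\<^bsub>B\<^esub> \<oplus>\<^bsub>B\<^esub> p [^]\<^bsub>B\<^esub> l \<otimes>\<^bsub>B\<^esub> x)"
    unfolding aA using xy trunc_embed_class[of "\<one>\<^bsub>A\<^esub> \<oplus>\<^bsub>A\<^esub> p [^]\<^bsub>A\<^esub> l \<otimes>\<^bsub>A\<^esub> x" r]
    by (simp only: A.one_closed A.a_closed A.m_closed At.p_pow_closed) (simp only: A_ops A_pow)
  have emb_b: "trunc_embed B p r b = cB (p [^]\<^bsub>B\<^esub> l \<otimes>\<^bsub>B\<^esub> y)"
    unfolding bA using xy trunc_embed_class[of "p [^]\<^bsub>A\<^esub> l \<otimes>\<^bsub>A\<^esub> y" r]
    by (simp only: A.m_closed At.p_pow_closed) (simp only: A_ops A_pow)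
  have shape: "trunc_embed B p r a \<oplus>\<^bsub>trunc B p r\<^esub> trunc_embed B p r b \<otimes>\<^bsub>trunc B p r\<^esub> cB s =
      cB (\<one>\<^bsub>B\<^esub> \<oplus>\<^bsub>B\<^esub> p [^]\<^bsub>B\<^esub> l \<otimes>\<^bsub>B\<^esub> (x \<oplus>\<^bsub>B\<^esub> y \<otimes>\<^bsub>B\<^esub> s))" if s: "s \<in> carrier B" for s
  proof -
    have "\<one>\<^bsub>B\<^esub> \<oplus>\<^bsub>B\<^esub> p [^]\<^bsub>B\<^esub> l \<otimes>\<^bsub>B\<^esub> (x \<oplus>\<^bsub>B\<^esub> y \<otimes>\<^bsub>B\<^esub> s) =
      (\<one>\<^bsub>B\<^esub> \<oplus>\<^bsub>B\<^esub> p [^]\<^bsub>B\<^esub> l \<otimes>\<^bsub>B\<^esub> x) \<oplus>\<^bsub>B\<^esub> (p [^]\<^bsub>B\<^esub> l \<otimes>\<^bsub>B\<^esub> y) \<otimes>\<^bsub>B\<^esub> s"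
      using s xyB Bt.p_pow_closed[of l] by algebra
    then show ?thesis unfolding emb_a emb_b using s by simp
  qed
  have \<sigma>z: "x \<oplus>\<^bsub>B\<^esub> y \<otimes>\<^bsub>B\<^esub> \<sigma> t = \<sigma> z"
    unfolding z_def by (simp add: \<sigma>_fixes xy)
  have nuval: "\<nu> (trunc_embed B p r a \<oplus>\<^bsub>trunc B p r\<^esub> trunc_embed B p r b \<otimes>\<^bsub>trunc B p r\<^esub> cB t) *
     \<nu>' (trunc_embed B p r a \<oplus>\<^bsub>trunc B p r\<^esub> trunc_embed B p r b \<otimes>\<^bsub>trunc B p r\<^esub> trunc_map B p r \<sigma> (cB t)) =
     \<psi> (p [^]\<^bsub>B\<^esub> l \<otimes>\<^bsub>B\<^esub> (t \<otimes>\<^bsub>B\<^esub> z \<oplus>\<^bsub>B\<^esub> \<sigma> (t \<otimes>\<^bsub>B\<^esub> z)))"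
    unfolding trunc_map_\<sigma>_class[OF t_B] shape[OF t_B] shape[OF \<sigma>.hom_closed[OF t_B]] \<sigma>z
    unfolding z_def[symmetric] by (rule associated_formula[OF zB])
  define N where "N = \<ominus>\<^bsub>A\<^esub> (t \<otimes>\<^bsub>B\<^esub> \<sigma> t)"
  define T where "T = t \<oplus>\<^bsub>B\<^esub> \<sigma> t"
  have NT: "N \<in> carrier A" "T \<in> carrier A"
    unfolding N_def T_def using norm_A[OF t_B] trace_A[OF t_B] by auto
  have NB: "N = \<ominus>\<^bsub>B\<^esub> (t \<otimes>\<^bsub>B\<^esub> \<sigma> t)"
    unfolding N_def by (rule A_inv[OF norm_A[OF t_B]])
  have \<beta>\<^sub>2\<^sub>1_N: "\<beta>\<^sub>2\<^sub>1 = cA N" and \<beta>\<^sub>2\<^sub>2_T: "\<beta>\<^sub>2\<^sub>2 = cA T" unfolding \<beta>\<^sub>2\<^sub>1_def \<beta>\<^sub>2\<^sub>2_def N_def T_def by simp_all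
  have "t \<otimes>\<^bsub>B\<^esub> z \<oplus>\<^bsub>B\<^esub> \<sigma> (t \<otimes>\<^bsub>B\<^esub> z) = t \<otimes>\<^bsub>B\<^esub> (x \<oplus>\<^bsub>B\<^esub> y \<otimes>\<^bsub>B\<^esub> t) \<oplus>\<^bsub>B\<^esub> \<sigma> t \<otimes>\<^bsub>B\<^esub> (x \<oplus>\<^bsub>B\<^esub> y \<otimes>\<^bsub>B\<^esub> \<sigma> t)"
    unfolding \<sigma>z using zB by (simp add: z_def)
  also have "\<dots> = x \<otimes>\<^bsub>B\<^esub> T \<oplus>\<^bsub>B\<^esub> y \<otimes>\<^bsub>B\<^esub> (T \<otimes>\<^bsub>B\<^esub> T \<oplus>\<^bsub>B\<^esub> (N \<oplus>\<^bsub>B\<^esub> N))"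
    unfolding T_def NB using xyB t_B \<sigma>.hom_closed[OF t_B] by algebra
  finally have "p [^]\<^bsub>B\<^esub> l \<otimes>\<^bsub>B\<^esub> (t \<otimes>\<^bsub>B\<^esub> z \<oplus>\<^bsub>B\<^esub> \<sigma> (t \<otimes>\<^bsub>B\<^esub> z)) =
      p [^]\<^bsub>A\<^esub> l \<otimes>\<^bsub>A\<^esub> (x \<otimes>\<^bsub>A\<^esub> T \<oplus>\<^bsub>A\<^esub> y \<otimes>\<^bsub>A\<^esub> (T \<otimes>\<^bsub>A\<^esub> T \<oplus>\<^bsub>A\<^esub> (N \<oplus>\<^bsub>A\<^esub> N)))"
    by (simp only: A_ops A_pow)
  moreover have "trunc_char \<psi> (cA (p [^]\<^bsub>A\<^esub> l \<otimes>\<^bsub>A\<^esub> (x \<otimes>\<^bsub>A\<^esub> T \<oplus>\<^bsub>A\<^esub> y \<otimes>\<^bsub>A\<^esub> (T \<otimes>\<^bsub>A\<^esub> T \<oplus>\<^bsub>A\<^esub> (N \<oplus>\<^bsub>A\<^esub> N))))) =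
     \<psi> (p [^]\<^bsub>A\<^esub> l \<otimes>\<^bsub>A\<^esub> (x \<otimes>\<^bsub>A\<^esub> T \<oplus>\<^bsub>A\<^esub> y \<otimes>\<^bsub>A\<^esub> (T \<otimes>\<^bsub>A\<^esub> T \<oplus>\<^bsub>A\<^esub> (N \<oplus>\<^bsub>A\<^esub> N))))"
    using xy NT by (intro \<psi>_class) simp
  moreover have "cA (p [^]\<^bsub>A\<^esub> l \<otimes>\<^bsub>A\<^esub> (x \<otimes>\<^bsub>A\<^esub> T \<oplus>\<^bsub>A\<^esub> y \<otimes>\<^bsub>A\<^esub> (T \<otimes>\<^bsub>A\<^esub> T \<oplus>\<^bsub>A\<^esub> (N \<oplus>\<^bsub>A\<^esub> N)))) =
     \<epsilon> \<otimes>\<^bsub>RA\<^esub> (a' \<otimes>\<^bsub>RA\<^esub> \<beta>\<^sub>2\<^sub>2 \<oplus>\<^bsub>RA\<^esub> b' \<otimes>\<^bsub>RA\<^esub> (\<beta>\<^sub>2\<^sub>2 \<otimes>\<^bsub>RA\<^esub> \<beta>\<^sub>2\<^sub>2 \<oplus>\<^bsub>RA\<^esub> (\<beta>\<^sub>2\<^sub>1 \<oplus>\<^bsub>RA\<^esub> \<beta>\<^sub>2\<^sub>1)))"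
    unfolding \<epsilon>_def a' b' \<beta>\<^sub>2\<^sub>1_N \<beta>\<^sub>2\<^sub>2_T using xy NT by simp
  ultimately have S: "\<psi> (p [^]\<^bsub>B\<^esub> l \<otimes>\<^bsub>B\<^esub> (t \<otimes>\<^bsub>B\<^esub> z \<oplus>\<^bsub>B\<^esub> \<sigma> (t \<otimes>\<^bsub>B\<^esub> z))) =
      trunc_char \<psi> (\<epsilon> \<otimes>\<^bsub>RA\<^esub> (a' \<otimes>\<^bsub>RA\<^esub> \<beta>\<^sub>2\<^sub>2 \<oplus>\<^bsub>RA\<^esub> b' \<otimes>\<^bsub>RA\<^esub> (\<beta>\<^sub>2\<^sub>2 \<otimes>\<^bsub>RA\<^esub> \<beta>\<^sub>2\<^sub>2 \<oplus>\<^bsub>RA\<^esub> (\<beta>\<^sub>2\<^sub>1 \<oplus>\<^bsub>RA\<^esub> \<beta>\<^sub>2\<^sub>1))))"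
    by simp
  have cl: "\<epsilon> \<otimes>\<^bsub>RA\<^esub> u \<in> carrier RA" if "u \<in> carrier RA" for u using that by simp
  show ?thesis
    unfolding nuval S k_eq g_eq
      trace_beta_minus_one[OF cl[OF kc(1)] cl[OF kc(2)] cl[OF kc(3)] cl[OF kc(4)]]
      trace_beta_minus_one[OF cl[OF gc(1)] cl[OF gc(2)] cl[OF gc(3)] cl[OF gc(4)]] tr
    by (rule \<psi>_add[symmetric]) (use ab' kc in simp_all)
qed

lemma inducing_character_on_level_subgroup:
  assumes g: "g \<in> level_subgroup A p r"
  shows "inducing_character A B p \<sigma> r \<psi> \<nu> \<nu>' (cB t) g =
     trunc_char \<psi> (mat2_trace RA (\<beta> \<otimes>\<^bsub>mat2_ring RA\<^esub> (g \<ominus>\<^bsub>mat2_ring RA\<^esub> \<one>\<^bsub>mat2_ring RA\<^esub>)))"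
    and "g \<in> inducing_subgroup A B p \<sigma> r (cB t)"
proof -
  interpret G: group "GL2 RA" by (rule At.trunc_hom.S.group_GL2)
  have one: "lin_comb RA \<beta> \<one>\<^bsub>RA\<^esub> \<zero>\<^bsub>RA\<^esub> = \<one>\<^bsub>GL2 RA\<^esub>"
    unfolding beta_hat_eq by (simp add: At.trunc_hom.S.lin_comb_Mat2 At.trunc_hom.S.GL2_one)
  have gG: "g \<in> carrier (GL2 RA)"
    using g unfolding level_subgroup_def congruence_subgroup_def by blast
  have g_eq: "g = lin_comb RA \<beta> \<one>\<^bsub>RA\<^esub> \<zero>\<^bsub>RA\<^esub> \<otimes>\<^bsub>GL2 RA\<^esub> g"
    unfolding one using gG by simp
  show "inducing_character A B p \<sigma> r \<psi> \<nu> \<nu>' (cB t) g =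
     trunc_char \<psi> (mat2_trace RA (\<beta> \<otimes>\<^bsub>mat2_ring RA\<^esub> (g \<ominus>\<^bsub>mat2_ring RA\<^esub> \<one>\<^bsub>mat2_ring RA\<^esub>)))"
    unfolding inducing_character_def Let_def
  proof (rule the_equality, goal_cases)
    case 1
    show ?case
      using g g_eq one inducing_value[OF At.trunc_hom.S.one_closed At.trunc_hom.S.zero_closed g g g_eq]
      by (intro bexI[of _ "\<one>\<^bsub>RA\<^esub>"] bexI[of _ "\<zero>\<^bsub>RA\<^esub>"] bexI[of _ g] conjI) auto
  next
    case (2 c)
    then show ?case using inducing_value[OF _ _ _ g] by blast
  qed
  have "lin_comb RA \<beta> \<one>\<^bsub>RA\<^esub> \<zero>\<^bsub>RA\<^esub> \<in> matrix_torus RA \<beta>"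
    unfolding matrix_torus_def
    by (intro IntI CollectI exI[of _ "\<one>\<^bsub>RA\<^esub>"] exI[of _ "\<zero>\<^bsub>RA\<^esub>"] conjI refl)
      (simp_all add: one)
  then show "g \<in> inducing_subgroup A B p \<sigma> r (cB t)"
    unfolding inducing_subgroup_def set_mult_def using g g_eq by blast
qed

end

section \<open>Cuspidality\<close>

context cuspidal_datum begin

text \<open>
  Modulo \<open>p\<close> the norm form \<open>(X - t Y) (X - \<sigma> t Y)\<close> has no zero over \<open>A\<close> other than \<open>(0, 0)\<close>:
  if one factor vanishes so does its conjugate, and then \<open>(t - \<sigma> t) Y\<close> vanishes.  The hypothesis
  \<open>one\<close> says that \<open>x\<^sub>1\<^sub>1\<close> and \<open>x\<^sub>2\<^sub>1\<close> generate the unit ideal modulo \<open>p\<close>.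
\<close>

lemma norm_form_not_in_PIdl:
  assumes x: "x11 \<in> carrier A" "x21 \<in> carrier A" "y11 \<in> carrier A" "y12 \<in> carrier A"
    and one: "y11 \<otimes>\<^bsub>B\<^esub> x11 \<oplus>\<^bsub>B\<^esub> y12 \<otimes>\<^bsub>B\<^esub> x21 \<ominus>\<^bsub>B\<^esub> \<one>\<^bsub>B\<^esub> \<in> PIdl\<^bsub>B\<^esub> p"
  shows "(x21 \<ominus>\<^bsub>B\<^esub> t \<otimes>\<^bsub>B\<^esub> x11) \<otimes>\<^bsub>B\<^esub> (x21 \<ominus>\<^bsub>B\<^esub> \<sigma> t \<otimes>\<^bsub>B\<^esub> x11) \<notin> PIdl\<^bsub>B\<^esub> p"
proof
  interpret I: ideal "PIdl\<^bsub>B\<^esub> p" B using Bt.ideal_pow[of 1] by simp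
  have xB: "x11 \<in> carrier B" "x21 \<in> carrier B" "y11 \<in> carrier B" "y12 \<in> carrier B" using x by auto
  note tB = t_B \<sigma>.hom_closed[OF t_B]
  have swap: "\<sigma> a \<in> PIdl\<^bsub>B\<^esub> p" if a: "a \<in> PIdl\<^bsub>B\<^esub> p" for a
  proof -
    obtain c where "c \<in> carrier B" "a = p \<otimes>\<^bsub>B\<^esub> c" using a Bt.PIdl_iff[OF Bt.p_closed] by blast
    then have "\<sigma> c \<in> carrier B" "\<sigma> a = p \<otimes>\<^bsub>B\<^esub> \<sigma> c" by simp_all
    then show ?thesis using Bt.PIdl_iff[OF Bt.p_closed] by blast
  qed
  assume "(x21 \<ominus>\<^bsub>B\<^esub> t \<otimes>\<^bsub>B\<^esub> x11) \<otimes>\<^bsub>B\<^esub> (x21 \<ominus>\<^bsub>B\<^esub> \<sigma> t \<otimes>\<^bsub>B\<^esub> x11) \<in> PIdl\<^bsub>B\<^esub> p"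
  then have "x21 \<ominus>\<^bsub>B\<^esub> t \<otimes>\<^bsub>B\<^esub> x11 \<in> PIdl\<^bsub>B\<^esub> p \<or> x21 \<ominus>\<^bsub>B\<^esub> \<sigma> t \<otimes>\<^bsub>B\<^esub> x11 \<in> PIdl\<^bsub>B\<^esub> p"
    using xB by (intro p_prime) auto
  moreover have s1: "\<sigma> (x21 \<ominus>\<^bsub>B\<^esub> t \<otimes>\<^bsub>B\<^esub> x11) = x21 \<ominus>\<^bsub>B\<^esub> \<sigma> t \<otimes>\<^bsub>B\<^esub> x11"
    using xB x by (simp add: a_minus_def \<sigma>_fixes)
  moreover have s2: "\<sigma> (x21 \<ominus>\<^bsub>B\<^esub> \<sigma> t \<otimes>\<^bsub>B\<^esub> x11) = x21 \<ominus>\<^bsub>B\<^esub> t \<otimes>\<^bsub>B\<^esub> x11"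
    using xB x by (simp add: a_minus_def \<sigma>_fixes \<sigma>_invol)
  ultimately have both: "x21 \<ominus>\<^bsub>B\<^esub> t \<otimes>\<^bsub>B\<^esub> x11 \<in> PIdl\<^bsub>B\<^esub> p" "x21 \<ominus>\<^bsub>B\<^esub> \<sigma> t \<otimes>\<^bsub>B\<^esub> x11 \<in> PIdl\<^bsub>B\<^esub> p"
    using swap[of "x21 \<ominus>\<^bsub>B\<^esub> t \<otimes>\<^bsub>B\<^esub> x11"] swap[of "x21 \<ominus>\<^bsub>B\<^esub> \<sigma> t \<otimes>\<^bsub>B\<^esub> x11"] by auto
  have "(x21 \<ominus>\<^bsub>B\<^esub> \<sigma> t \<otimes>\<^bsub>B\<^esub> x11) \<ominus>\<^bsub>B\<^esub> (x21 \<ominus>\<^bsub>B\<^esub> t \<otimes>\<^bsub>B\<^esub> x11) = (t \<ominus>\<^bsub>B\<^esub> \<sigma> t) \<otimes>\<^bsub>B\<^esub> x11"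
    using xB tB by algebra
  then have "(t \<ominus>\<^bsub>B\<^esub> \<sigma> t) \<otimes>\<^bsub>B\<^esub> x11 \<in> PIdl\<^bsub>B\<^esub> p"
    using both I.a_closed I.a_inv_closed unfolding a_minus_def by metis
  then have x11: "x11 \<in> PIdl\<^bsub>B\<^esub> p"
    using p_prime[of "t \<ominus>\<^bsub>B\<^esub> \<sigma> t" x11] t_regular xB by auto
  have "x21 = (x21 \<ominus>\<^bsub>B\<^esub> t \<otimes>\<^bsub>B\<^esub> x11) \<oplus>\<^bsub>B\<^esub> t \<otimes>\<^bsub>B\<^esub> x11" using xB tB by algebra
  then have x21: "x21 \<in> PIdl\<^bsub>B\<^esub> p"
    using both I.a_closed I.I_l_closed[OF x11 t_B] by metis
  have "\<one>\<^bsub>B\<^esub> = (y11 \<otimes>\<^bsub>B\<^esub> x11 \<oplus>\<^bsub>B\<^esub> y12 \<otimes>\<^bsub>B\<^esub> x21) \<oplus>\<^bsub>B\<^esub> (\<ominus>\<^bsub>B\<^esub> (y11 \<otimes>\<^bsub>B\<^esub> x11 \<oplus>\<^bsub>B\<^esub> y12 \<otimes>\<^bsub>B\<^esub> x21 \<ominus>\<^bsub>B\<^esub> \<one>\<^bsub>B\<^esub>))"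
    using xB B.one_closed by algebra
  then have "\<one>\<^bsub>B\<^esub> \<in> PIdl\<^bsub>B\<^esub> p"
    using I.a_closed I.a_inv_closed one I.I_l_closed[OF x11 xB(3)] I.I_l_closed[OF x21 xB(4)] by metis
  then have "t \<ominus>\<^bsub>B\<^esub> \<sigma> t \<in> PIdl\<^bsub>B\<^esub> p"
    using I.one_imp_carrier by simp
  then show False using t_regular by simp
qed

text \<open>
  The ideal \<open>p\<^sup>r\<^sup>-\<^sup>1 A / p\<^sup>r A\<close>, the smallest nonzero ideal of \<open>A / p\<^sup>r A\<close>.
\<close>

definition "socle = (\<lambda>x. cA (p [^]\<^bsub>A\<^esub> (r - 1) \<otimes>\<^bsub>A\<^esub> x)) ` carrier A"

lemma finite_socle: "finite socle"
proof -
  \<comment> \<open>multiplication by p^(r - 1) factors through the residue field\<close>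
  have "socle = (\<lambda>x. trunc_map A p r (\<lambda>x. p [^]\<^bsub>A\<^esub> (r - 1) \<otimes>\<^bsub>A\<^esub> x) (trunc_class A p 1 x)) ` carrier A"
    unfolding socle_def using trunc_map_shift_class[of _ "r - 1" 1] l_pos by (intro image_cong) (auto simp: r_eq)
  also have "\<dots> = trunc_map A p r (\<lambda>x. p [^]\<^bsub>A\<^esub> (r - 1) \<otimes>\<^bsub>A\<^esub> x) ` carrier (trunc A p 1)"
    by (simp add: At.carrier_trunc image_image)
  also have "finite \<dots>"
    using finite_residue by (simp add: trunc_def)
  finally show ?thesis .
qed

lemma socle_closed: "z \<in> socle \<Longrightarrow> z \<in> carrier RA"
  unfolding socle_def by auto

lemma socle_multiple: "z \<in> socle \<Longrightarrow> \<exists>y\<in>carrier RA. z = \<epsilon> \<otimes>\<^bsub>RA\<^esub> y"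
proof -
  assume "z \<in> socle"
  then obtain x where x: "x \<in> carrier A" "z = cA (p [^]\<^bsub>A\<^esub> (r - 1) \<otimes>\<^bsub>A\<^esub> x)" unfolding socle_def by auto
  have "p [^]\<^bsub>A\<^esub> (r - 1) = p [^]\<^bsub>A\<^esub> l \<otimes>\<^bsub>A\<^esub> p [^]\<^bsub>A\<^esub> (l - 1)"
    using l_pos by (simp add: A.nat_pow_mult r_eq)
  then have "p [^]\<^bsub>A\<^esub> (r - 1) \<otimes>\<^bsub>A\<^esub> x = p [^]\<^bsub>A\<^esub> l \<otimes>\<^bsub>A\<^esub> (p [^]\<^bsub>A\<^esub> (l - 1) \<otimes>\<^bsub>A\<^esub> x)"
    using x(1) by (simp add: A.m_assoc)
  then have "z = \<epsilon> \<otimes>\<^bsub>RA\<^esub> cA (p [^]\<^bsub>A\<^esub> (l - 1) \<otimes>\<^bsub>A\<^esub> x)"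
    unfolding x(2) \<epsilon>_def using x(1) by simp
  then show ?thesis using x(1) by blast
qed

text \<open>
  For a unit \<open>C\<close> the character \<open>z \<mapsto> \<psi> (z C)\<close> of the socle is nontrivial, because \<open>\<psi>\<close> has level
  exactly \<open>r\<close>; translating by an element \<open>w\<close> where it is not \<open>1\<close> shows that its sum vanishes.
\<close>

lemma character_sum_socle:
  assumes C: "C \<in> carrier A" "C \<notin> PIdl\<^bsub>A\<^esub> p"
  shows "(\<Sum>z\<in>socle. trunc_char \<psi> (z \<otimes>\<^bsub>RA\<^esub> cA C)) = 0"
proof -
  have CU: "C \<in> Units A" using unit_A[OF C] .
  obtain x where "x \<in> PIdl\<^bsub>A\<^esub> (p [^]\<^bsub>A\<^esub> (r - 1))" and ne: "\<psi> x \<noteq> 1" using \<psi>_nontrivial by blast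
  then obtain n where n: "n \<in> carrier A" and x: "x = p [^]\<^bsub>A\<^esub> (r - 1) \<otimes>\<^bsub>A\<^esub> n"
    unfolding At.PIdl_iff[OF At.p_pow_closed] by blast
  define w where "w = p [^]\<^bsub>A\<^esub> (r - 1) \<otimes>\<^bsub>A\<^esub> (n \<otimes>\<^bsub>A\<^esub> inv\<^bsub>A\<^esub> C)"
  have wA: "w \<in> carrier A" unfolding w_def using n CU by simp
  have wC: "w \<otimes>\<^bsub>A\<^esub> C = x"
    unfolding w_def x using n CU C(1) by (simp add: A.m_assoc)
  have wZ: "cA w \<in> socle" unfolding socle_def w_def using n CU by (intro imageI) simp
  have add: "a \<oplus>\<^bsub>RA\<^esub> b \<in> socle" if "a \<in> socle" "b \<in> socle" for a b
  proof -
    obtain x y where "x \<in> carrier A" "y \<in> carrier A" "a = cA (p [^]\<^bsub>A\<^esub> (r - 1) \<otimes>\<^bsub>A\<^esub> x)"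
      "b = cA (p [^]\<^bsub>A\<^esub> (r - 1) \<otimes>\<^bsub>A\<^esub> y)" using \<open>a \<in> socle\<close> \<open>b \<in> socle\<close> unfolding socle_def by auto
    then have "a \<oplus>\<^bsub>RA\<^esub> b = cA (p [^]\<^bsub>A\<^esub> (r - 1) \<otimes>\<^bsub>A\<^esub> (x \<oplus>\<^bsub>A\<^esub> y))" "x \<oplus>\<^bsub>A\<^esub> y \<in> carrier A"
      by (simp_all add: At.trunc_hom.S.r_distr)
    then show ?thesis unfolding socle_def by blast
  qed
  have neg: "\<ominus>\<^bsub>RA\<^esub> a \<in> socle" if aZ: "a \<in> socle" for a
  proof -
    obtain x where "x \<in> carrier A" "a = cA (p [^]\<^bsub>A\<^esub> (r - 1) \<otimes>\<^bsub>A\<^esub> x)" using aZ unfolding socle_def by auto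
    then have "\<ominus>\<^bsub>RA\<^esub> a = cA (p [^]\<^bsub>A\<^esub> (r - 1) \<otimes>\<^bsub>A\<^esub> (\<ominus>\<^bsub>A\<^esub> x))" "\<ominus>\<^bsub>A\<^esub> x \<in> carrier A"
      by (simp_all add: At.trunc_hom.S.r_minus)
    then show ?thesis unfolding socle_def by blast
  qed
  let ?g = "\<lambda>z. trunc_char \<psi> (z \<otimes>\<^bsub>RA\<^esub> cA C)"
  have "(\<Sum>z\<in>socle. ?g z) = (\<Sum>z\<in>socle. ?g (cA w \<oplus>\<^bsub>RA\<^esub> z))"
    using socle_closed wA wZ add neg
    by (intro sum.reindex_bij_witness[where i = "\<lambda>z. cA w \<oplus>\<^bsub>RA\<^esub> z" and j = "\<lambda>z. \<ominus>\<^bsub>RA\<^esub> cA w \<oplus>\<^bsub>RA\<^esub> z"])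
      (auto simp: At.trunc_hom.S.r_neg1 At.trunc_hom.S.r_neg2)
  also have "\<dots> = (\<Sum>z\<in>socle. \<psi> x * ?g z)"
  proof (intro sum.cong refl)
    fix z assume "z \<in> socle"
    then have z: "z \<in> carrier RA" by (rule socle_closed)
    have wCc: "cA w \<otimes>\<^bsub>RA\<^esub> cA C = cA x"
      unfolding wC[symmetric] using wA C by simp
    have xA: "x \<in> carrier A" unfolding x using n by simp
    have "(cA w \<oplus>\<^bsub>RA\<^esub> z) \<otimes>\<^bsub>RA\<^esub> cA C = cA x \<oplus>\<^bsub>RA\<^esub> z \<otimes>\<^bsub>RA\<^esub> cA C"
      unfolding wCc[symmetric] using wA C z by (simp add: At.trunc_hom.S.l_distr)
    then show "?g (cA w \<oplus>\<^bsub>RA\<^esub> z) = \<psi> x * ?g z"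
      using z C xA by (simp add: \<psi>_add \<psi>_class)
  qed
  finally have "(\<Sum>z\<in>socle. ?g z) = \<psi> x * (\<Sum>z\<in>socle. ?g z)"
    by (simp only: sum_distrib_left[symmetric])
  then show ?thesis using ne by simp
qed

text \<open>
  The lower left entry of \<open>x\<^sup>-\<^sup>1 \<beta> x\<close> is a unit for every \<open>x\<close> in \<open>GL\<^sub>2\<close>, since \<open>\<beta>\<close> has no eigenvector
  modulo \<open>p\<close>: up to the unit \<open>- det x\<close> this entry is a value of the norm form.  (Here \<open>y = x\<^sup>-\<^sup>1\<close>.)
\<close>

lemma conjugate_corner_not_in_PIdl:
  assumes xc: "x11 \<in> carrier RA" "x12 \<in> carrier RA" "x21 \<in> carrier RA" "x22 \<in> carrier RA"
    and yc: "y11 \<in> carrier RA" "y12 \<in> carrier RA" "y21 \<in> carrier RA" "y22 \<in> carrier RA"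
    and YX': "y11 \<otimes>\<^bsub>RA\<^esub> x11 \<oplus>\<^bsub>RA\<^esub> y12 \<otimes>\<^bsub>RA\<^esub> x21 = \<one>\<^bsub>RA\<^esub>"
    "y21 \<otimes>\<^bsub>RA\<^esub> x11 \<oplus>\<^bsub>RA\<^esub> y22 \<otimes>\<^bsub>RA\<^esub> x21 = \<zero>\<^bsub>RA\<^esub>"
    "y21 \<otimes>\<^bsub>RA\<^esub> x12 \<oplus>\<^bsub>RA\<^esub> y22 \<otimes>\<^bsub>RA\<^esub> x22 = \<one>\<^bsub>RA\<^esub>"
    and C: "C \<in> carrier A"
    and C_eq: "x21 \<otimes>\<^bsub>RA\<^esub> y21 \<oplus>\<^bsub>RA\<^esub> (\<beta>\<^sub>2\<^sub>1 \<otimes>\<^bsub>RA\<^esub> (x11 \<otimes>\<^bsub>RA\<^esub> y22) \<oplus>\<^bsub>RA\<^esub> \<beta>\<^sub>2\<^sub>2 \<otimes>\<^bsub>RA\<^esub> (x21 \<otimes>\<^bsub>RA\<^esub> y22)) = cA C"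
  shows "C \<notin> PIdl\<^bsub>A\<^esub> p"
proof -
  let ?C = "x21 \<otimes>\<^bsub>RA\<^esub> y21 \<oplus>\<^bsub>RA\<^esub> (\<beta>\<^sub>2\<^sub>1 \<otimes>\<^bsub>RA\<^esub> (x11 \<otimes>\<^bsub>RA\<^esub> y22) \<oplus>\<^bsub>RA\<^esub> \<beta>\<^sub>2\<^sub>2 \<otimes>\<^bsub>RA\<^esub> (x21 \<otimes>\<^bsub>RA\<^esub> y22))"
  interpret I: ideal "PIdl\<^bsub>B\<^esub> p" B using Bt.ideal_pow[of 1] by simp
  obtain \<xi>11 \<xi>12 \<xi>21 \<xi>22 where \<xi>: "\<xi>11 \<in> carrier A" "\<xi>12 \<in> carrier A" "\<xi>21 \<in> carrier A" "\<xi>22 \<in> carrier A"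
    and x_\<xi>: "x11 = cA \<xi>11" "x12 = cA \<xi>12" "x21 = cA \<xi>21" "x22 = cA \<xi>22"
    using xc unfolding At.carrier_trunc by blast
  obtain \<eta>11 \<eta>12 where \<eta>: "\<eta>11 \<in> carrier A" "\<eta>12 \<in> carrier A" and y_\<eta>: "y11 = cA \<eta>11" "y12 = cA \<eta>12"
    using yc unfolding At.carrier_trunc by blast
  show ?thesis
  proof
    assume "C \<in> PIdl\<^bsub>A\<^esub> p"
    then obtain C' where C': "C' \<in> carrier A" "C = p \<otimes>\<^bsub>A\<^esub> C'"
      using At.PIdl_iff[OF At.p_closed] by blast
    define D where "D = \<xi>12 \<otimes>\<^bsub>A\<^esub> \<xi>21 \<ominus>\<^bsub>A\<^esub> \<xi>11 \<otimes>\<^bsub>A\<^esub> \<xi>22"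
    have DA: "D \<in> carrier A" unfolding D_def using \<xi> by simp
    define N where "N = \<ominus>\<^bsub>A\<^esub> (t \<otimes>\<^bsub>B\<^esub> \<sigma> t)"
    define T where "T = t \<oplus>\<^bsub>B\<^esub> \<sigma> t"
    have NT: "N \<in> carrier A" "T \<in> carrier A"
      unfolding N_def T_def using norm_A[OF t_B] trace_A[OF t_B] by auto
    have NB: "N = \<ominus>\<^bsub>B\<^esub> (t \<otimes>\<^bsub>B\<^esub> \<sigma> t)"
      unfolding N_def by (rule A_inv[OF norm_A[OF t_B]])
    define Q where "Q = \<xi>21 \<otimes>\<^bsub>A\<^esub> \<xi>21 \<ominus>\<^bsub>A\<^esub> T \<otimes>\<^bsub>A\<^esub> (\<xi>11 \<otimes>\<^bsub>A\<^esub> \<xi>21) \<ominus>\<^bsub>A\<^esub> N \<otimes>\<^bsub>A\<^esub> (\<xi>11 \<otimes>\<^bsub>A\<^esub> \<xi>11)"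
    have QA: "Q \<in> carrier A" unfolding Q_def using \<xi> NT by simp
    have "cA Q = x21 \<otimes>\<^bsub>RA\<^esub> x21 \<ominus>\<^bsub>RA\<^esub> \<beta>\<^sub>2\<^sub>2 \<otimes>\<^bsub>RA\<^esub> (x11 \<otimes>\<^bsub>RA\<^esub> x21) \<ominus>\<^bsub>RA\<^esub> \<beta>\<^sub>2\<^sub>1 \<otimes>\<^bsub>RA\<^esub> (x11 \<otimes>\<^bsub>RA\<^esub> x11)"
      unfolding Q_def x_\<xi> \<beta>\<^sub>2\<^sub>1_def \<beta>\<^sub>2\<^sub>2_def N_def[symmetric] T_def[symmetric]
      using \<xi> NT by (simp add: a_minus_def)
    also have "\<dots> = (x12 \<otimes>\<^bsub>RA\<^esub> x21 \<ominus>\<^bsub>RA\<^esub> x11 \<otimes>\<^bsub>RA\<^esub> x22) \<otimes>\<^bsub>RA\<^esub> ?C"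
      by (rule At.trunc_hom.S.norm_form_eq[OF xc yc(3,4) closed_RA(1,2) YX'(2,3)])
    also have "\<dots> = cA (D \<otimes>\<^bsub>A\<^esub> (p \<otimes>\<^bsub>A\<^esub> C'))"
      unfolding C_eq C'(2)[symmetric] unfolding x_\<xi> D_def using \<xi> C by (simp add: a_minus_def)
    finally have "cA Q = cA (D \<otimes>\<^bsub>A\<^esub> (p \<otimes>\<^bsub>A\<^esub> C'))" .
    then have "Q \<ominus>\<^bsub>B\<^esub> D \<otimes>\<^bsub>A\<^esub> (p \<otimes>\<^bsub>A\<^esub> C') \<in> PIdl\<^bsub>B\<^esub> p"
      using QA DA C'(1) l_pos by (intro minus_in_PIdl_of_trunc_class_eq[where k = r]) (simp_all add: r_eq)
    moreover have "D \<otimes>\<^bsub>A\<^esub> (p \<otimes>\<^bsub>A\<^esub> C') \<in> PIdl\<^bsub>B\<^esub> p"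
    proof -
      have "D \<otimes>\<^bsub>A\<^esub> (p \<otimes>\<^bsub>A\<^esub> C') = p \<otimes>\<^bsub>B\<^esub> (D \<otimes>\<^bsub>B\<^esub> C')" "D \<otimes>\<^bsub>B\<^esub> C' \<in> carrier B"
        using DA C'(1) by (simp_all add: A_ops B.m_lcomm)
      then show ?thesis using Bt.PIdl_iff[OF Bt.p_closed] by blast
    qed
    ultimately have "(Q \<ominus>\<^bsub>B\<^esub> D \<otimes>\<^bsub>A\<^esub> (p \<otimes>\<^bsub>A\<^esub> C')) \<oplus>\<^bsub>B\<^esub> D \<otimes>\<^bsub>A\<^esub> (p \<otimes>\<^bsub>A\<^esub> C') \<in> PIdl\<^bsub>B\<^esub> p"
      by (rule I.a_closed)
    moreover have "(Q \<ominus>\<^bsub>B\<^esub> D') \<oplus>\<^bsub>B\<^esub> D' = Q" if "D' \<in> carrier B" for D'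
      using that A_in_B[OF QA] by algebra
    moreover have "D \<otimes>\<^bsub>A\<^esub> (p \<otimes>\<^bsub>A\<^esub> C') \<in> carrier B" using DA C'(1) by (intro A_in_B) simp
    ultimately have "Q \<in> PIdl\<^bsub>B\<^esub> p" by simp
    moreover have "Q = (\<xi>21 \<ominus>\<^bsub>B\<^esub> t \<otimes>\<^bsub>B\<^esub> \<xi>11) \<otimes>\<^bsub>B\<^esub> (\<xi>21 \<ominus>\<^bsub>B\<^esub> \<sigma> t \<otimes>\<^bsub>B\<^esub> \<xi>11)"
    proof -
      have "Q = \<xi>21 \<otimes>\<^bsub>B\<^esub> \<xi>21 \<ominus>\<^bsub>B\<^esub> T \<otimes>\<^bsub>B\<^esub> (\<xi>11 \<otimes>\<^bsub>B\<^esub> \<xi>21) \<ominus>\<^bsub>B\<^esub> N \<otimes>\<^bsub>B\<^esub> (\<xi>11 \<otimes>\<^bsub>B\<^esub> \<xi>11)"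
        unfolding Q_def using \<xi> NT by (simp only: A_minus A.m_closed) (simp only: A_ops)
      also have "\<dots> = (\<xi>21 \<ominus>\<^bsub>B\<^esub> t \<otimes>\<^bsub>B\<^esub> \<xi>11) \<otimes>\<^bsub>B\<^esub> (\<xi>21 \<ominus>\<^bsub>B\<^esub> \<sigma> t \<otimes>\<^bsub>B\<^esub> \<xi>11)"
        unfolding T_def NB
        using A_in_B[OF \<xi>(1)] A_in_B[OF \<xi>(3)] t_B \<sigma>.hom_closed[OF t_B] by algebra
      finally show ?thesis .
    qed
    moreover have "\<eta>11 \<otimes>\<^bsub>B\<^esub> \<xi>11 \<oplus>\<^bsub>B\<^esub> \<eta>12 \<otimes>\<^bsub>B\<^esub> \<xi>21 \<ominus>\<^bsub>B\<^esub> \<one>\<^bsub>B\<^esub> \<in> PIdl\<^bsub>B\<^esub> p"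
    proof -
      have eA: "\<eta>11 \<otimes>\<^bsub>A\<^esub> \<xi>11 \<oplus>\<^bsub>A\<^esub> \<eta>12 \<otimes>\<^bsub>A\<^esub> \<xi>21 \<in> carrier A" using \<eta> \<xi> by simp
      have "cA (\<eta>11 \<otimes>\<^bsub>A\<^esub> \<xi>11 \<oplus>\<^bsub>A\<^esub> \<eta>12 \<otimes>\<^bsub>A\<^esub> \<xi>21) = cA \<one>\<^bsub>A\<^esub>"
        using YX'(1) unfolding x_\<xi> y_\<eta> using \<eta> \<xi> by simp
      from minus_in_PIdl_of_trunc_class_eq[OF eA A.one_closed _ this] show ?thesis
        using l_pos by (simp add: A_ops r_eq)
    qed
    ultimately show False
      using norm_form_not_in_PIdl[OF \<xi>(1,3) \<eta>] by simp
  qed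
qed

lemma cuspidal_character_diagonal:
  assumes i: "i \<le> r - 1" and \<alpha>: "\<alpha> \<in> Units RA" and \<delta>: "\<delta> \<in> Units RA"
    and u: "u \<in> Units RA" and diff: "\<alpha> \<ominus>\<^bsub>RA\<^esub> \<delta> = cA (p [^]\<^bsub>A\<^esub> i) \<otimes>\<^bsub>RA\<^esub> u"
  shows "cuspidal_character A B p \<sigma> r \<psi> \<nu> \<nu>' (cB t) (Mat2 \<alpha> \<zero>\<^bsub>RA\<^esub> \<zero>\<^bsub>RA\<^esub> \<delta>) = 0"
  unfolding cuspidal_character_def
proof (rule group.induced_character_eq_0[where Z = socle and u = "\<lambda>z. Mat2 \<one>\<^bsub>RA\<^esub> z \<zero>\<^bsub>RA\<^esub> \<one>\<^bsub>RA\<^esub>"])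
  show grp: "group (GL2 RA)" by (rule At.trunc_hom.S.group_GL2)
  interpret G: group "GL2 RA" by (rule grp)
  show "inducing_subgroup A B p \<sigma> r (cB t) \<subseteq> carrier (GL2 RA)"
  proof -
    have "level_subgroup A p r \<subseteq> carrier (GL2 RA)"
      unfolding level_subgroup_def congruence_subgroup_def by blast
    moreover have "matrix_torus RA \<beta> \<subseteq> carrier (GL2 RA)" unfolding matrix_torus_def by blast
    ultimately show ?thesis unfolding inducing_subgroup_def set_mult_def by blast
  qed
  show "Mat2 \<alpha> \<zero>\<^bsub>RA\<^esub> \<zero>\<^bsub>RA\<^esub> \<delta> \<in> carrier (GL2 RA)"
    by (rule At.trunc_hom.S.Mat2_diag[OF \<alpha> \<delta>])
  show "finite socle" by (rule finite_socle)
  show "socle \<noteq> {}" unfolding socle_def using A.one_closed by blast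
  show uni: "Mat2 \<one>\<^bsub>RA\<^esub> z \<zero>\<^bsub>RA\<^esub> \<one>\<^bsub>RA\<^esub> \<in> carrier (GL2 RA)" if "z \<in> socle" for z
    using that socle_closed At.trunc_hom.S.Mat2_upper_unipotent by blast
  note \<alpha>c = At.trunc_hom.S.Units_closed[OF \<alpha>] and \<delta>c = At.trunc_hom.S.Units_closed[OF \<delta>]
    and uc = At.trunc_hom.S.Units_closed[OF u]
  show "\<exists>h\<in>carrier (GL2 RA). h \<otimes>\<^bsub>GL2 RA\<^esub> Mat2 \<alpha> \<zero>\<^bsub>RA\<^esub> \<zero>\<^bsub>RA\<^esub> \<delta> =
      Mat2 \<alpha> \<zero>\<^bsub>RA\<^esub> \<zero>\<^bsub>RA\<^esub> \<delta> \<otimes>\<^bsub>GL2 RA\<^esub> Mat2 \<one>\<^bsub>RA\<^esub> z \<zero>\<^bsub>RA\<^esub> \<one>\<^bsub>RA\<^esub> \<otimes>\<^bsub>GL2 RA\<^esub> h" if "z \<in> socle" for z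
  proof -
    obtain n where n: "n \<in> carrier A" and z: "z = cA (p [^]\<^bsub>A\<^esub> (r - 1) \<otimes>\<^bsub>A\<^esub> n)"
      using \<open>z \<in> socle\<close> unfolding socle_def by blast
    let ?s = "cA (p [^]\<^bsub>A\<^esub> (r - 1 - i) \<otimes>\<^bsub>A\<^esub> n)"
    \<comment> \<open>from z = \<alpha>^-1 (\<delta> - \<alpha>) m; the bound on i makes p^(r - 1 - i) meaningful\<close>
    define m where "m = \<ominus>\<^bsub>RA\<^esub> (\<alpha> \<otimes>\<^bsub>RA\<^esub> (inv\<^bsub>RA\<^esub> u \<otimes>\<^bsub>RA\<^esub> ?s))"
    have sc: "?s \<in> carrier RA" using n by simp
    have pc: "cA (p [^]\<^bsub>A\<^esub> i) \<in> carrier RA" by simp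
    have uic: "inv\<^bsub>RA\<^esub> u \<in> carrier RA" using u by simp
    have mc: "m \<in> carrier RA" unfolding m_def using \<alpha>c uic sc by simp
    have zc: "z \<in> carrier RA" using \<open>z \<in> socle\<close> by (rule socle_closed)
    have "p [^]\<^bsub>A\<^esub> (r - 1) = p [^]\<^bsub>A\<^esub> i \<otimes>\<^bsub>A\<^esub> p [^]\<^bsub>A\<^esub> (r - 1 - i)"
      by (simp only: A.nat_pow_mult[OF At.p_closed] le_add_diff_inverse[OF i])
    then have "p [^]\<^bsub>A\<^esub> (r - 1) \<otimes>\<^bsub>A\<^esub> n = p [^]\<^bsub>A\<^esub> i \<otimes>\<^bsub>A\<^esub> (p [^]\<^bsub>A\<^esub> (r - 1 - i) \<otimes>\<^bsub>A\<^esub> n)"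
      using n by (simp add: A.m_assoc)
    then have zs: "z = cA (p [^]\<^bsub>A\<^esub> i) \<otimes>\<^bsub>RA\<^esub> ?s"
      unfolding z using n At.trunc_hom.hom_mult[of "p [^]\<^bsub>A\<^esub> i" "p [^]\<^bsub>A\<^esub> (r - 1 - i) \<otimes>\<^bsub>A\<^esub> n" r] by simp
    have "m \<otimes>\<^bsub>RA\<^esub> \<delta> = \<alpha> \<otimes>\<^bsub>RA\<^esub> m \<oplus>\<^bsub>RA\<^esub> (\<ominus>\<^bsub>RA\<^esub> m) \<otimes>\<^bsub>RA\<^esub> (\<alpha> \<ominus>\<^bsub>RA\<^esub> \<delta>)"
      using mc \<alpha>c \<delta>c by algebra
    also have "(\<ominus>\<^bsub>RA\<^esub> m) \<otimes>\<^bsub>RA\<^esub> (\<alpha> \<ominus>\<^bsub>RA\<^esub> \<delta>) = (inv\<^bsub>RA\<^esub> u \<otimes>\<^bsub>RA\<^esub> u) \<otimes>\<^bsub>RA\<^esub> (\<alpha> \<otimes>\<^bsub>RA\<^esub> (cA (p [^]\<^bsub>A\<^esub> i) \<otimes>\<^bsub>RA\<^esub> ?s))"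
      unfolding diff m_def using \<alpha>c uic sc pc uc by algebra
    also have "\<dots> = \<alpha> \<otimes>\<^bsub>RA\<^esub> z"
      unfolding zs[symmetric] using u \<alpha>c zc by simp
    finally have key: "m \<otimes>\<^bsub>RA\<^esub> \<delta> = \<alpha> \<otimes>\<^bsub>RA\<^esub> z \<oplus>\<^bsub>RA\<^esub> \<alpha> \<otimes>\<^bsub>RA\<^esub> m"
      using \<alpha>c mc zc by (simp add: At.trunc_hom.S.a_comm)
    show ?thesis
      using At.trunc_hom.S.diag_unipotent_conj[OF \<alpha>c \<delta>c zc mc key]
        At.trunc_hom.S.Mat2_upper_unipotent[OF mc] by blast
  qed
  fix X assume X: "X \<in> carrier (GL2 RA)"
  let ?Y = "inv\<^bsub>GL2 RA\<^esub> X"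
  have Y: "?Y \<in> carrier (GL2 RA)" using X by simp
  obtain x11 x12 x21 x22 where X_eq: "X = Mat2 x11 x12 x21 x22" by (cases X)
  obtain y11 y12 y21 y22 where Y_eq: "?Y = Mat2 y11 y12 y21 y22" by (cases ?Y)
  have XM: "Mat2 x11 x12 x21 x22 \<in> carrier (mat2_ring RA)" and YM: "Mat2 y11 y12 y21 y22 \<in> carrier (mat2_ring RA)"
    using X Y unfolding X_eq[symmetric] Y_eq[symmetric] by (auto simp: At.trunc_hom.S.GL2_carrier_iff)
  have XY: "Mat2 x11 x12 x21 x22 \<otimes>\<^bsub>mat2_ring RA\<^esub> Mat2 y11 y12 y21 y22 = \<one>\<^bsub>mat2_ring RA\<^esub>"
    and YX: "Mat2 y11 y12 y21 y22 \<otimes>\<^bsub>mat2_ring RA\<^esub> Mat2 x11 x12 x21 x22 = \<one>\<^bsub>mat2_ring RA\<^esub>"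
    using G.r_inv[OF X] G.l_inv[OF X] unfolding X_eq[symmetric] Y_eq[symmetric]
    by (simp_all add: At.trunc_hom.S.GL2_mult At.trunc_hom.S.GL2_one At.trunc_hom.S.mat2_simps)
  have xc: "x11 \<in> carrier RA" "x12 \<in> carrier RA" "x21 \<in> carrier RA" "x22 \<in> carrier RA"
    and yc: "y11 \<in> carrier RA" "y12 \<in> carrier RA" "y21 \<in> carrier RA" "y22 \<in> carrier RA"
    using XM YM by (simp_all add: At.trunc_hom.S.mat2_simps)
  have YX': "y11 \<otimes>\<^bsub>RA\<^esub> x11 \<oplus>\<^bsub>RA\<^esub> y12 \<otimes>\<^bsub>RA\<^esub> x21 = \<one>\<^bsub>RA\<^esub>"
    "y21 \<otimes>\<^bsub>RA\<^esub> x11 \<oplus>\<^bsub>RA\<^esub> y22 \<otimes>\<^bsub>RA\<^esub> x21 = \<zero>\<^bsub>RA\<^esub>"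
    "y21 \<otimes>\<^bsub>RA\<^esub> x12 \<oplus>\<^bsub>RA\<^esub> y22 \<otimes>\<^bsub>RA\<^esub> x22 = \<one>\<^bsub>RA\<^esub>"
    using YX by (simp_all add: At.trunc_hom.S.mat2_simps)
  let ?C = "x21 \<otimes>\<^bsub>RA\<^esub> y21 \<oplus>\<^bsub>RA\<^esub> (\<beta>\<^sub>2\<^sub>1 \<otimes>\<^bsub>RA\<^esub> (x11 \<otimes>\<^bsub>RA\<^esub> y22) \<oplus>\<^bsub>RA\<^esub> \<beta>\<^sub>2\<^sub>2 \<otimes>\<^bsub>RA\<^esub> (x21 \<otimes>\<^bsub>RA\<^esub> y22))"
  have conj_eq: "X \<otimes>\<^bsub>GL2 RA\<^esub> Mat2 \<one>\<^bsub>RA\<^esub> z \<zero>\<^bsub>RA\<^esub> \<one>\<^bsub>RA\<^esub> \<otimes>\<^bsub>GL2 RA\<^esub> ?Y =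
      Mat2 (\<one>\<^bsub>RA\<^esub> \<oplus>\<^bsub>RA\<^esub> z \<otimes>\<^bsub>RA\<^esub> (x11 \<otimes>\<^bsub>RA\<^esub> y21)) (z \<otimes>\<^bsub>RA\<^esub> (x11 \<otimes>\<^bsub>RA\<^esub> y22))
        (z \<otimes>\<^bsub>RA\<^esub> (x21 \<otimes>\<^bsub>RA\<^esub> y21)) (\<one>\<^bsub>RA\<^esub> \<oplus>\<^bsub>RA\<^esub> z \<otimes>\<^bsub>RA\<^esub> (x21 \<otimes>\<^bsub>RA\<^esub> y22))" if "z \<in> carrier RA" for z
    using At.trunc_hom.S.unipotent_conj[OF XM YM XY that]
    unfolding At.trunc_hom.S.GL2_mult Y_eq unfolding X_eq .
  have level: "X \<otimes>\<^bsub>GL2 RA\<^esub> Mat2 \<one>\<^bsub>RA\<^esub> z \<zero>\<^bsub>RA\<^esub> \<one>\<^bsub>RA\<^esub> \<otimes>\<^bsub>GL2 RA\<^esub> ?Y \<in> level_subgroup A p r" if z: "z \<in> socle" for z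
  proof -
    obtain y where y: "y \<in> carrier RA" "z = \<epsilon> \<otimes>\<^bsub>RA\<^esub> y" using socle_multiple[OF z] by blast
    have assoc: "z \<otimes>\<^bsub>RA\<^esub> c = \<epsilon> \<otimes>\<^bsub>RA\<^esub> (y \<otimes>\<^bsub>RA\<^esub> c)" if "c \<in> carrier RA" for c
      using that y by (simp add: At.trunc_hom.S.m_assoc)
    have "X \<otimes>\<^bsub>GL2 RA\<^esub> Mat2 \<one>\<^bsub>RA\<^esub> z \<zero>\<^bsub>RA\<^esub> \<one>\<^bsub>RA\<^esub> \<otimes>\<^bsub>GL2 RA\<^esub> ?Y \<in> carrier (GL2 RA)"
      using X uni[OF z] by simp
    then show ?thesis
      unfolding conj_eq[OF socle_closed[OF z]]
      using xc yc y(1) by (simp only: assoc At.trunc_hom.S.m_closed) (rule level_subgroupI, simp_all)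
  qed
  show "X \<otimes>\<^bsub>GL2 RA\<^esub> Mat2 \<one>\<^bsub>RA\<^esub> z \<zero>\<^bsub>RA\<^esub> \<one>\<^bsub>RA\<^esub> \<otimes>\<^bsub>GL2 RA\<^esub> ?Y \<in> inducing_subgroup A B p \<sigma> r (cB t)"
    if "z \<in> socle" for z
    by (rule inducing_character_on_level_subgroup(2)[OF level[OF that]])
  have \<chi>: "inducing_character A B p \<sigma> r \<psi> \<nu> \<nu>' (cB t) (X \<otimes>\<^bsub>GL2 RA\<^esub> Mat2 \<one>\<^bsub>RA\<^esub> z \<zero>\<^bsub>RA\<^esub> \<one>\<^bsub>RA\<^esub> \<otimes>\<^bsub>GL2 RA\<^esub> ?Y) =
      trunc_char \<psi> (z \<otimes>\<^bsub>RA\<^esub> ?C)" if z: "z \<in> socle" for z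
  proof -
    have zc: "z \<in> carrier RA" using z by (rule socle_closed)
    have "z \<otimes>\<^bsub>RA\<^esub> (x21 \<otimes>\<^bsub>RA\<^esub> y21) \<oplus>\<^bsub>RA\<^esub> (\<beta>\<^sub>2\<^sub>1 \<otimes>\<^bsub>RA\<^esub> (z \<otimes>\<^bsub>RA\<^esub> (x11 \<otimes>\<^bsub>RA\<^esub> y22)) \<oplus>\<^bsub>RA\<^esub> \<beta>\<^sub>2\<^sub>2 \<otimes>\<^bsub>RA\<^esub> (z \<otimes>\<^bsub>RA\<^esub> (x21 \<otimes>\<^bsub>RA\<^esub> y22))) = z \<otimes>\<^bsub>RA\<^esub> ?C"
      using zc xc yc closed_RA by algebra
    moreover have "trunc_char \<psi> (mat2_trace RA (\<beta> \<otimes>\<^bsub>mat2_ring RA\<^esub>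
        (X \<otimes>\<^bsub>GL2 RA\<^esub> Mat2 \<one>\<^bsub>RA\<^esub> z \<zero>\<^bsub>RA\<^esub> \<one>\<^bsub>RA\<^esub> \<otimes>\<^bsub>GL2 RA\<^esub> ?Y \<ominus>\<^bsub>mat2_ring RA\<^esub> \<one>\<^bsub>mat2_ring RA\<^esub>))) =
      trunc_char \<psi> (z \<otimes>\<^bsub>RA\<^esub> (x21 \<otimes>\<^bsub>RA\<^esub> y21) \<oplus>\<^bsub>RA\<^esub> (\<beta>\<^sub>2\<^sub>1 \<otimes>\<^bsub>RA\<^esub> (z \<otimes>\<^bsub>RA\<^esub> (x11 \<otimes>\<^bsub>RA\<^esub> y22)) \<oplus>\<^bsub>RA\<^esub> \<beta>\<^sub>2\<^sub>2 \<otimes>\<^bsub>RA\<^esub> (z \<otimes>\<^bsub>RA\<^esub> (x21 \<otimes>\<^bsub>RA\<^esub> y22))))"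
      unfolding conj_eq[OF zc] using zc xc yc by (subst trace_beta_minus_one) simp_all
    ultimately show ?thesis
      unfolding inducing_character_on_level_subgroup(1)[OF level[OF z]] by simp
  qed
  have "?C \<in> carrier RA" using xc yc by simp
  then obtain C where C: "C \<in> carrier A" and C_eq: "?C = cA C"
    unfolding At.carrier_trunc by blast
  have "C \<notin> PIdl\<^bsub>A\<^esub> p"
    by (rule conjugate_corner_not_in_PIdl[OF xc yc YX' C C_eq])
  from character_sum_socle[OF C this]
  show "(\<Sum>z\<in>socle. inducing_character A B p \<sigma> r \<psi> \<nu> \<nu>' (cB t)
      (X \<otimes>\<^bsub>GL2 RA\<^esub> Mat2 \<one>\<^bsub>RA\<^esub> z \<zero>\<^bsub>RA\<^esub> \<one>\<^bsub>RA\<^esub> \<otimes>\<^bsub>GL2 RA\<^esub> ?Y)) = 0"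
    by (simp add: \<chi> C_eq)
qed

end

section \<open>Discrete valuations\<close>

context discrete_valuation_field begin

lemma val_one: "v \<one> = 0"
  using val_mult[of \<one> \<one>] by simp

lemma val_minus: "x \<in> carrier F - {\<zero>} \<Longrightarrow> v (\<ominus> x) = v x"
proof -
  assume x: "x \<in> carrier F - {\<zero>}"
  have m1: "\<ominus> \<one> \<in> carrier F - {\<zero>}" by auto
  have "\<ominus> \<one> \<otimes> \<ominus> \<one> = \<one>" by algebra
  then have "v (\<ominus> \<one>) = 0" using val_mult[OF m1 m1] val_one by simp
  moreover have "\<ominus> x = \<ominus> \<one> \<otimes> x" using x by (simp add: l_minus)
  ultimately show ?thesis using val_mult[OF m1 x] by simp
qed

lemma val_ge_zero [simp]: "val_ge F v n \<zero>"
  by (simp add: val_ge_def)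

lemma val_ge_mono: "val_ge F v m x \<Longrightarrow> n \<le> m \<Longrightarrow> val_ge F v n x"
  by (auto simp: val_ge_def)

lemma val_ge_one: "val_ge F v 0 \<one>"
  by (simp add: val_ge_def val_one)

lemma val_ge_add:
  "\<lbrakk>x \<in> carrier F; y \<in> carrier F; val_ge F v n x; val_ge F v n y\<rbrakk> \<Longrightarrow> val_ge F v n (x \<oplus> y)"
  using val_add[of x y] unfolding val_ge_def by fastforce

lemma val_ge_mult:
  "\<lbrakk>x \<in> carrier F; y \<in> carrier F; val_ge F v m x; val_ge F v n y\<rbrakk> \<Longrightarrow> val_ge F v (m + n) (x \<otimes> y)"
  using val_mult[of x y] unfolding val_ge_def by fastforce

lemma val_ge_uminus: "\<lbrakk>x \<in> carrier F; val_ge F v n x\<rbrakk> \<Longrightarrow> val_ge F v n (\<ominus> x)"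
  using val_minus[of x] unfolding val_ge_def by fastforce

lemma val_ge_minus:
  "\<lbrakk>x \<in> carrier F; y \<in> carrier F; val_ge F v n x; val_ge F v n y\<rbrakk> \<Longrightarrow> val_ge F v n (x \<ominus> y)"
  unfolding a_minus_def by (intro val_ge_add val_ge_uminus a_inv_closed)

lemma val_ge_all_imp_zero:
  assumes "\<And>n. val_ge F v n x"
  shows "x = \<zero>"
  using assms[of "v x + 1"] by (simp add: val_ge_def)

lemma val_ge_inv:
  assumes "x \<in> carrier F" "x \<noteq> \<zero>" "v x \<le> n"
  shows "inv x \<in> carrier F" "val_ge F v (- n) (inv x)" "inv x \<otimes> x = \<one>"
proof -
  have U: "x \<in> Units F" using assms field_Units by auto
  then show cl: "inv x \<in> carrier F" and e: "inv x \<otimes> x = \<one>" by simp_all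
  have "inv x \<noteq> \<zero>" using e assms zero_not_one l_null by metis
  then have "v (inv x) + v x = 0"
    using val_mult[of "inv x" x] cl assms e val_one by simp
  then show "val_ge F v (- n) (inv x)" using assms by (simp add: val_ge_def)
qed

abbreviation "Ov \<equiv> valuation_ring F v"

lemma carrier_Ov: "x \<in> carrier Ov \<longleftrightarrow> x \<in> carrier F \<and> val_ge F v 0 x"
  by (simp add: valuation_ring_def)

lemma Ov_ops: "mult Ov = mult F" "add Ov = add F" "one Ov = one F" "zero Ov = zero F"
  by (simp_all add: valuation_ring_def)

lemma subring_Ov: "subring (carrier Ov) F"
  by (rule subringI) (auto simp: carrier_Ov val_ge_one intro: val_ge_add val_ge_uminus val_ge_mult[where m = 0 and n = 0, simplified])

lemma domain_Ov: "domain Ov"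
  using subring_is_domain[OF subring_Ov] by (simp add: valuation_ring_def)

lemma uniformizer_Ov: "\<pi> \<in> carrier Ov"
  using uniformizer_carrier uniformizer_val by (simp add: carrier_Ov val_ge_def)

lemma PIdl_Ov_iff:
  assumes x: "x \<in> carrier Ov"
  shows "x \<in> PIdl\<^bsub>Ov\<^esub> \<pi> \<longleftrightarrow> val_ge F v 1 x"
proof
  assume "x \<in> PIdl\<^bsub>Ov\<^esub> \<pi>"
  then obtain y where y: "y \<in> carrier Ov" "x = y \<otimes> \<pi>"
    by (auto simp: cgenideal_def Ov_ops)
  have "val_ge F v 1 \<pi>" using uniformizer_val by (simp add: val_ge_def)
  then show "val_ge F v 1 x"
    using val_ge_mult[of y \<pi> 0 1] y uniformizer_carrier by (simp add: carrier_Ov)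
next
  assume ge: "val_ge F v 1 x"
  have \<pi>: "\<pi> \<in> carrier F" "\<pi> \<noteq> \<zero>" "v \<pi> \<le> 1" using uniformizer_carrier uniformizer_val by auto
  note i = val_ge_inv[OF \<pi>]
  have "x \<otimes> inv \<pi> \<in> carrier Ov"
    using val_ge_mult[of x "inv \<pi>" 1 "-1"] ge i x by (simp add: carrier_Ov)
  moreover have "x = (x \<otimes> inv \<pi>) \<otimes> \<pi>" using i x \<pi> by (simp add: carrier_Ov m_assoc)
  ultimately show "x \<in> PIdl\<^bsub>Ov\<^esub> \<pi>" by (auto simp: cgenideal_def Ov_ops)
qed

lemma Units_OvI:
  assumes x: "x \<in> carrier Ov" and nge: "\<not> val_ge F v 1 x"
  shows "x \<in> Units Ov"
proof -
  have x': "x \<in> carrier F" "x \<noteq> \<zero>" "v x \<le> 0" using assms by (auto simp: carrier_Ov val_ge_def)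
  note i = val_ge_inv[OF x']
  have "inv x \<in> carrier Ov" using i by (simp add: carrier_Ov)
  moreover have "x \<otimes> inv x = \<one>" using i x' m_comm by metis
  ultimately show ?thesis using x i unfolding Units_def by (auto simp: Ov_ops)
qed

lemma val_ge_mult_cases:
  assumes "x \<in> carrier Ov" "y \<in> carrier Ov" "val_ge F v 1 (x \<otimes> y)"
  shows "val_ge F v 1 x \<or> val_ge F v 1 y"
  using assms val_mult[of x y] integral[of x y] unfolding carrier_Ov val_ge_def by force

end


section \<open>Unramified quadratic extensions of local fields\<close>

context unramified_quadratic_extension begin

lemma F_ops: "mult F = mult E" "add F = add E" "one F = one E" "zero F = zero E"
  using arg_cong[OF restrict, of mult] arg_cong[OF restrict, of add] arg_cong[OF restrict, of one]
    arg_cong[OF restrict, of zero] by simp_all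

lemma F_in_E: "x \<in> carrier F \<Longrightarrow> x \<in> carrier E"
  using subfieldE(3)[OF subfield] by auto

lemma F_inv: "x \<in> carrier F \<Longrightarrow> \<ominus>\<^bsub>F\<^esub> x = \<ominus>\<^bsub>E\<^esub> x"
  using base.l_neg[of x] by (intro ext.minus_equality[symmetric]) (auto simp: F_ops F_in_E)

lemma F_minus: "y \<in> carrier F \<Longrightarrow> x \<ominus>\<^bsub>F\<^esub> y = x \<ominus>\<^bsub>E\<^esub> y"
  by (simp add: a_minus_def F_ops F_inv)

lemma val_ge_F: "x \<in> carrier F \<Longrightarrow> val_ge F v n x \<longleftrightarrow> val_ge E w n x"
  using val_extends[of x] by (cases "x = \<zero>\<^bsub>E\<^esub>") (simp_all add: val_ge_def F_ops)

sublocale gal: ring_hom_cring E E \<sigma>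
  using galois_iso by unfold_locales (auto simp: ring_iso_def)

text \<open>
  An element moved by \<open>\<sigma>\<close> generates the extension, and \<open>\<sigma>\<close> takes it to the other root of its
  quadratic equation.  Trace, norm and the order of \<open>\<sigma>\<close> are read off from this generator.
\<close>

lemma quadratic_generator:
  obtains \<theta> s n where "\<theta> \<in> carrier E" "s \<in> carrier F" "n \<in> carrier F"
    "\<theta> \<oplus>\<^bsub>E\<^esub> \<sigma> \<theta> = s" "\<theta> \<otimes>\<^bsub>E\<^esub> \<sigma> \<theta> = n"
    "\<forall>x\<in>carrier E. \<exists>c\<in>carrier F. \<exists>d\<in>carrier F. x = c \<otimes>\<^bsub>E\<^esub> \<theta> \<oplus>\<^bsub>E\<^esub> d"
proof -
  obtain \<theta> where \<theta>: "\<theta> \<in> carrier E" and ne: "\<sigma> \<theta> \<noteq> \<theta>" using galois_nontrivial by blast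
  have \<theta>F: "\<theta> \<notin> carrier F" using ne galois_fixes by blast
  have one: "ext.Span (carrier F) [\<one>\<^bsub>E\<^esub>] = carrier F"
  proof -
    have "x \<in> ext.line_extension (carrier F) \<one>\<^bsub>E\<^esub> {\<zero>\<^bsub>E\<^esub>} \<longleftrightarrow> x \<in> carrier F" for x
      using F_in_E by (auto simp: ext.line_extension_mem_iff)
    then show ?thesis by auto
  qed
  have "ext.independent (carrier F) [\<theta>, \<one>\<^bsub>E\<^esub>]"
    using \<theta> \<theta>F one by (intro ext.li_Cons ext.li_Nil) auto
  then have span: "ext.Span (carrier F) [\<theta>, \<one>\<^bsub>E\<^esub>] = carrier E"
    by (rule ext.independent_length_eq_dimension[OF subfield degree_two, THEN iffD1])
      (use \<theta> in auto)
  have rep: "\<exists>c\<in>carrier F. \<exists>d\<in>carrier F. x = c \<otimes>\<^bsub>E\<^esub> \<theta> \<oplus>\<^bsub>E\<^esub> d" if "x \<in> carrier E" for x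
  proof -
    have "x \<in> ext.line_extension (carrier F) \<theta> (ext.Span (carrier F) [\<one>\<^bsub>E\<^esub>])"
      using span that by simp
    then show ?thesis unfolding one ext.line_extension_mem_iff .
  qed
  obtain a b where ab: "a \<in> carrier F" "b \<in> carrier F" and sq: "\<theta> \<otimes>\<^bsub>E\<^esub> \<theta> = a \<otimes>\<^bsub>E\<^esub> \<theta> \<oplus>\<^bsub>E\<^esub> b"
    using rep[of "\<theta> \<otimes>\<^bsub>E\<^esub> \<theta>"] \<theta> by auto
  note cl = \<theta> gal.hom_closed[OF \<theta>] F_in_E[OF ab(1)] F_in_E[OF ab(2)]
  have sq': "\<sigma> \<theta> \<otimes>\<^bsub>E\<^esub> \<sigma> \<theta> = a \<otimes>\<^bsub>E\<^esub> \<sigma> \<theta> \<oplus>\<^bsub>E\<^esub> b"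
    using arg_cong[OF sq, of \<sigma>] cl by (simp add: galois_fixes ab)
  have "(\<sigma> \<theta> \<ominus>\<^bsub>E\<^esub> \<theta>) \<otimes>\<^bsub>E\<^esub> (\<theta> \<oplus>\<^bsub>E\<^esub> \<sigma> \<theta> \<ominus>\<^bsub>E\<^esub> a) =
      \<sigma> \<theta> \<otimes>\<^bsub>E\<^esub> \<sigma> \<theta> \<ominus>\<^bsub>E\<^esub> \<theta> \<otimes>\<^bsub>E\<^esub> \<theta> \<ominus>\<^bsub>E\<^esub> a \<otimes>\<^bsub>E\<^esub> \<sigma> \<theta> \<oplus>\<^bsub>E\<^esub> a \<otimes>\<^bsub>E\<^esub> \<theta>"
    using cl by algebra
  also have "\<dots> = \<zero>\<^bsub>E\<^esub>" unfolding sq sq' using cl by algebra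
  finally have "\<sigma> \<theta> \<ominus>\<^bsub>E\<^esub> \<theta> = \<zero>\<^bsub>E\<^esub> \<or> \<theta> \<oplus>\<^bsub>E\<^esub> \<sigma> \<theta> \<ominus>\<^bsub>E\<^esub> a = \<zero>\<^bsub>E\<^esub>"
    using cl by (intro ext.integral) auto
  then have s: "\<theta> \<oplus>\<^bsub>E\<^esub> \<sigma> \<theta> = a"
    using ne cl by auto
  have "\<theta> \<otimes>\<^bsub>E\<^esub> \<sigma> \<theta> = \<theta> \<otimes>\<^bsub>E\<^esub> (\<theta> \<oplus>\<^bsub>E\<^esub> \<sigma> \<theta>) \<ominus>\<^bsub>E\<^esub> \<theta> \<otimes>\<^bsub>E\<^esub> \<theta>"
    using cl by algebra
  also have "\<dots> = \<ominus>\<^bsub>E\<^esub> b" unfolding s sq using cl by algebra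
  finally have n: "\<theta> \<otimes>\<^bsub>E\<^esub> \<sigma> \<theta> = \<ominus>\<^bsub>E\<^esub> b" .
  show thesis
    by (rule that[OF \<theta> ab(1) _ s n]) (use ab F_inv[OF ab(2)] base.a_inv_closed[OF ab(2)] rep in auto)
qed

lemma galois_facts:
  assumes x: "x \<in> carrier E"
  shows galois_trace: "x \<oplus>\<^bsub>E\<^esub> \<sigma> x \<in> carrier F"
    and galois_norm: "x \<otimes>\<^bsub>E\<^esub> \<sigma> x \<in> carrier F"
    and galois_involution: "\<sigma> (\<sigma> x) = x"
proof -
  obtain \<theta> s n where \<theta>: "\<theta> \<in> carrier E" and sn: "s \<in> carrier F" "n \<in> carrier F"
    and s: "\<theta> \<oplus>\<^bsub>E\<^esub> \<sigma> \<theta> = s" and n: "\<theta> \<otimes>\<^bsub>E\<^esub> \<sigma> \<theta> = n"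
    and rep: "\<forall>x\<in>carrier E. \<exists>c\<in>carrier F. \<exists>d\<in>carrier F. x = c \<otimes>\<^bsub>E\<^esub> \<theta> \<oplus>\<^bsub>E\<^esub> d"
    by (rule quadratic_generator)
  obtain c d where cd: "c \<in> carrier F" "d \<in> carrier F" and x_eq: "x = c \<otimes>\<^bsub>E\<^esub> \<theta> \<oplus>\<^bsub>E\<^esub> d"
    using rep x by blast
  note cl = \<theta> gal.hom_closed[OF \<theta>] F_in_E[OF cd(1)] F_in_E[OF cd(2)] F_in_E[OF sn(1)] F_in_E[OF sn(2)]
  have \<sigma>x: "\<sigma> x = c \<otimes>\<^bsub>E\<^esub> \<sigma> \<theta> \<oplus>\<^bsub>E\<^esub> d" unfolding x_eq using cl by (simp add: galois_fixes cd)
  have "x \<oplus>\<^bsub>E\<^esub> \<sigma> x = c \<otimes>\<^bsub>E\<^esub> (\<theta> \<oplus>\<^bsub>E\<^esub> \<sigma> \<theta>) \<oplus>\<^bsub>E\<^esub> (d \<oplus>\<^bsub>E\<^esub> d)"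
    unfolding \<sigma>x unfolding x_eq using cl by algebra
  also have "\<dots> = c \<otimes>\<^bsub>F\<^esub> s \<oplus>\<^bsub>F\<^esub> (d \<oplus>\<^bsub>F\<^esub> d)" unfolding s F_ops ..
  also have "\<dots> \<in> carrier F" using cd sn by (intro base.a_closed base.m_closed)
  finally show "x \<oplus>\<^bsub>E\<^esub> \<sigma> x \<in> carrier F" .
  have "x \<otimes>\<^bsub>E\<^esub> \<sigma> x = c \<otimes>\<^bsub>E\<^esub> c \<otimes>\<^bsub>E\<^esub> (\<theta> \<otimes>\<^bsub>E\<^esub> \<sigma> \<theta>) \<oplus>\<^bsub>E\<^esub> (c \<otimes>\<^bsub>E\<^esub> d \<otimes>\<^bsub>E\<^esub> (\<theta> \<oplus>\<^bsub>E\<^esub> \<sigma> \<theta>) \<oplus>\<^bsub>E\<^esub> d \<otimes>\<^bsub>E\<^esub> d)"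
    unfolding \<sigma>x unfolding x_eq using cl by algebra
  also have "\<dots> = c \<otimes>\<^bsub>F\<^esub> c \<otimes>\<^bsub>F\<^esub> n \<oplus>\<^bsub>F\<^esub> (c \<otimes>\<^bsub>F\<^esub> d \<otimes>\<^bsub>F\<^esub> s \<oplus>\<^bsub>F\<^esub> d \<otimes>\<^bsub>F\<^esub> d)" unfolding s n F_ops ..
  also have "\<dots> \<in> carrier F" using cd sn by (intro base.a_closed base.m_closed)
  finally show "x \<otimes>\<^bsub>E\<^esub> \<sigma> x \<in> carrier F" .
  have "\<sigma> \<theta> = s \<ominus>\<^bsub>E\<^esub> \<theta>" unfolding s[symmetric] using cl(1,2) by algebra
  then have "\<sigma> (\<sigma> \<theta>) = s \<ominus>\<^bsub>E\<^esub> \<sigma> \<theta>" using cl by (simp add: a_minus_def galois_fixes sn)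
  also have "\<dots> = \<theta>" unfolding s[symmetric] using cl(1,2) by algebra
  finally show "\<sigma> (\<sigma> x) = x"
    unfolding \<sigma>x using cl by (simp add: galois_fixes cd x_eq)
qed

text \<open>
  This is where completeness enters.  The elements \<open>u\<close> and \<open>1 - u = \<sigma> u\<close> are the roots of
  \<open>X\<^sup>2 - X + e\<close> with \<open>e = u (1 - u)\<close> in \<open>F\<close>.  If \<open>u\<close> were in the maximal ideal, the
  iteration \<open>y \<mapsto> y\<^sup>2 + e\<close> would stay in \<open>F\<close> and contract to \<open>u\<close>, so \<open>u\<close> would lie in \<open>F\<close> and
  be fixed by \<open>\<sigma>\<close>; but then \<open>1 = u + u\<close>.
\<close>

lemma no_small_element_of_trace_one:
  assumes u: "u \<in> carrier E" and ge: "val_ge E w 1 u" and tr: "u \<oplus>\<^bsub>E\<^esub> \<sigma> u = \<one>\<^bsub>E\<^esub>"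
  shows False
proof -
  define e where "e = u \<otimes>\<^bsub>E\<^esub> \<sigma> u"
  have eF: "e \<in> carrier F" unfolding e_def by (rule galois_norm[OF u])
  have \<sigma>u: "\<sigma> u = \<one>\<^bsub>E\<^esub> \<ominus>\<^bsub>E\<^esub> u" unfolding tr[symmetric] using u gal.hom_closed[OF u] by algebra
  have e_eq: "e = u \<ominus>\<^bsub>E\<^esub> u \<otimes>\<^bsub>E\<^esub> u" unfolding e_def \<sigma>u using u ext.one_closed by algebra
  have uu: "val_ge E w 1 (u \<otimes>\<^bsub>E\<^esub> u)"
    using ext.val_ge_mult[OF u u ge ge] by (rule ext.val_ge_mono) simp
  have ege: "val_ge E w 1 e"
    unfolding e_eq using u ge uu by (intro ext.val_ge_minus) auto
  define y where "y = rec_nat \<zero>\<^bsub>E\<^esub> (\<lambda>_ z. z \<otimes>\<^bsub>E\<^esub> z \<oplus>\<^bsub>E\<^esub> e)"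
  have y0: "y 0 = \<zero>\<^bsub>E\<^esub>" and yS: "y (Suc n) = y n \<otimes>\<^bsub>E\<^esub> y n \<oplus>\<^bsub>E\<^esub> e" for n
    unfolding y_def by simp_all
  have yF: "y n \<in> carrier F" for n
  proof (induction n)
    case 0 then show ?case using base.zero_closed by (simp add: y0 F_ops)
  next
    case (Suc n) then show ?case
      using base.a_closed[OF base.m_closed[OF Suc Suc] eF] by (simp add: yS F_ops)
  qed
  note yE = F_in_E[OF yF]
  have yge: "val_ge E w 1 (y n)" for n
  proof (induction n)
    case (Suc n)
    have "val_ge E w 1 (y n \<otimes>\<^bsub>E\<^esub> y n)"
      using ext.val_ge_mult[OF yE yE Suc Suc] by (rule ext.val_ge_mono) simp
    then show ?case unfolding yS using yE F_in_E[OF eF] ege by (intro ext.val_ge_add) auto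
  qed (simp add: y0)
  have close: "val_ge E w (int n + 1) (u \<ominus>\<^bsub>E\<^esub> y n)" for n
  proof (induction n)
    case 0 then show ?case using u ge by (simp add: y0 a_minus_def)
  next
    case (Suc n)
    have "u \<ominus>\<^bsub>E\<^esub> y (Suc n) = (u \<ominus>\<^bsub>E\<^esub> y n) \<otimes>\<^bsub>E\<^esub> (u \<oplus>\<^bsub>E\<^esub> y n)"
      unfolding yS e_eq using u yE[of n] by algebra
    moreover have "val_ge E w (int n + 1 + 1) \<dots>"
      using u yE Suc ge yge by (intro ext.val_ge_mult ext.val_ge_add) auto
    ultimately show ?case by (simp add: add.commute)
  qed
  have diff: "val_ge E w N (y m \<ominus>\<^bsub>E\<^esub> y n)" if "N \<le> int m" "N \<le> int n" for N m n
  proof -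
    have "y m \<ominus>\<^bsub>E\<^esub> y n = (u \<ominus>\<^bsub>E\<^esub> y n) \<ominus>\<^bsub>E\<^esub> (u \<ominus>\<^bsub>E\<^esub> y m)"
      using u yE[of n] yE[of m] by algebra
    also have "val_ge E w N \<dots>"
      using that u yE by (intro ext.val_ge_minus ext.val_ge_mono[OF close]) auto
    finally show ?thesis .
  qed
  have "\<exists>x\<in>carrier F. \<forall>N. \<exists>M. \<forall>n\<ge>M. val_ge F v N (y n \<ominus>\<^bsub>F\<^esub> x)"
  proof (rule base.complete)
    show "range y \<subseteq> carrier F" using yF by auto
    show "\<forall>N. \<exists>M. \<forall>m\<ge>M. \<forall>n\<ge>M. val_ge F v N (y m \<ominus>\<^bsub>F\<^esub> y n)"
    proof
      fix N :: int
      have "val_ge F v N (y m \<ominus>\<^bsub>F\<^esub> y n)" if "m \<ge> nat N" "n \<ge> nat N" for m n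
        using diff[of N m n] that val_ge_F[OF base.minus_closed[OF yF yF]] by (simp add: F_minus yF)
      then show "\<exists>M. \<forall>m\<ge>M. \<forall>n\<ge>M. val_ge F v N (y m \<ominus>\<^bsub>F\<^esub> y n)" by blast
    qed
  qed
  then obtain x where xF: "x \<in> carrier F" and lim: "\<And>N. \<exists>M. \<forall>n\<ge>M. val_ge F v N (y n \<ominus>\<^bsub>F\<^esub> x)"
    by blast
  have "u \<ominus>\<^bsub>E\<^esub> x = \<zero>\<^bsub>E\<^esub>"
  proof (rule ext.val_ge_all_imp_zero)
    fix N :: int
    obtain M where M: "\<And>n. n \<ge> M \<Longrightarrow> val_ge F v N (y n \<ominus>\<^bsub>F\<^esub> x)" using lim by blast
    define n where "n = max M (nat N)"
    have "val_ge E w N (y n \<ominus>\<^bsub>E\<^esub> x)"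
      using M[of n] val_ge_F[OF base.minus_closed[OF yF xF]] by (simp add: F_minus xF n_def)
    moreover have "val_ge E w N (u \<ominus>\<^bsub>E\<^esub> y n)"
      by (rule ext.val_ge_mono[OF close]) (simp add: n_def)
    ultimately have "val_ge E w N ((u \<ominus>\<^bsub>E\<^esub> y n) \<oplus>\<^bsub>E\<^esub> (y n \<ominus>\<^bsub>E\<^esub> x))"
      using u yE F_in_E[OF xF] by (intro ext.val_ge_add) auto
    moreover have "(u \<ominus>\<^bsub>E\<^esub> y n) \<oplus>\<^bsub>E\<^esub> (y n \<ominus>\<^bsub>E\<^esub> x) = u \<ominus>\<^bsub>E\<^esub> x"
      using u yE[of n] F_in_E[OF xF] by algebra
    ultimately show "val_ge E w N (u \<ominus>\<^bsub>E\<^esub> x)" by simp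
  qed
  then have "u = x" using u F_in_E[OF xF] by simp
  then have "\<sigma> u = u" using galois_fixes xF by simp
  then have "val_ge E w 1 \<one>\<^bsub>E\<^esub>"
    using ext.val_ge_add[OF u u ge ge] tr by simp
  then show False using ext.val_one ext.one_not_zero by (simp add: val_ge_def)
qed

text \<open>
  An integral \<open>x\<close> with \<open>\<sigma> x\<close> not integral would have a trace \<open>T\<close> of negative valuation, and \<open>x / T\<close>
  would be an element of the maximal ideal of trace one.
\<close>

lemma galois_integral:
  assumes x: "x \<in> carrier E" and ge: "val_ge E w 0 x"
  shows "val_ge E w 0 (\<sigma> x)"
proof (rule ccontr)
  assume n: "\<not> val_ge E w 0 (\<sigma> x)"
  define T where "T = x \<oplus>\<^bsub>E\<^esub> \<sigma> x"
  have TF: "T \<in> carrier F" unfolding T_def by (rule galois_trace[OF x])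
  note TE = F_in_E[OF TF]
  have "\<sigma> x = T \<ominus>\<^bsub>E\<^esub> x" unfolding T_def using x gal.hom_closed[OF x] by algebra
  then have nT: "\<not> val_ge E w 0 T" using n ge x TE ext.val_ge_minus by metis
  then have T: "T \<noteq> \<zero>\<^bsub>E\<^esub>" "w T \<le> -1" by (auto simp: val_ge_def)
  note i = ext.val_ge_inv[OF TE T]
  have iF: "inv\<^bsub>E\<^esub> T \<in> carrier F"
    using ext.subfield_m_inv(1)[OF subfield, of T] TF T by auto
  define u where "u = x \<otimes>\<^bsub>E\<^esub> inv\<^bsub>E\<^esub> T"
  have u: "u \<in> carrier E" unfolding u_def using x i by simp
  have "val_ge E w 1 u" unfolding u_def using ext.val_ge_mult[OF x i(1) ge i(2)] by simp
  moreover have "u \<oplus>\<^bsub>E\<^esub> \<sigma> u = inv\<^bsub>E\<^esub> T \<otimes>\<^bsub>E\<^esub> T"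
  proof -
    have "\<sigma> u = \<sigma> x \<otimes>\<^bsub>E\<^esub> inv\<^bsub>E\<^esub> T"
      unfolding u_def using x i(1) iF by (simp add: galois_fixes)
    then have "u \<oplus>\<^bsub>E\<^esub> \<sigma> u = inv\<^bsub>E\<^esub> T \<otimes>\<^bsub>E\<^esub> (x \<oplus>\<^bsub>E\<^esub> \<sigma> x)"
      unfolding u_def using x i(1) gal.hom_closed[OF x] by algebra
    then show ?thesis by (simp only: T_def)
  qed
  ultimately show False using no_small_element_of_trace_one[OF u] i(3) by simp
qed

lemma quadratic_integers_valuation_rings:
  "quadratic_integers (valuation_ring F v) (valuation_ring E w) \<pi> \<sigma>"
proof (intro quadratic_integers.intro quadratic_integers_axioms.intro)
  let ?A = "valuation_ring F v" and ?B = "valuation_ring E w"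
  show dB: "domain ?B" by (rule ext.domain_Ov)
  interpret B: domain ?B by (rule dB)
  interpret A: domain ?A by (rule base.domain_Ov)
  have AB: "x \<in> carrier ?A \<longleftrightarrow> x \<in> carrier F \<and> x \<in> carrier ?B" for x
    using val_ge_F F_in_E by (auto simp: base.carrier_Ov ext.carrier_Ov)
  have "F\<lparr>carrier := X\<rparr> = E\<lparr>carrier := X\<rparr>" for X by (subst restrict) simp
  then show eq: "?A = ?B\<lparr>carrier := carrier ?A\<rparr>"
    by (simp add: valuation_ring_def)
  have neg: "\<ominus>\<^bsub>?A\<^esub> h = \<ominus>\<^bsub>?B\<^esub> h" if "h \<in> carrier ?A" for h
    using A.l_neg[OF that] A.a_inv_closed[OF that] that AB
    by (intro B.minus_equality[symmetric]) (auto simp: base.Ov_ops ext.Ov_ops F_ops)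
  show "subring (carrier ?A) ?B"
  proof (rule B.subringI)
    show "\<one>\<^bsub>?B\<^esub> \<in> carrier ?A" using A.one_closed by (simp add: base.Ov_ops ext.Ov_ops F_ops)
    show "\<ominus>\<^bsub>?B\<^esub> h \<in> carrier ?A" if "h \<in> carrier ?A" for h
      using A.a_inv_closed[OF that] neg[OF that] by simp
    show "h1 \<otimes>\<^bsub>?B\<^esub> h2 \<in> carrier ?A" "h1 \<oplus>\<^bsub>?B\<^esub> h2 \<in> carrier ?A"
      if "h1 \<in> carrier ?A" "h2 \<in> carrier ?A" for h1 h2
      using A.m_closed[OF that] A.a_closed[OF that] by (simp_all add: base.Ov_ops ext.Ov_ops F_ops)
  qed (auto simp: AB)
  show "\<pi> \<in> carrier ?A" by (rule base.uniformizer_Ov)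
  show "\<sigma> \<in> ring_hom ?B ?B"
    by (rule ring_hom_memI) (auto simp: ext.carrier_Ov ext.Ov_ops galois_integral)
  show "\<sigma> (\<sigma> x) = x" if "x \<in> carrier ?B" for x
    using that galois_involution by (simp add: ext.carrier_Ov)
  show "\<sigma> x = x" if "x \<in> carrier ?A" for x
    using that galois_fixes by (simp add: base.carrier_Ov)
  show "x \<oplus>\<^bsub>?B\<^esub> \<sigma> x \<in> carrier ?A" if "x \<in> carrier ?B" for x
    using that galois_trace[of x] galois_integral[of x] ext.val_ge_add[of x "\<sigma> x" 0]
    by (simp add: AB ext.carrier_Ov ext.Ov_ops)
  show "x \<otimes>\<^bsub>?B\<^esub> \<sigma> x \<in> carrier ?A" if "x \<in> carrier ?B" for x
    using that galois_norm[of x] galois_integral[of x] ext.val_ge_mult[of x "\<sigma> x" 0 0]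
    by (simp add: AB ext.carrier_Ov ext.Ov_ops)
  show "x \<in> carrier ?A" if x: "x \<in> carrier ?B" and px: "\<pi> \<otimes>\<^bsub>?B\<^esub> x \<in> carrier ?A" for x
  proof -
    have xE: "x \<in> carrier E" using x by (simp add: ext.carrier_Ov)
    have \<pi>: "\<pi> \<in> carrier E" "\<pi> \<noteq> \<zero>\<^bsub>E\<^esub>" "w \<pi> \<le> 1"
      using ext.uniformizer_carrier ext.uniformizer_val by auto
    note i = ext.val_ge_inv[OF \<pi>]
    have iF: "inv\<^bsub>E\<^esub> \<pi> \<in> carrier F"
      using ext.subfield_m_inv(1)[OF subfield, of \<pi>] base.uniformizer_carrier by (simp add: F_ops)
    have "inv\<^bsub>E\<^esub> \<pi> \<otimes>\<^bsub>F\<^esub> (\<pi> \<otimes>\<^bsub>E\<^esub> x) \<in> carrier F"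
      using iF px by (intro base.m_closed) (auto simp: AB ext.Ov_ops)
    moreover have "inv\<^bsub>E\<^esub> \<pi> \<otimes>\<^bsub>E\<^esub> (\<pi> \<otimes>\<^bsub>E\<^esub> x) = x"
      using i \<pi> xE by (simp flip: ext.m_assoc)
    ultimately show ?thesis using x by (simp add: AB F_ops)
  qed
  show "x \<in> PIdl\<^bsub>?B\<^esub> \<pi> \<or> y \<in> PIdl\<^bsub>?B\<^esub> \<pi>"
    if x: "x \<in> carrier ?B" and y: "y \<in> carrier ?B" and xy: "x \<otimes>\<^bsub>?B\<^esub> y \<in> PIdl\<^bsub>?B\<^esub> \<pi>" for x y
    using xy ext.val_ge_mult_cases[OF x y] ext.PIdl_Ov_iff[OF B.m_closed[OF x y]]
      ext.PIdl_Ov_iff[OF x] ext.PIdl_Ov_iff[OF y] by (simp add: ext.Ov_ops)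
  show "x \<in> Units ?A" if x: "x \<in> carrier ?A" and n: "x \<notin> PIdl\<^bsub>?A\<^esub> \<pi>" for x
    using base.Units_OvI[OF x] base.PIdl_Ov_iff[OF x] n by blast
  show "finite (carrier (?A Quot PIdl\<^bsub>?A\<^esub> \<pi>))" by (rule base.finite_residue_field)
qed

end

section \<open>Vanishing of the cuspidal character on diagonal matrices\<close>

theorem proposition12:
  fixes F E A B :: "'a ring" and v w :: "'a \<Rightarrow> int" and \<pi> :: 'a and \<sigma> :: "'a \<Rightarrow> 'a"
    and r i :: nat and \<psi> :: "'a \<Rightarrow> complex" and \<nu> \<nu>' :: "'a set \<Rightarrow> complex"
    and \<tau> \<tau>_hat \<alpha> \<delta> :: "'a set"
  assumes "unramified_quadratic_extension F v \<pi> E w \<sigma>"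
    and "residue_characteristic F v \<pi> \<noteq> 2"
    and "A = valuation_ring F v" and "B = valuation_ring E w"
    and "even r" and "2 \<le> r"
    and "additive_character_of_level A \<pi> r \<psi>"
    and "regular_couple B \<pi> \<sigma> r \<nu> \<nu>'"
    and "associated_element A B \<pi> \<sigma> r \<psi> \<nu> \<nu>' \<tau>"
    and "\<tau>_hat \<in> carrier (trunc B \<pi> r)"
    and "trunc_map B \<pi> (r div 2) (\<lambda>x. x) \<tau>_hat = \<tau>"
    and "i \<le> r - 1"
    and "\<alpha> \<in> Units (trunc A \<pi> r)" and "\<delta> \<in> Units (trunc A \<pi> r)"
    and "\<exists>u\<in>Units (trunc A \<pi> r). \<alpha> \<ominus>\<^bsub>trunc A \<pi> r\<^esub> \<delta> =
           trunc_class A \<pi> r (\<pi> [^]\<^bsub>A\<^esub> i) \<otimes>\<^bsub>trunc A \<pi> r\<^esub> u"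
  shows "cuspidal_character A B \<pi> \<sigma> r \<psi> \<nu> \<nu>' \<tau>_hat
           (Mat2 \<alpha> \<zero>\<^bsub>trunc A \<pi> r\<^esub> \<zero>\<^bsub>trunc A \<pi> r\<^esub> \<delta>) = 0"
proof -
  interpret U: unramified_quadratic_extension F v \<pi> E w \<sigma> by fact
  interpret Q: quadratic_integers A B \<pi> \<sigma>
    using U.quadratic_integers_valuation_rings by (simp add: \<open>A = _\<close> \<open>B = _\<close>)
  obtain t where t: "t \<in> carrier B" and \<tau>_hat: "\<tau>_hat = trunc_class B \<pi> r t"
    using \<open>\<tau>_hat \<in> _\<close> unfolding Q.Bt.carrier_trunc by blast
  have \<tau>: "\<tau> = trunc_class B \<pi> (r div 2) t"
    using \<open>trunc_map B \<pi> (r div 2) (\<lambda>x. x) \<tau>_hat = \<tau>\<close> Q.trunc_map_reduce_class[OF t, of "r div 2" r]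
    unfolding \<tau>_hat by simp
  interpret D: cuspidal_datum A B \<pi> \<sigma> r "r div 2" \<psi> \<nu> \<nu>' t
  proof
    show "r = r div 2 + r div 2" "0 < r div 2" using \<open>even r\<close> \<open>2 \<le> r\<close> by auto
    show "associated_element A B \<pi> \<sigma> r \<psi> \<nu> \<nu>' (trunc_class B \<pi> (r div 2) t)"
      using \<open>associated_element A B \<pi> \<sigma> r \<psi> \<nu> \<nu>' \<tau>\<close> unfolding \<tau> .
  qed fact+
  obtain u where "u \<in> Units (trunc A \<pi> r)"
    and "\<alpha> \<ominus>\<^bsub>trunc A \<pi> r\<^esub> \<delta> = trunc_class A \<pi> r (\<pi> [^]\<^bsub>A\<^esub> i) \<otimes>\<^bsub>trunc A \<pi> r\<^esub> u"
    using assms(15) by blast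
  then show ?thesis
    unfolding \<tau>_hat
    using D.cuspidal_character_diagonal \<open>i \<le> r - 1\<close> \<open>\<alpha> \<in> _\<close> \<open>\<delta> \<in> _\<close> by blast
qed

end
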